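(* Let $\kappa>0$, $\alpha\in[0,1]$ and $\beta\in(0,1)$ be constants with $\alpha<\beta$. Suppose $\lambda_j=j^{-\kappa}$ for all $j=1,\dots,N$, that $p/N\to\alpha$ and $n/N\to\beta$ as $p,n,N\to\infty$, and that there is no noise ($\sigma^2=0$). Define, for $a<\beta$, $$h_\kappa(a):=\frac{\beta}{a}-\int_a^1 t^{\kappa-2}\,dt-1,\qquad \mathcal R_\kappa(a):=N^{1-\kappa}\int_a^1 t^{-\kappa}\,dt\cdot\frac{\beta}{\beta-a}.$$ Then $$\mathbb E_{\theta}[\mathrm{Error}]\ \xrightarrow{\ \mathrm p\ }\ \mathcal R_\kappa(\alpha).$$ Furthermore, the equation $h_\kappa(a)=0$ has a unique solution $\alpha^*$ over the interval $(0,\beta)$, and $\mathcal R_\kappa(a)$ is decreasing on $a\in[0,\alpha^* )$ and increasing on $a\in(\alpha^*,\beta)$. Finally, $$\mathcal R_\kappa(\alpha^* )=\min_{0\le a<\beta}\mathcal R_\kappa(a)=N^{1-\kappa}\frac{\beta}{(\alpha^* )^\kappa}.$$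
   Context: Data model. For each $N$, let $\Sigma=\mathrm{diag}(\lambda_1,\dots,\lambda_N)$ with $\lambda_1>\dots>\lambda_N>0$. The data $(x_1,y_1),\dots,(x_n,y_n)\in\mathbb R^N\times\mathbb R$ are i.i.d. (given $\theta$) with $x_i\sim\mathcal N(0,\Sigma)$ and $y_i=x_i^\top\theta+w_i$, where the $w_i$ are i.i.d. $\mathcal N(0,\sigma^2)$ noise variables. The coefficient vector $\theta\in\mathbb R^N$ is independently drawn from a distribution with $\mathbb E[\theta]=0$ and $\mathbb E[\theta\theta^\top]=I$. Estimator. Let $X=[x_1|\cdots|x_n]^\top\in\mathbb R^{n\times N}$, $y=(y_1,\dots,y_n)^\top$. Let $X_P\in\mathbb R^{n\times p}$ be the first $p$ columns of $X$; for a vector $v\in\mathbb R^N$, $v_P\in\mathbb R^p$ denotes its first $p$ entries and $v_{P^c}$ its last $N-p$ entries. The estimator $\hat\theta\in\mathbb R^N$ is defined by $\hat\theta_P=(X_P^\top X_P)^{-1}X_P^\top y$ if $p\le n$, $\hat\theta_P=X_P^\top(X_PX_P^\top)^{-1}y$ if $p>n$, and $\hat\theta_{P^c}=0$ (the inverses exist with probability 1). Error. $\mathrm{Error}:=\mathbb E_{x,y}[(y-x^\top\hat\theta)^2]$, where $(x,y)$ is an independent copy of $(x_1,y_1)$ (with the same $\theta$). $\mathbb E_\theta[\mathrm{Error}]$ is the expectation over $\theta$ conditional on $X$, so it is a random variable depending on $X$. Convergence notation. $A\xrightarrow{\mathrm p}B$ means $A=B+o_{\mathrm p}(B)$ as $n,p,N\to\infty$.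 *)

theory Defs
  imports "HOL-Probability.Probability" "Jordan_Normal_Form.Gauss_Jordan_Elimination"
begin

(* Vectors and matrices are those of Jordan_Normal_Form, since their dimensions vary along the
   asymptotics. These carry no measurable structure, so random vectors (matrices) are represented
   by their entry functions in product measure spaces. Coordinates are 0-based: coordinate j of a
   covariate has variance lam (Suc j), where lam 1, ..., lam N are the eigenvalues of the
   diagonal covariance matrix. *)

(* Gaussian with mean 0 and variance v >= 0; a point mass at 0 for v = 0. *)
definition centered_normal :: "real \<Rightarrow> real measure" where
  "centered_normal v = distr std_normal_distribution borel (\<lambda>z. sqrt v * z)"

(* For a diagonal covariance matrix the multivariate Gaussian is the product of its marginals. *)
definition covariate_law :: "nat \<Rightarrow> (nat \<Rightarrow> real) \<Rightarrow> (nat \<Rightarrow> real) measure" where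
  "covariate_law N lam = (\<Pi>\<^sub>M j\<in>{..<N}. centered_normal (lam (Suc j)))"

definition design_law :: "nat \<Rightarrow> nat \<Rightarrow> (nat \<Rightarrow> real) \<Rightarrow> (nat \<Rightarrow> nat \<Rightarrow> real) measure" where
  "design_law n N lam = (\<Pi>\<^sub>M i\<in>{..<n}. covariate_law N lam)"

definition noise_law :: "nat \<Rightarrow> real \<Rightarrow> (nat \<Rightarrow> real) measure" where
  "noise_law n \<sigma> = (\<Pi>\<^sub>M i\<in>{..<n}. centered_normal (\<sigma>\<^sup>2))"

definition isotropic_law :: "nat \<Rightarrow> (nat \<Rightarrow> real) measure \<Rightarrow> bool" where
  "isotropic_law N T \<longleftrightarrow>
     prob_space T \<and> sets T = sets (\<Pi>\<^sub>M j\<in>{..<N}. borel) \<and>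
     (\<forall>j<N. integrable T (\<lambda>\<theta>. \<theta> j) \<and> (\<integral>\<theta>. \<theta> j \<partial>T) = 0) \<and>
     (\<forall>i<N. \<forall>j<N. integrable T (\<lambda>\<theta>. \<theta> i * \<theta> j) \<and>
                  (\<integral>\<theta>. \<theta> i * \<theta> j \<partial>T) = (if i = j then 1 else 0))"

(* Matrix inverse, with a junk value for singular matrices. *)
definition inv_mat :: "real Matrix.mat \<Rightarrow> real Matrix.mat" where
  "inv_mat A = (case mat_inverse A of Some B \<Rightarrow> B | None \<Rightarrow> 0\<^sub>m (dim_row A) (dim_col A))"

definition first_cols :: "nat \<Rightarrow> real Matrix.mat \<Rightarrow> real Matrix.mat" where
  "first_cols p X = Matrix.mat (dim_row X) p (\<lambda>(i, j). X $$ (i, j))"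

definition estimator :: "nat \<Rightarrow> real Matrix.mat \<Rightarrow> real Matrix.vec \<Rightarrow> real Matrix.vec" where
  "estimator p X y =
     (let n = dim_row X; N = dim_col X; XP = first_cols p X; XPt = transpose_mat XP in
        (if p \<le> n then (inv_mat (XPt * XP) * XPt) *\<^sub>v y
         else (XPt * inv_mat (XP * XPt)) *\<^sub>v y) @\<^sub>v 0\<^sub>v (N - p))"

definition response ::
    "nat \<Rightarrow> real Matrix.mat \<Rightarrow> real Matrix.vec \<Rightarrow> (nat \<Rightarrow> real) \<Rightarrow> real Matrix.vec" where
  "response n X \<theta> w = X *\<^sub>v \<theta> + Matrix.vec n w"

(* The integral is over a fresh covariate x and a fresh noise variable w, so that
   y = <x, theta> + w. *)
definition pred_error ::
    "nat \<Rightarrow> (nat \<Rightarrow> real) \<Rightarrow> real \<Rightarrow> real Matrix.vec \<Rightarrow> real Matrix.vec \<Rightarrow> real" where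
  "pred_error N lam \<sigma> \<theta> \<theta>hat =
     (\<integral>(x, w). ((scalar_prod (Matrix.vec N x) \<theta> + w) - scalar_prod (Matrix.vec N x) \<theta>hat)\<^sup>2
        \<partial>(covariate_law N lam \<Otimes>\<^sub>M centered_normal (\<sigma>\<^sup>2)))"

(* Error averaged conditionally on the design X: the coefficients theta (with law T) and the
   training noise w are independent of X, so their conditional law is the product below. *)
definition mean_error ::
    "nat \<Rightarrow> nat \<Rightarrow> nat \<Rightarrow> (nat \<Rightarrow> real) \<Rightarrow> real \<Rightarrow> (nat \<Rightarrow> real) measure
      \<Rightarrow> (nat \<Rightarrow> nat \<Rightarrow> real) \<Rightarrow> real" where
  "mean_error n p N lam \<sigma> T x =
     (let X = Matrix.mat n N (\<lambda>(i, j). x i j) in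
       \<integral>(\<theta>, w). pred_error N lam \<sigma> (Matrix.vec N \<theta>)
                   (estimator p X (response n X (Matrix.vec N \<theta>) w))
         \<partial>(T \<Otimes>\<^sub>M noise_law n \<sigma>))"

(* A = B + o_p(B) for random variables A k on M k and deterministic B k. *)
definition conv_p :: "(nat \<Rightarrow> 'a measure) \<Rightarrow> (nat \<Rightarrow> 'a \<Rightarrow> real) \<Rightarrow> (nat \<Rightarrow> real) \<Rightarrow> bool" where
  "conv_p M A B \<longleftrightarrow>
     (\<forall>\<epsilon>>0. (\<lambda>k. \<P>(\<omega> in M k. \<bar>A k \<omega> - B k\<bar> \<le> \<epsilon> * \<bar>B k\<bar>)) \<longlonglongrightarrow> 1)"

definition h_fun :: "real \<Rightarrow> real \<Rightarrow> real \<Rightarrow> real" where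
  "h_fun \<kappa> \<beta> a = \<beta> / a - (LBINT t:{a..1}. t powr (\<kappa> - 2)) - 1"

(* The risk is extended-valued: the integral is infinite for a = 0 and kappa >= 1.
   risk_coeff is the factor of the risk that does not depend on N. *)
definition risk_coeff :: "real \<Rightarrow> real \<Rightarrow> real \<Rightarrow> ennreal" where
  "risk_coeff \<kappa> \<beta> a =
     (\<integral>\<^sup>+t\<in>{a..1}. ennreal (t powr (- \<kappa>)) \<partial>lborel) * ennreal (\<beta> / (\<beta> - a))"

definition risk :: "real \<Rightarrow> real \<Rightarrow> nat \<Rightarrow> real \<Rightarrow> ennreal" where
  "risk \<kappa> \<beta> N a = ennreal (real N powr (1 - \<kappa>)) * risk_coeff \<kappa> \<beta> a"

end

theory Submission
  imports Defs "HOL-Real_Asymp.Real_Asymp"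
begin

text \<open>
  Write \<open>Z\<close> for the standardized design and \<open>P\<close> for the first \<open>p\<close> columns. Eventually \<open>p < n\<close>, and the
  error averaged over \<open>\<theta>\<close> is \<open>\<Sum>\<^bsub>j > p\<^esub> \<lambda>\<^sub>j (1 + R\<^sub>j)\<close>, where \<open>R\<^sub>j\<close> is the squared norm of the least-squares
  coefficients of column \<open>j\<close> on the columns in \<open>P\<close>. All \<open>R\<^sub>j\<close> have the same law, and two expectations
  are explicit: \<open>E R\<^sub>j = p / (n - p - 1) = c\<close>, since a diagonal entry of the inverse Gram matrix is the
  inverse of a squared residual; and \<open>E (1 / (1 + R\<^sub>j)) = 1 - p / (n + 1)\<close>, since a Gaussian duality between
  columns and rows turns \<open>1 / (1 + R\<^sub>j)\<close> into one minus a leverage of an \<open>(n + 1) \<times> p\<close> design, and the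
  \<open>n + 1\<close> leverages are exchangeable with sum \<open>p\<close>. As \<open>1 / (1 + r)\<close> is strictly convex, these values are
  compatible only if \<open>R\<^sub>j\<close> concentrates:
  \<open>E ((R\<^sub>j - c)\<^sup>2 / (1 + R\<^sub>j)) = 2 p (1 + c) / ((n + 1) (n - p - 1))\<close>. Hence \<open>E |R\<^sub>j - c|\<close> tends to 0, and
  Markov's inequality applies to the weighted sum.

  For the shape of the risk, \<open>- a\<^bsup>1-\<kappa>\<^esup> h(a)\<close> has the sign of the derivative of the risk and is strictly
  increasing.
\<close>

subsection \<open>Gaussian integrals\<close>


text \<open>The variance of \<open>R_j\<close> would call for second moments of inverse Wishart
  matrices. The function \<open>1 / (1 + r)\<close> is accessible instead through Laplace
  transforms, because \<open>exp (- t |K^T z|^2)\<close> and \<open>exp (- t |K g|^2)\<close> have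
  the same Gaussian expectation. The same transposition yields the inverse moment of a squared
  residual: it replaces a Gaussian vector seen through a projection by one whose dimension is the
  trace.

  All expectations are computed in \<open>ennreal\<close>, where the inverse of 0 is infinite.
  Tonelli then applies freely, and the finite inverse moment of a residual is itself what makes Gram
  matrices almost surely invertible.

  Columns are integrated out one at a time, so the inverse Gram matrix has to be a total measurable
  function that depends on the columns in \<open>P\<close> alone; it is built by bordering.

  For \<kappa> \<ge> 1 and \<alpha> = 0 the limit is infinite, and a deterministic lower bound on
  the error settles that case.\<close>

definition gauss :: "'a set \<Rightarrow> ('a \<Rightarrow> real) measure" where
  "gauss I = (\<Pi>\<^sub>M i\<in>I. std_normal_distribution)"

lemma prob_space_std_normal: "prob_space std_normal_distribution"
  using real_dist_normal_dist by (simp add: real_distribution_def)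

interpretation std_normal: prob_space std_normal_distribution
  by (rule prob_space_std_normal)

interpretation gauss: product_prob_space "\<lambda>_. std_normal_distribution" I for I :: "'a set"
  by unfold_locales

lemma sets_gauss [measurable_cong]: "sets (gauss I) = sets (\<Pi>\<^sub>M i\<in>I. borel)"
  unfolding gauss_def by (intro sets_PiM_cong) auto

lemma space_gauss: "space (gauss I) = I \<rightarrow>\<^sub>E UNIV"
  by (simp add: gauss_def space_PiM)

lemma measurable_gauss_component [measurable]:
  "i \<in> I \<Longrightarrow> (\<lambda>x. x i) \<in> borel_measurable (gauss I)"
  by (simp add: measurable_component_singleton cong: measurable_cong_sets[OF sets_gauss refl])

lemma prob_space_gauss: "prob_space (gauss I)"
  unfolding gauss_def by (intro prob_space_PiM prob_space_std_normal)

lemma nn_integral_gauss_insert: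
  assumes "finite I" "i \<notin> I" "f \<in> borel_measurable (gauss (insert i I))"
  shows "integral\<^sup>N (gauss (insert i I)) f
       = (\<integral>\<^sup>+ y. (\<integral>\<^sup>+ x. f (x(i := y)) \<partial>gauss I) \<partial>std_normal_distribution)"
  using gauss.product_nn_integral_insert_rev[OF assms[unfolded gauss_def]]
  by (simp add: gauss_def)

lemma nn_integral_gauss_union:
  assumes "I \<inter> J = {}" "finite I" "finite J" "f \<in> borel_measurable (gauss (I \<union> J))"
  shows "integral\<^sup>N (gauss (I \<union> J)) f
       = (\<integral>\<^sup>+ x. (\<integral>\<^sup>+ y. f (merge I J (x, y)) \<partial>gauss J) \<partial>gauss I)"
  using gauss.product_nn_integral_fold[OF assms[unfolded gauss_def]]
  by (simp add: gauss_def)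

text \<open>This is the exchangeability of the coordinates; it serves to swap two rows of a
  design.\<close>

lemma nn_integral_gauss_reindex:
  assumes "bij_betw \<pi> I I" "f \<in> borel_measurable (gauss I)"
  shows "(\<integral>\<^sup>+ x. f (\<lambda>i\<in>I. x (\<pi> i)) \<partial>gauss I) = integral\<^sup>N (gauss I) f"
proof -
  have "distr (gauss I) (gauss I) (\<lambda>x. \<lambda>i\<in>I. x (\<pi> i)) = gauss I"
    unfolding gauss_def
    by (rule distr_PiM_reindex) (use assms(1) in \<open>auto simp: bij_betw_def prob_space_std_normal\<close>)
  moreover have "(\<lambda>x. \<lambda>i\<in>I. x (\<pi> i)) \<in> gauss I \<rightarrow>\<^sub>M gauss I"
    unfolding gauss_def
    by (intro measurable_restrict measurable_component_singleton) (use assms(1) in \<open>auto simp: bij_betw_def\<close>)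
  ultimately show ?thesis
    using nn_integral_distr[of "\<lambda>x. \<lambda>i\<in>I. x (\<pi> i)" "gauss I" "gauss I" f] assms(2) by simp
qed

lemma nn_integral_std_normal_affine_square:
  fixes s a :: real
  shows "(\<integral>\<^sup>+ y. ennreal ((s + a * y)\<^sup>2) \<partial>std_normal_distribution) = ennreal (s\<^sup>2 + a\<^sup>2)"
proof -
  have i1: "integrable std_normal_distribution (\<lambda>x. x)" "(\<integral>x. x \<partial>std_normal_distribution) = 0"
    using integrable_std_normal_distribution_moment[of 1] integral_std_normal_distribution_moment_odd[of 1]
    by auto
  have i2: "integrable std_normal_distribution (\<lambda>x. x\<^sup>2)" "(\<integral>x. x\<^sup>2 \<partial>std_normal_distribution) = 1"
    using std_normal_distribution_even_moments[of 1] by (auto simp: fact_numeral)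
  have eq: "(s + a * y)\<^sup>2 = s\<^sup>2 + 2 * s * a * y + a\<^sup>2 * y\<^sup>2" for y
    by (simp add: power2_eq_square algebra_simps)
  have int: "integrable std_normal_distribution (\<lambda>y. (s + a * y)\<^sup>2)"
    unfolding eq using i1 i2 by (intro Bochner_Integration.integrable_add integrable_mult_right) auto
  have "(\<integral>y. (s + a * y)\<^sup>2 \<partial>std_normal_distribution) = s\<^sup>2 + a\<^sup>2"
    unfolding eq using i1 i2 std_normal.prob_space by simp
  then show ?thesis
    using nn_integral_eq_integral[OF int] by simp
qed

text \<open>The offset \<open>s\<close> carries the induction: while the remaining coordinates are
  integrated, the coordinate held fixed is absorbed into it.\<close>

lemma nn_integral_gauss_affine_square:
  assumes "finite I"
  shows "(\<integral>\<^sup>+ x. ennreal ((s + (\<Sum>i\<in>I. a i * x i))\<^sup>2) \<partial>gauss I) = ennreal (s\<^sup>2 + (\<Sum>i\<in>I. (a i)\<^sup>2))"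
  using assms
proof (induction I arbitrary: s rule: finite_induct)
  case empty
  then show ?case by (simp add: prob_space.emeasure_space_1[OF prob_space_gauss])
next
  case (insert j J)
  have meas: "(\<lambda>x. ennreal ((s + (\<Sum>i\<in>insert j J. a i * x i))\<^sup>2)) \<in> borel_measurable (gauss (insert j J))"
    by (intro measurable_compose[OF _ measurable_ennreal] borel_measurable_power borel_measurable_add
        borel_measurable_sum borel_measurable_times borel_measurable_const measurable_gauss_component)
  have upd: "s + (\<Sum>i\<in>insert j J. a i * (x(j := y)) i) = (s + a j * y) + (\<Sum>i\<in>J. a i * x i)" for x y
  proof -
    have "(\<Sum>i\<in>J. a i * (x(j := y)) i) = (\<Sum>i\<in>J. a i * x i)"
      by (intro sum.cong) (use insert.hyps in auto)
    then show ?thesis using insert.hyps by simp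
  qed
  have one: "emeasure std_normal_distribution UNIV = 1"
    using std_normal.emeasure_space_1 by (simp add: space_density)
  have "(\<integral>\<^sup>+ x. ennreal ((s + (\<Sum>i\<in>insert j J. a i * x i))\<^sup>2) \<partial>gauss (insert j J))
      = (\<integral>\<^sup>+ y. ennreal ((s + a j * y)\<^sup>2 + (\<Sum>i\<in>J. (a i)\<^sup>2)) \<partial>std_normal_distribution)"
    by (subst nn_integral_gauss_insert[OF insert.hyps meas], subst upd, subst insert.IH) simp
  also have "\<dots> = (\<integral>\<^sup>+ y. ennreal ((s + a j * y)\<^sup>2) \<partial>std_normal_distribution) + ennreal (\<Sum>i\<in>J. (a i)\<^sup>2)"
    by (subst ennreal_plus) (auto simp: sum_nonneg nn_integral_add one)
  also have "\<dots> = ennreal (s\<^sup>2 + (\<Sum>i\<in>insert j J. (a i)\<^sup>2))"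
    using insert.hyps by (simp add: nn_integral_std_normal_affine_square sum_nonneg add.assoc flip: ennreal_plus)
  finally show ?case .
qed

lemma char_gauss:
  assumes "finite J"
  shows "(\<integral>g. exp (\<i> * complex_of_real (\<Sum>j\<in>J. u j * g j)) \<partial>gauss J)
       = complex_of_real (exp (- (\<Sum>j\<in>J. (u j)\<^sup>2) / 2))"
proof -
  have "(\<integral>g. exp (\<i> * complex_of_real (\<Sum>j\<in>J. u j * g j)) \<partial>gauss J)
      = (\<integral>g. (\<Prod>j\<in>J. iexp (u j * g j)) \<partial>gauss J)"
    by (simp add: exp_sum[OF assms] sum_distrib_left flip: of_real_mult)
  also have "\<dots> = (\<Prod>j\<in>J. (\<integral>y. iexp (u j * y) \<partial>std_normal_distribution))"
    unfolding gauss_def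
    by (intro gauss.product_integral_prod assms std_normal.integrable_const_bound[where B=1]) auto
  also have "\<dots> = (\<Prod>j\<in>J. complex_of_real (exp (- ((u j)\<^sup>2) / 2)))"
    using char_std_normal_distribution by (intro prod.cong refl) (simp add: char_def fun_eq_iff)
  also have "\<dots> = complex_of_real (exp (- (\<Sum>j\<in>J. (u j)\<^sup>2) / 2))"
    by (simp add: exp_sum[OF assms, symmetric] sum_negf sum_divide_distrib flip: of_real_prod)
  finally show ?thesis .
qed

text \<open>Linearization: \<open>exp (- |K\<^sup>T z|\<^sup>2 / 2)\<close> is the expectation over \<open>g\<close> of \<open>exp (i z\<^sup>T K g)\<close>, so both
  sides are the same double integral.\<close>

lemma integral_gauss_exp_transpose:
  fixes K :: "'a \<Rightarrow> 'b \<Rightarrow> real"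
  assumes "finite A" "finite B"
  shows "(\<integral>z. exp (- (\<Sum>b\<in>B. (\<Sum>a\<in>A. K a b * z a)\<^sup>2) / 2) \<partial>gauss A)
       = (\<integral>g. exp (- (\<Sum>a\<in>A. (\<Sum>b\<in>B. K a b * g b)\<^sup>2) / 2) \<partial>gauss B)"
proof -
  interpret A: prob_space "gauss A" by (rule prob_space_gauss)
  interpret B: prob_space "gauss B" by (rule prob_space_gauss)
  interpret AB: pair_prob_space "gauss A" "gauss B" by unfold_locales
  let ?f = "\<lambda>z g. exp (\<i> * complex_of_real (\<Sum>a\<in>A. \<Sum>b\<in>B. K a b * z a * g b))"
  have int: "integrable (gauss A \<Otimes>\<^sub>M gauss B) (\<lambda>(z, g). ?f z g)"
  proof (rule AB.integrable_const_bound[where B=1])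
    show "(\<lambda>(z, g). ?f z g) \<in> borel_measurable (gauss A \<Otimes>\<^sub>M gauss B)"
      by measurable
  qed (auto intro!: AE_I2)
  have 1: "(\<integral>g. ?f z g \<partial>gauss B) = complex_of_real (exp (- (\<Sum>b\<in>B. (\<Sum>a\<in>A. K a b * z a)\<^sup>2) / 2))" for z
  proof -
    have "(\<Sum>a\<in>A. \<Sum>b\<in>B. K a b * z a * g b) = (\<Sum>b\<in>B. (\<Sum>a\<in>A. K a b * z a) * g b)" for g
      by (subst sum.swap) (simp add: sum_distrib_right)
    then show ?thesis by (simp only: char_gauss[OF assms(2)])
  qed
  have 2: "(\<integral>z. ?f z g \<partial>gauss A) = complex_of_real (exp (- (\<Sum>a\<in>A. (\<Sum>b\<in>B. K a b * g b)\<^sup>2) / 2))" for g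
  proof -
    have "(\<Sum>a\<in>A. \<Sum>b\<in>B. K a b * z a * g b) = (\<Sum>a\<in>A. (\<Sum>b\<in>B. K a b * g b) * z a)" for z
      by (simp add: sum_distrib_left mult_ac)
    then show ?thesis by (simp only: char_gauss[OF assms(1)])
  qed
  have "(\<integral>g. (\<integral>z. ?f z g \<partial>gauss A) \<partial>gauss B) = (\<integral>z. (\<integral>g. ?f z g \<partial>gauss B) \<partial>gauss A)"
    by (rule AB.Fubini_integral[OF int])
  then show ?thesis
    unfolding 1 2 by simp
qed

lemma nn_integral_gauss_exp_transpose:
  fixes K :: "'a \<Rightarrow> 'b \<Rightarrow> real"
  assumes "finite A" "finite B" "t \<ge> 0"
  shows "(\<integral>\<^sup>+ z. ennreal (exp (- (t * (\<Sum>b\<in>B. (\<Sum>a\<in>A. K a b * z a)\<^sup>2)))) \<partial>gauss A)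
       = (\<integral>\<^sup>+ g. ennreal (exp (- (t * (\<Sum>a\<in>A. (\<Sum>b\<in>B. K a b * g b)\<^sup>2)))) \<partial>gauss B)"
proof -
  interpret A: prob_space "gauss A" by (rule prob_space_gauss)
  interpret B: prob_space "gauss B" by (rule prob_space_gauss)
  \<comment> \<open>The factor absorbs both the parameter \<open>t\<close> and the 1/2 in the
    exponent of the Gaussian characteristic function.\<close>
  define L where "L a b = sqrt (2 * t) * K a b" for a b
  have sq: "(sqrt (2 * t) * r)\<^sup>2 = 2 * t * r\<^sup>2" for r
    using assms(3) by (simp add: power_mult_distrib)
  have 1: "(\<Sum>b\<in>B. (\<Sum>a\<in>A. L a b * z a)\<^sup>2) / 2 = t * (\<Sum>b\<in>B. (\<Sum>a\<in>A. K a b * z a)\<^sup>2)" for z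
    by (simp add: L_def sum_distrib_left[symmetric] mult.assoc sq)
  have 2: "(\<Sum>a\<in>A. (\<Sum>b\<in>B. L a b * g b)\<^sup>2) / 2 = t * (\<Sum>a\<in>A. (\<Sum>b\<in>B. K a b * g b)\<^sup>2)" for g
    by (simp add: L_def sum_distrib_left[symmetric] mult.assoc sq)
  have nonneg: "t * (\<Sum>b\<in>B'. (f b)\<^sup>2) \<ge> 0" for f :: "'c \<Rightarrow> real" and B'
    using assms(3) by (simp add: sum_nonneg)
  have "integrable (gauss A) (\<lambda>z. exp (- (t * (\<Sum>b\<in>B. (\<Sum>a\<in>A. K a b * z a)\<^sup>2))))"
    using nonneg by (intro A.integrable_const_bound[where B=1]) (auto intro!: AE_I2)
  moreover have "integrable (gauss B) (\<lambda>g. exp (- (t * (\<Sum>a\<in>A. (\<Sum>b\<in>B. K a b * g b)\<^sup>2))))"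
    using nonneg by (intro B.integrable_const_bound[where B=1]) (auto intro!: AE_I2)
  ultimately show ?thesis
    using integral_gauss_exp_transpose[OF assms(1,2), of L] 
    by (simp add: nn_integral_eq_integral 1 2 minus_divide_left[symmetric])
qed

section \<open>Inverse moments through Laplace transforms\<close>

lemma ennreal_inverse_eq_nn_integral_exp:
  fixes r :: real
  assumes "r \<ge> 0"
  shows "(\<integral>\<^sup>+ t. ennreal (exp (- (t * r))) * indicator {0..} t \<partial>lborel) = inverse (ennreal r)"
\<comment> \<open>For \<open>r = 0\<close> both sides are infinite. Including this case frees the
  later inverse moments from nondegeneracy hypotheses, so that their finiteness can prove
  nondegeneracy.\<close>
proof (cases "r = 0")
  case True
  have "(\<integral>\<^sup>+ t. indicator {0::real..} t \<partial>lborel) = emeasure lborel {0::real..}"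
    by simp
  also have "\<dots> = \<infinity>"
  proof (rule ccontr)
    assume "emeasure lborel {0::real..} \<noteq> \<infinity>"
    then obtain c where c: "emeasure lborel {0::real..} = ennreal c" "c \<ge> 0"
      by (metis ennreal_cases infinity_ennreal_def)
    have "emeasure lborel {0..c+1} \<le> emeasure lborel {0::real..}"
      by (rule emeasure_mono) auto
    then show False using c by simp
  qed
  finally show ?thesis using True by simp
next
  case False
  then have r: "r > 0" using assms by simp
  have "(\<integral>\<^sup>+ t. ennreal (exp (- (t * r))) * indicator {0..} t \<partial>lborel) = ennreal (0 - (- exp (- (0 * r)) / r))"
  proof (rule nn_integral_FTC_atLeast)
    show "((\<lambda>t. - exp (- (t * r)) / r) has_real_derivative exp (- (x * r))) (at x)" for x
      using r by (auto intro!: derivative_eq_intros)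
    have "((\<lambda>t. exp (- (t * r))) \<longlongrightarrow> 0) at_top"
      using r by real_asymp
    then show "((\<lambda>t. - exp (- (t * r)) / r) \<longlongrightarrow> 0) at_top"
      using tendsto_divide[OF tendsto_minus, of "\<lambda>t. exp (- (t * r))" 0 at_top "\<lambda>_. r" r] r by simp
  qed auto
  then show ?thesis using r by (simp add: inverse_ennreal divide_inverse)
qed

text \<open>Tonelli trades the inverse for exponentials, which factor over independent coordinates
  and obey the transposition identity.\<close>

lemma nn_integral_inverse_eq_Laplace:
  assumes "sigma_finite_measure M" and [measurable]: "f \<in> borel_measurable M" and "\<And>x. f x \<ge> 0"
  shows "(\<integral>\<^sup>+ x. inverse (ennreal (f x)) \<partial>M)
       = (\<integral>\<^sup>+ t. (\<integral>\<^sup>+ x. ennreal (exp (- (t * f x))) \<partial>M) * indicator {0..} t \<partial>lborel)"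
proof -
  interpret M: sigma_finite_measure M by fact
  interpret pair_sigma_finite M lborel by unfold_locales
  have "(\<integral>\<^sup>+ x. inverse (ennreal (f x)) \<partial>M)
      = (\<integral>\<^sup>+ x. (\<integral>\<^sup>+ t. ennreal (exp (- (t * f x))) * indicator {0..} t \<partial>lborel) \<partial>M)"
    by (simp only: ennreal_inverse_eq_nn_integral_exp[OF assms(3)])
  also have "\<dots> = (\<integral>\<^sup>+ t. (\<integral>\<^sup>+ x. ennreal (exp (- (t * f x))) * indicator {0..} t \<partial>M) \<partial>lborel)"
  proof (rule Fubini'[symmetric])
    have f': "(\<lambda>z. f (fst z)) \<in> borel_measurable (M \<Otimes>\<^sub>M lborel)"
      by (rule measurable_compose[OF measurable_fst assms(2)])
    have s: "snd \<in> borel_measurable (M \<Otimes>\<^sub>M (lborel :: real measure))"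
      using measurable_snd[of M "lborel :: real measure"] by (simp cong: measurable_cong_sets)
    have e: "(\<lambda>z. ennreal (exp (- (snd z * f (fst z))))) \<in> borel_measurable (M \<Otimes>\<^sub>M lborel)"
      by (rule measurable_compose[OF measurable_compose[OF borel_measurable_uminus[OF borel_measurable_times[OF s f']]
            borel_measurable_exp] measurable_ennreal])
    have i: "(\<lambda>z. indicator {0::real..} (snd z) :: ennreal) \<in> borel_measurable (M \<Otimes>\<^sub>M lborel)"
      by (rule measurable_compose[OF s]) simp
    have "(\<lambda>z. ennreal (exp (- (snd z * f (fst z)))) * indicator {0..} (snd z)) \<in> borel_measurable (M \<Otimes>\<^sub>M lborel)"
      by (rule borel_measurable_times_ennreal[OF e i])
    then show "(\<lambda>(x, t). ennreal (exp (- (t * f x))) * indicator {0..} t) \<in> borel_measurable (M \<Otimes>\<^sub>M lborel)"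
      unfolding case_prod_beta' .
  qed
  also have "\<dots> = (\<integral>\<^sup>+ t. (\<integral>\<^sup>+ x. ennreal (exp (- (t * f x))) \<partial>M) * indicator {0..} t \<partial>lborel)"
    by (intro nn_integral_cong nn_integral_multc measurable_compose[OF _ measurable_ennreal]
        borel_measurable_exp[THEN measurable_compose[rotated]] borel_measurable_uminus
        borel_measurable_times borel_measurable_const assms(2))
  finally show ?thesis .
qed

text \<open>For every \<open>t\<close> the two quadratic forms have the same Laplace transform, and
  this passes to the mixture over \<open>t\<close> that represents the inverse. The case
  \<open>c = 0\<close> yields the inverse moment of a projected vector, the case
  \<open>c = 1\<close> the duality between a fresh column and a fresh row.\<close>

lemma nn_integral_gauss_inverse_transpose:
  fixes K :: "'a \<Rightarrow> 'b \<Rightarrow> real"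
  assumes "finite A" "finite B" "c \<ge> 0"
  shows "(\<integral>\<^sup>+ z. inverse (ennreal (c + (\<Sum>b\<in>B. (\<Sum>a\<in>A. K a b * z a)\<^sup>2))) \<partial>gauss A)
       = (\<integral>\<^sup>+ g. inverse (ennreal (c + (\<Sum>a\<in>A. (\<Sum>b\<in>B. K a b * g b)\<^sup>2))) \<partial>gauss B)"
proof -
  interpret A: prob_space "gauss A" by (rule prob_space_gauss)
  interpret B: prob_space "gauss B" by (rule prob_space_gauss)
  have split: "ennreal (exp (- (t * (c + r)))) = ennreal (exp (- (t * c))) * ennreal (exp (- (t * r)))" for t r
    by (simp add: ennreal_mult[symmetric] exp_add[symmetric] algebra_simps)
  have "(\<integral>\<^sup>+ z. inverse (ennreal (c + (\<Sum>b\<in>B. (\<Sum>a\<in>A. K a b * z a)\<^sup>2))) \<partial>gauss A)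
     = (\<integral>\<^sup>+ t. (\<integral>\<^sup>+ z. ennreal (exp (- (t * (c + (\<Sum>b\<in>B. (\<Sum>a\<in>A. K a b * z a)\<^sup>2))))) \<partial>gauss A) * indicator {0..} t \<partial>lborel)"
    by (intro nn_integral_inverse_eq_Laplace A.sigma_finite_measure_axioms) (auto intro!: add_nonneg_nonneg sum_nonneg assms)
  also have "\<dots> = (\<integral>\<^sup>+ t. (\<integral>\<^sup>+ g. ennreal (exp (- (t * (c + (\<Sum>a\<in>A. (\<Sum>b\<in>B. K a b * g b)\<^sup>2))))) \<partial>gauss B) * indicator {0..} t \<partial>lborel)"
  proof (intro nn_integral_cong, goal_cases)
    case (1 t)
    show ?case
      by (cases "t \<ge> 0") (auto simp: split nn_integral_cmult nn_integral_gauss_exp_transpose[OF assms(1,2)])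
  qed
  also have "\<dots> = (\<integral>\<^sup>+ g. inverse (ennreal (c + (\<Sum>a\<in>A. (\<Sum>b\<in>B. K a b * g b)\<^sup>2))) \<partial>gauss B)"
    by (intro nn_integral_inverse_eq_Laplace[symmetric] B.sigma_finite_measure_axioms) (auto intro!: add_nonneg_nonneg sum_nonneg assms)
  finally show ?thesis .
qed

lemma nn_integral_std_normal_exp_square:
  assumes "t \<ge> 0"
  shows "(\<integral>\<^sup>+ y. ennreal (exp (- (t * y\<^sup>2))) \<partial>std_normal_distribution) = ennreal (1 / sqrt (1 + 2 * t))"
proof -
  \<comment> \<open>Tilting the standard normal density by \<open>exp (- t y^2)\<close> gives
    \<open>s\<close> times the centered normal density with standard deviation
    \<open>s\<close>.\<close>
  define s where "s = 1 / sqrt (1 + 2 * t)"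
  have s: "s > 0" "s\<^sup>2 = 1 / (1 + 2 * t)" using assms by (auto simp: s_def power_divide)
  have eq: "std_normal_density y * exp (- (t * y\<^sup>2)) = s * normal_density 0 s y" for y
  proof -
    have "sqrt (2 * pi * s\<^sup>2) = sqrt (2 * pi) * s"
      using s(1) by (simp add: real_sqrt_mult)
    moreover have "- (y\<^sup>2 / (2 * s\<^sup>2)) = - y\<^sup>2 / 2 + - t * y\<^sup>2"
      using assms by (simp add: s(2) field_simps)
    ultimately show ?thesis
      using s(1) by (simp add: normal_density_def exp_add[symmetric])
  qed
  have "(\<integral>\<^sup>+ y. ennreal (exp (- (t * y\<^sup>2))) \<partial>std_normal_distribution)
      = (\<integral>\<^sup>+ y. ennreal (s * normal_density 0 s y) \<partial>lborel)"
    by (subst nn_integral_density) (auto simp: eq ennreal_mult[symmetric])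
  also have "\<dots> = ennreal (\<integral> y. s * normal_density 0 s y \<partial>lborel)"
    using s(1) by (intro nn_integral_eq_integral) auto
  also have "(\<integral> y. s * normal_density 0 s y \<partial>lborel) = s"
    using s(1) by simp
  finally show ?thesis by (simp add: s_def)
qed

text \<open>This is the inverse moment of a chi-square variable with \<open>m = card B\<close>
  degrees of freedom. Its Laplace transform \<open>(1 + 2 t) powr (- m / 2)\<close> is integrable at
  infinity exactly for \<open>m > 2\<close>, the origin of every margin of 2 below.\<close>

lemma nn_integral_gauss_inverse_norm_square:
  assumes "finite B" "card B > 2"
  shows "(\<integral>\<^sup>+ g. inverse (ennreal (\<Sum>b\<in>B. (g b)\<^sup>2)) \<partial>gauss B) = ennreal (1 / (real (card B) - 2))"
proof -
  interpret B: prob_space "gauss B" by (rule prob_space_gauss)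
  define m where "m = real (card B)"
  have m: "m > 2" using assms by (simp add: m_def)
  have Lap: "(\<integral>\<^sup>+ g. ennreal (exp (- (t * (\<Sum>b\<in>B. (g b)\<^sup>2)))) \<partial>gauss B) = ennreal ((1 + 2 * t) powr (- m / 2))"
    if "t \<ge> 0" for t
  proof -
    have "(\<integral>\<^sup>+ g. ennreal (exp (- (t * (\<Sum>b\<in>B. (g b)\<^sup>2)))) \<partial>gauss B)
        = (\<integral>\<^sup>+ g. (\<Prod>b\<in>B. ennreal (exp (- (t * (g b)\<^sup>2)))) \<partial>gauss B)"
      by (simp add: prod_ennreal sum_distrib_left exp_sum[OF assms(1), symmetric] sum_negf)
    also have "\<dots> = (\<Prod>b\<in>B. ennreal (1 / sqrt (1 + 2 * t)))"
      unfolding gauss_def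
      by (subst gauss.product_nn_integral_prod[OF assms(1)])
         (simp_all add: nn_integral_std_normal_exp_square[OF that])
    also have "\<dots> = ennreal ((1 / sqrt (1 + 2 * t)) ^ card B)"
      using that by (simp add: ennreal_power)
    also have "1 / sqrt (1 + 2 * t) = (1 + 2 * t) powr (- 1 / 2)"
      using that by (simp add: powr_minus_divide powr_half_sqrt)
    also have "((1 + 2 * t) powr (- 1 / 2)) ^ card B = (1 + 2 * t) powr (- m / 2)"
      using that by (subst powr_realpow[symmetric]) (auto simp: powr_powr m_def)
    finally show ?thesis .
  qed
  have "(\<integral>\<^sup>+ g. inverse (ennreal (\<Sum>b\<in>B. (g b)\<^sup>2)) \<partial>gauss B)
      = (\<integral>\<^sup>+ t. (\<integral>\<^sup>+ g. ennreal (exp (- (t * (\<Sum>b\<in>B. (g b)\<^sup>2)))) \<partial>gauss B) * indicator {0..} t \<partial>lborel)"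
    by (intro nn_integral_inverse_eq_Laplace B.sigma_finite_measure_axioms) (auto intro!: sum_nonneg)
  also have "\<dots> = (\<integral>\<^sup>+ t. ennreal ((1 + 2 * t) powr (- m / 2)) * indicator {0..} t \<partial>lborel)"
    by (intro nn_integral_cong) (auto simp: Lap indicator_def)
  also have "\<dots> = ennreal (0 - (- ((1 + 2 * 0) powr (1 - m / 2) / (m - 2))))"
  proof (rule nn_integral_FTC_atLeast)
    show "((\<lambda>t. - ((1 + 2 * t) powr (1 - m / 2) / (m - 2))) has_real_derivative (1 + 2 * x) powr (- m / 2)) (at x)"
      if "0 \<le> x" for x
    proof -
      have "((\<lambda>t. - ((1 + 2 * t) powr (1 - m / 2) / (m - 2))) has_real_derivative
          - (((1 - m / 2) * (1 + 2 * x) powr (1 - m / 2 - 1) * 2) / (m - 2))) (at x)"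
        using that m by (auto intro!: derivative_eq_intros)
      moreover have "- (((1 - m / 2) * (1 + 2 * x) powr (1 - m / 2 - 1) * 2) / (m - 2)) = (1 + 2 * x) powr (- m / 2)"
      proof -
        have "(1 - m / 2) * 2 = - (m - 2)" by simp
        then show ?thesis using m by (simp add: field_simps)
      qed
      ultimately show ?thesis by simp
    qed
    have "((\<lambda>t. (1 + 2 * t) powr (1 - m / 2)) \<longlongrightarrow> 0) at_top"
    proof (rule tendsto_neg_powr)
      show "1 - m / 2 < 0" using m by simp
      show "filterlim (\<lambda>t::real. 1 + 2 * t) at_top at_top" by real_asymp
    qed
    from tendsto_minus[OF tendsto_divide[OF this tendsto_const[of "m - 2"]]]
    show "((\<lambda>t. - ((1 + 2 * t) powr (1 - m / 2) / (m - 2))) \<longlongrightarrow> 0) at_top"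
      using m by simp
  qed auto
  finally show ?thesis by (simp add: m_def)
qed

subsection \<open>Inverses of Gram matrices\<close>

text \<open>Matrices are entry functions over an index set, so that columns can be added or removed
  without renumbering. The condition is one-sided; for symmetric \<open>W\<close> on a finite set
  the other side follows.\<close>

definition inv_on :: "'a set \<Rightarrow> ('a \<Rightarrow> 'a \<Rightarrow> real) \<Rightarrow> ('a \<Rightarrow> 'a \<Rightarrow> real) \<Rightarrow> bool" where
  "inv_on P W G \<longleftrightarrow> (\<forall>k\<in>P. \<forall>l\<in>P. (\<Sum>m\<in>P. W k m * G m l) = of_bool (k = l))"

definition sym_on :: "'a set \<Rightarrow> ('a \<Rightarrow> 'a \<Rightarrow> real) \<Rightarrow> bool" where
  "sym_on P W \<longleftrightarrow> (\<forall>k\<in>P. \<forall>l\<in>P. W k l = W l k)"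

lemma sym_onD: "sym_on P W \<Longrightarrow> k \<in> P \<Longrightarrow> l \<in> P \<Longrightarrow> W k l = W l k"
  by (simp add: sym_on_def)

lemma sum_swap3: "(\<Sum>i\<in>A. \<Sum>k\<in>B. \<Sum>l\<in>C. f i k l) = (\<Sum>k\<in>B. \<Sum>l\<in>C. \<Sum>i\<in>A. f i k l)"
  by (rule trans[OF sum.swap]) (intro sum.cong refl sum.swap)

lemma sum_of_bool_mult:
  fixes f :: "'a \<Rightarrow> real"
  assumes "finite P" "k \<in> P"
  shows "(\<Sum>m\<in>P. of_bool (k = m) * f m) = f k" "(\<Sum>m\<in>P. of_bool (m = k) * f m) = f k"
    "(\<Sum>m\<in>P. f m * of_bool (k = m)) = f k" "(\<Sum>m\<in>P. f m * of_bool (m = k)) = f k"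
  using assms by (simp_all add: of_bool_def if_distrib[of "\<lambda>c. _ * c"] if_distrib[of "\<lambda>c. c * _"] cong: if_cong)

text \<open>Transposing \<open>W G = 1\<close> with \<open>W\<close> symmetric shows that
  \<open>G^T\<close> is a left inverse, so it recovers any solution from its right-hand
  side.\<close>

lemma inv_on_solve:
  assumes P: "finite P" "sym_on P W" and G: "inv_on P W G" and v: "\<And>m. m \<in> P \<Longrightarrow> (\<Sum>l\<in>P. W m l * v l) = u m"
    and k: "k \<in> P"
  shows "v k = (\<Sum>m\<in>P. G m k * u m)"
proof -
  have "(\<Sum>m\<in>P. G m k * u m) = (\<Sum>m\<in>P. G m k * (\<Sum>l\<in>P. W m l * v l))"
    by (intro sum.cong) (simp_all add: v)
  also have "\<dots> = (\<Sum>l\<in>P. \<Sum>m\<in>P. G m k * W m l * v l)"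
    by (subst sum.swap) (simp add: sum_distrib_left mult.assoc)
  also have "\<dots> = (\<Sum>l\<in>P. (\<Sum>m\<in>P. W l m * G m k) * v l)"
    using P(2) by (auto simp: sum_distrib_right sym_on_def intro!: sum.cong)
  also have "\<dots> = (\<Sum>l\<in>P. of_bool (l = k) * v l)"
    using G k by (intro sum.cong) (auto simp: inv_on_def)
  also have "\<dots> = v k" using P(1) k by (rule sum_of_bool_mult)
  finally show ?thesis by simp
qed

text \<open>Column \<open>l\<close> of \<open>G'\<close> solves the system for the unit vector at
  \<open>l\<close>. The indices come out swapped: with \<open>G' = G\<close> this is the symmetry of
  the inverse, and symmetry then turns it into plain uniqueness.\<close>

lemma inv_on_unique:
  assumes P: "finite P" "sym_on P W" and G: "inv_on P W G" "inv_on P W G'" and k: "k \<in> P" "l \<in> P"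
  shows "G' k l = G l k"
proof -
  have "G' k l = (\<Sum>m\<in>P. G m k * of_bool (m = l))"
    using G(2) k(2) by (intro inv_on_solve[OF P G(1) _ k(1)]) (auto simp: inv_on_def)
  then show ?thesis using sum_of_bool_mult[OF P(1) k(2)] by simp
qed

lemma inv_on_sym: 
  assumes "finite P" "sym_on P W" "inv_on P W G" "k \<in> P" "l \<in> P"
  shows "G k l = G l k"
  using inv_on_unique[OF assms(1,2,3,3,4,5)] .

lemma inv_on_unique':
  assumes "finite P" "sym_on P W" "inv_on P W G" "inv_on P W G'" "k \<in> P" "l \<in> P"
  shows "G' k l = G k l"
  using inv_on_unique[OF assms] inv_on_sym[OF assms(1-3,5,6)] by simp

lemma inv_on_left:
  assumes "finite P" "sym_on P W" "inv_on P W G" "k \<in> P" "l \<in> P"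
  shows "(\<Sum>m\<in>P. G k m * W m l) = of_bool (k = l)"
proof -
  have "(\<Sum>m\<in>P. G k m * W m l) = (\<Sum>m\<in>P. W l m * G m k)"
    using assms(2,4,5) inv_on_sym[OF assms(1-3)] by (intro sum.cong) (auto simp: sym_on_def)
  then show ?thesis using assms by (auto simp: inv_on_def)
qed

section \<open>Schur complements and bordering\<close>

definition schur_coef :: "'a set \<Rightarrow> ('a \<Rightarrow> 'a \<Rightarrow> real) \<Rightarrow> ('a \<Rightarrow> 'a \<Rightarrow> real) \<Rightarrow> 'a \<Rightarrow> 'a \<Rightarrow> real" where
  "schur_coef P W G j k = (\<Sum>l\<in>P. G k l * W l j)"

text \<open>For a Gram matrix, \<open>schur_coef\<close> lists the least-squares coefficients of
  column \<open>j\<close> on the columns in \<open>P\<close>, and the Schur complement is the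
  squared norm of the residual.\<close>

definition schur :: "'a set \<Rightarrow> ('a \<Rightarrow> 'a \<Rightarrow> real) \<Rightarrow> ('a \<Rightarrow> 'a \<Rightarrow> real) \<Rightarrow> 'a \<Rightarrow> real" where
  "schur P W G j = W j j - (\<Sum>k\<in>P. W j k * schur_coef P W G j k)"

text \<open>These are the normal equations of the regression of column \<open>j\<close>.\<close>

lemma schur_coef_solves:
  assumes "finite P" "inv_on P W G" "k \<in> P"
  shows "(\<Sum>m\<in>P. W k m * schur_coef P W G j m) = W k j"
proof -
  have "(\<Sum>m\<in>P. W k m * schur_coef P W G j m) = (\<Sum>l\<in>P. (\<Sum>m\<in>P. W k m * G m l) * W l j)"
    unfolding schur_coef_def sum_distrib_left sum_distrib_right mult.assoc[symmetric] by (rule sum.swap)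
  also have "\<dots> = (\<Sum>l\<in>P. of_bool (k = l) * W l j)"
    using assms by (intro sum.cong) (auto simp: inv_on_def)
  also have "\<dots> = W k j" using assms by (intro sum_of_bool_mult)
  finally show ?thesis .
qed

text \<open>The block formula for the inverse after adding one row and one column to a symmetric
  matrix.\<close>

definition border :: "'a set \<Rightarrow> ('a \<Rightarrow> 'a \<Rightarrow> real) \<Rightarrow> ('a \<Rightarrow> 'a \<Rightarrow> real) \<Rightarrow> 'a \<Rightarrow> 'a \<Rightarrow> 'a \<Rightarrow> real" where
  "border P W G j k l = (let r = schur_coef P W G j; Y = schur P W G j in
     if k = j then (if l = j then 1 / Y else - r l / Y)
     else if l = j then - r k / Y else G k l + r k * r l / Y)"

lemma sum_insert_cong:
  assumes "finite P" "j \<notin> P" "\<And>m. m \<in> P \<Longrightarrow> f m = g m"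
  shows "sum f (insert j P) = f j + sum g P"
  using assms by (simp cong: sum.cong)

lemma inv_on_border:
  assumes P: "finite P" "j \<notin> P" and W: "sym_on (insert j P) W" and G: "inv_on P W G"
    and Y: "schur P W G j \<noteq> 0"
  shows "inv_on (insert j P) W (border P W G j)"
proof -
  define r where "r = schur_coef P W G j"
  define Y where "Y = schur P W G j"
  have Y0: "Y \<noteq> 0" using Y by (simp add: Y_def)
  have WP: "sym_on P W" using W by (simp add: sym_on_def)
  have sol: "(\<Sum>m\<in>P. W k m * r m) = W k j" if "k \<in> P" for k
    unfolding r_def by (rule schur_coef_solves[OF P(1) G that])
  have solj: "(\<Sum>m\<in>P. W j m * r m) = W j j - Y"
    by (simp add: Y_def r_def schur_def)
  have rl: "(\<Sum>m\<in>P. W j m * G m l) = r l" if "l \<in> P" for l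
    unfolding r_def schur_coef_def
  proof (intro sum.cong refl)
    fix m assume "m \<in> P"
    then show "W j m * G m l = G l m * W m j"
      using that inv_on_sym[OF P(1) WP G, of m l] sym_onD[OF W, of j m] by simp
  qed
  have B: "border P W G j = (\<lambda>k l. if k = j then (if l = j then 1 / Y else - r l / Y)
     else if l = j then - r k / Y else G k l + r k * r l / Y)"
    by (simp add: fun_eq_iff border_def Let_def r_def Y_def)
  show ?thesis
    unfolding inv_on_def B
  proof (intro ballI)
    fix k l assume k: "k \<in> insert j P" and l: "l \<in> insert j P"
    let ?S = "\<Sum>m\<in>insert j P. W k m * (if m = j then (if l = j then 1 / Y else - r l / Y)
     else if l = j then - r m / Y else G m l + r m * r l / Y)"
    have kW: "(\<Sum>m\<in>P. W k m * r m) = W k j - (if k = j then Y else 0)"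
      using sol solj k by auto
    show "?S = of_bool (k = l)"
    proof (cases "l = j")
      case True
      have "?S = W k j / Y + (\<Sum>m\<in>P. - (W k m * r m) / Y)"
        using P True by (subst sum_insert_cong[where g="\<lambda>m. - (W k m * r m) / Y"]) auto
      also have "(\<Sum>m\<in>P. - (W k m * r m) / Y) = - (W k j - (if k = j then Y else 0)) / Y"
        unfolding kW[symmetric] by (simp add: sum_negf sum_divide_distrib)
      also have "W k j / Y + - (W k j - (if k = j then Y else 0)) / Y = of_bool (k = l)"
        using Y0 True by (simp add: diff_divide_distrib)
      finally show ?thesis .
    next
      case False
      then have lP: "l \<in> P" using l by simp
      have "?S = - W k j * r l / Y + (\<Sum>m\<in>P. W k m * G m l + (W k m * r m) * (r l / Y))"
        using P False by (subst sum_insert_cong[where g="\<lambda>m. W k m * G m l + (W k m * r m) * (r l / Y)"])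
          (auto simp: algebra_simps)
      also have "(\<Sum>m\<in>P. W k m * G m l + (W k m * r m) * (r l / Y))
          = (\<Sum>m\<in>P. W k m * G m l) + (\<Sum>m\<in>P. W k m * r m) * (r l / Y)"
        by (simp only: sum.distrib sum_distrib_right)
      also have "(\<Sum>m\<in>P. W k m * G m l) = (if k = j then r l else of_bool (k = l))"
        using rl[OF lP] G k lP by (auto simp: inv_on_def)
      also have "- W k j * r l / Y + ((if k = j then r l else of_bool (k = l)) + (\<Sum>m\<in>P. W k m * r m) * (r l / Y))
          = of_bool (k = l)"
        unfolding kW using Y0 False by (auto simp: field_simps)
      finally show ?thesis .
    qed
  qed
qed

text \<open>The coefficients of the residual, 1 at \<open>j\<close> and \<open>- schur_coef\<close>
  on \<open>P\<close>, are mapped by \<open>W\<close> to a multiple of the unit vector at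
  \<open>j\<close>: on \<open>P\<close> by the normal equations, at \<open>j\<close> by the
  definition of the Schur complement.\<close>

lemma schur_mult:
  assumes P: "finite P" "j \<notin> P" and G: "inv_on P W G" and k: "k \<in> insert j P"
  shows "(\<Sum>l\<in>insert j P. W k l * (if l = j then 1 else - schur_coef P W G j l))
       = schur P W G j * of_bool (k = j)"
proof -
  have "(\<Sum>l\<in>insert j P. W k l * (if l = j then 1 else - schur_coef P W G j l))
      = W k j + (\<Sum>l\<in>P. - (W k l * schur_coef P W G j l))"
    using P by (subst sum_insert_cong[where g="\<lambda>l. - (W k l * schur_coef P W G j l)"]) auto
  then show ?thesis
    using k schur_coef_solves[OF P(1) G, of k j] by (auto simp: sum_negf schur_def)
qed

text \<open>Apply \<open>G'\<close> to the identity for the residual coefficients and read off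
  coordinate \<open>j\<close>, where the coefficient is 1. The product form also shows that the
  Schur complement is nonzero.\<close>

lemma inv_on_diag_schur:
  assumes P: "finite P" "j \<notin> P" and W: "sym_on (insert j P) W"
    and G: "inv_on P W G" and G': "inv_on (insert j P) W G'"
  shows "G' j j * schur P W G j = 1"
proof -
  have "(if j = j then 1 else - schur_coef P W G j j) = (\<Sum>m\<in>insert j P. G' m j * (schur P W G j * of_bool (m = j)))"
    by (rule inv_on_solve[OF _ W G']) (use P schur_mult[OF P G] in \<open>simp_all only: finite_insert insertI1\<close>)
  also have "\<dots> = (\<Sum>m\<in>insert j P. (G' m j * schur P W G j) * of_bool (m = j))"
    by (simp add: mult.assoc)
  also have "\<dots> = G' j j * schur P W G j"
    using P by (intro sum_of_bool_mult) auto
  finally show ?thesis by simp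
qed

section \<open>Gram matrices and a measurable choice of their inverse\<close>

definition gram :: "nat \<Rightarrow> (nat \<times> nat \<Rightarrow> real) \<Rightarrow> nat \<Rightarrow> nat \<Rightarrow> real" where
  "gram n x k l = (\<Sum>i<n. x (i, k) * x (i, l))"

lemma sym_on_gram: "sym_on P (gram n x)"
  by (simp add: sym_on_def gram_def mult.commute)

lemma gram_cong: "(\<And>i. i < n \<Longrightarrow> x (i, k) = y (i, k)) \<Longrightarrow> (\<And>i. i < n \<Longrightarrow> x (i, l) = y (i, l))
    \<Longrightarrow> gram n x k l = gram n y k l"
  by (simp add: gram_def)

lemma sum_square_eq_gram:
  "(\<Sum>i<n. (\<Sum>k\<in>P. c k * x (i, k))\<^sup>2) = (\<Sum>k\<in>P. c k * (\<Sum>l\<in>P. gram n x k l * c l))"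
proof -
  have "(\<Sum>i<n. (\<Sum>k\<in>P. c k * x (i, k))\<^sup>2) = (\<Sum>i<n. \<Sum>k\<in>P. \<Sum>l\<in>P. c k * x (i, k) * (c l * x (i, l)))"
    by (simp add: power2_eq_square sum_product)
  also have "\<dots> = (\<Sum>k\<in>P. \<Sum>l\<in>P. \<Sum>i<n. c k * x (i, k) * (c l * x (i, l)))"
    by (rule sum_swap3)
  also have "\<dots> = (\<Sum>k\<in>P. c k * (\<Sum>l\<in>P. gram n x k l * c l))"
    by (simp add: gram_def sum_distrib_left sum_distrib_right mult_ac)
  finally show ?thesis .
qed

text \<open>With \<open>c\<close> the residual coefficients, the squared norm of the residual is
  \<open>c^T W c\<close>. Since \<open>W c\<close> is supported at \<open>j\<close> and
  \<open>c j = 1\<close>, only the Schur complement survives.\<close>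

lemma schur_gram_eq_sum_squares:
  assumes "finite P" "j \<notin> P" "inv_on P (gram n x) G"
  shows "schur P (gram n x) G j
       = (\<Sum>i<n. (\<Sum>k\<in>insert j P. (if k = j then 1 else - schur_coef P (gram n x) G j k) * x (i, k))\<^sup>2)"
proof -
  define c where "c k = (if k = j then 1 else - schur_coef P (gram n x) G j k)" for k
  have "(\<Sum>i<n. (\<Sum>k\<in>insert j P. c k * x (i, k))\<^sup>2)
      = (\<Sum>k\<in>insert j P. (c k * schur P (gram n x) G j) * of_bool (k = j))"
    unfolding sum_square_eq_gram using schur_mult[OF assms]
    by (intro sum.cong) (simp_all add: c_def)
  also have "\<dots> = c j * schur P (gram n x) G j"
    using assms by (intro sum_of_bool_mult) auto
  finally show ?thesis by (simp add: c_def)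
qed

lemma schur_gram_nonneg:
  assumes "finite P" "j \<notin> P" "inv_on P (gram n x) G"
  shows "schur P (gram n x) G j \<ge> 0"
  unfolding schur_gram_eq_sum_squares[OF assms] by (intro sum_nonneg) auto

text \<open>A linear relation between the columns serves as the certificate of singularity,
  complementary to an inverse.\<close>

definition ker_on :: "nat \<Rightarrow> nat set \<Rightarrow> (nat \<times> nat \<Rightarrow> real) \<Rightarrow> (nat \<Rightarrow> real) \<Rightarrow> bool" where
  "ker_on n P x v \<longleftrightarrow> (\<exists>k\<in>P. v k \<noteq> 0) \<and> (\<forall>i<n. (\<Sum>k\<in>P. v k * x (i, k)) = 0)"

lemma ker_on_imp_not_inv_on:
  assumes "finite P" "ker_on n P x v" "inv_on P (gram n x) G"
  shows False
proof -
  have "(\<Sum>l\<in>P. gram n x m l * v l) = 0" for m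
  proof -
    have "(\<Sum>l\<in>P. gram n x m l * v l) = (\<Sum>i<n. x (i, m) * (\<Sum>l\<in>P. v l * x (i, l)))"
      unfolding gram_def sum_distrib_right sum_distrib_left by (subst sum.swap) (simp add: mult_ac)
    also have "\<dots> = 0" using assms(2) by (intro sum.neutral) (auto simp: ker_on_def)
    finally show ?thesis .
  qed
  then have "v k = 0" if "k \<in> P" for k
    using inv_on_solve[OF assms(1) sym_on_gram assms(3), where u="\<lambda>_. 0"] that by simp
  then show False using assms(2) by (auto simp: ker_on_def)
qed

text \<open>Locality, the second condition, is what makes the inverse constant while a column
  outside \<open>P\<close> is integrated. Measurability is asked for every index set that contains
  the relevant entries, because the ambient product changes as columns and rows are removed or
  added.\<close>

definition gram_inverse_fun :: "nat \<Rightarrow> nat set \<Rightarrow> ((nat \<times> nat \<Rightarrow> real) \<Rightarrow> nat \<Rightarrow> nat \<Rightarrow> real) \<Rightarrow> bool" where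
  "gram_inverse_fun n P G \<longleftrightarrow> (\<forall>x. inv_on P (gram n x) (G x) \<or> (\<exists>v. ker_on n P x v)) \<and>
    (\<forall>x y. (\<forall>i<n. \<forall>k\<in>P. x (i, k) = y (i, k)) \<longrightarrow> G x = G y) \<and>
    (\<forall>I k l. {..<n} \<times> P \<subseteq> I \<longrightarrow> (\<lambda>x. G x k l) \<in> borel_measurable (gauss I))"

text \<open>Adding a column either borders the previous inverse or, if the Schur complement
  vanishes, produces a linear relation. All formulas are rational in earlier ones, which preserves
  measurability and locality.\<close>

lemma ex_gram_inverse:
  assumes "finite P"
  shows "\<exists>G. gram_inverse_fun n P G"
  using assms
proof (induction P rule: finite_induct)
  case empty
  show ?case by (rule exI[of _ "\<lambda>_ _ _. 0"]) (simp add: gram_inverse_fun_def inv_on_def)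
next
  case (insert j P)
  from insert.IH obtain G where *: "gram_inverse_fun n P G" ..
  note G = *[unfolded gram_inverse_fun_def, THEN conjunct1]
    and loc = *[unfolded gram_inverse_fun_def, THEN conjunct2, THEN conjunct1]
    and meas = *[unfolded gram_inverse_fun_def, THEN conjunct2, THEN conjunct2]
  define H where "H x = border P (gram n x) (G x) j" for x
  have "inv_on (insert j P) (gram n x) (H x) \<or> (\<exists>v. ker_on n (insert j P) x v)" for x
  proof (cases "\<exists>v. ker_on n P x v")
    case True
    then obtain v where "ker_on n P x v" by blast
    moreover have "(\<Sum>k\<in>insert j P. (v(j := 0)) k * x (i, k)) = (\<Sum>k\<in>P. v k * x (i, k))" for i
      using insert.hyps by (subst sum_insert_cong[where g="\<lambda>k. v k * x (i, k)"]) auto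
    moreover have "(v(j := 0)) k = v k" if "k \<in> P" for k using that insert.hyps by auto
    ultimately have "ker_on n (insert j P) x (v(j := 0))"
      unfolding ker_on_def by simp
    then show ?thesis by blast
  next
    case False
    then have inv: "inv_on P (gram n x) (G x)" using G[rule_format, of x] by blast
    show ?thesis
    proof (cases "schur P (gram n x) (G x) j = 0")
      case True
      \<comment> \<open>A vanishing Schur complement is a vanishing residual, so the residual
        coefficients, with entry 1 at \<open>j\<close>, are a nontrivial relation between the
        columns.\<close>
      then have "(\<Sum>i<n. (\<Sum>k\<in>insert j P. (if k = j then 1 else - schur_coef P (gram n x) (G x) j k) * x (i, k))\<^sup>2) = 0"
        using schur_gram_eq_sum_squares[OF insert.hyps inv] by simp
      then have "ker_on n (insert j P) x (\<lambda>k. if k = j then 1 else - schur_coef P (gram n x) (G x) j k)"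
        by (subst (asm) sum_nonneg_eq_0_iff) (auto simp: ker_on_def)
      then show ?thesis by blast
    next
      case False
      then show ?thesis
        unfolding H_def using inv_on_border[OF insert.hyps sym_on_gram inv] by blast
    qed
  qed
  moreover have "H x = H y" if "\<forall>i<n. \<forall>k\<in>insert j P. x (i, k) = y (i, k)" for x y
  proof -
    have "G x = G y" using that by (intro loc[rule_format]) auto
    moreover have "gram n x k l = gram n y k l" if "k \<in> insert j P" "l \<in> insert j P" for k l
      using \<open>\<forall>i<n. _\<close> that by (intro gram_cong) auto
    ultimately have "schur_coef P (gram n x) (G x) j = schur_coef P (gram n y) (G y) j"
        "schur P (gram n x) (G x) j = schur P (gram n y) (G y) j"
      by (auto simp: schur_coef_def schur_def fun_eq_iff intro!: sum.cong arg_cong2[where f="(-)"] arg_cong2[where f="(*)"])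
    then show ?thesis
      using \<open>G x = G y\<close> by (simp add: H_def border_def[abs_def])
  qed
  moreover have "(\<lambda>x. H x k l) \<in> borel_measurable (gauss I)" if I: "{..<n} \<times> insert j P \<subseteq> I" for I k l
  proof -
    have Gm: "(\<lambda>x. G x k l) \<in> borel_measurable (gauss I)" for k l
      using I by (intro meas[rule_format]) auto
    have gm: "(\<lambda>x. gram n x k l) \<in> borel_measurable (gauss I)"
      if "k \<in> insert j P" "l \<in> insert j P" for k l
      unfolding gram_def using I that
      by (intro borel_measurable_sum borel_measurable_times measurable_gauss_component) auto
    have cm: "(\<lambda>x. schur_coef P (gram n x) (G x) j k) \<in> borel_measurable (gauss I)" for k
      unfolding schur_coef_def by (intro borel_measurable_sum borel_measurable_times Gm gm insertI1 insertI2)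
    have sm: "(\<lambda>x. schur P (gram n x) (G x) j) \<in> borel_measurable (gauss I)"
      unfolding schur_def
      by (intro borel_measurable_sum borel_measurable_times borel_measurable_diff gm cm insertI1 insertI2)
    note mm = borel_measurable_divide borel_measurable_add borel_measurable_times borel_measurable_uminus
      borel_measurable_const Gm cm sm
    show ?thesis
    proof (cases "k = j"; cases "l = j")
    qed (simp_all only: H_def border_def Let_def if_True if_False simp_thms, (intro mm)+)
  qed
  ultimately have "gram_inverse_fun n (insert j P) H" unfolding gram_inverse_fun_def by blast
  then show ?case by blast
qed

text \<open>Where the Gram matrix is singular, the value is arbitrary but still measurable and local.\<close>

definition gram_inv :: "nat \<Rightarrow> nat set \<Rightarrow> (nat \<times> nat \<Rightarrow> real) \<Rightarrow> nat \<Rightarrow> nat \<Rightarrow> real" where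
  "gram_inv n P = (SOME G. gram_inverse_fun n P G)"

lemma
  assumes "finite P"
  shows gram_inv_or_ker: "inv_on P (gram n x) (gram_inv n P x) \<or> (\<exists>v. ker_on n P x v)"
    and gram_inv_cong: "\<forall>i<n. \<forall>k\<in>P. x (i, k) = y (i, k) \<Longrightarrow> gram_inv n P x = gram_inv n P y"
    and measurable_gram_inv: "{..<n} \<times> P \<subseteq> I \<Longrightarrow> (\<lambda>x. gram_inv n P x k l) \<in> borel_measurable (gauss I)"
proof -
  note * = someI_ex[OF ex_gram_inverse[OF assms, of n], folded gram_inv_def, unfolded gram_inverse_fun_def]
  show "inv_on P (gram n x) (gram_inv n P x) \<or> (\<exists>v. ker_on n P x v)"
    using *[THEN conjunct1] by (rule spec)
  show "gram_inv n P x = gram_inv n P y" if "\<forall>i<n. \<forall>k\<in>P. x (i, k) = y (i, k)"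
    using *[THEN conjunct2, THEN conjunct1, rule_format, of x y] that by simp
  show "(\<lambda>x. gram_inv n P x k l) \<in> borel_measurable (gauss I)" if "{..<n} \<times> P \<subseteq> I"
    using *[THEN conjunct2, THEN conjunct2, rule_format, OF that] .
qed

lemma inv_on_gram_inv:
  assumes "finite P" "inv_on P (gram n x) G"
  shows "inv_on P (gram n x) (gram_inv n P x)"
  using gram_inv_or_ker[OF assms(1), of n x] ker_on_imp_not_inv_on[OF assms(1) _ assms(2)] by blast

text \<open>Unit vectors are peeled off one at a time. A nonzero projection has a positive diagonal
  entry; the corresponding column, normalized, is a unit vector \<open>q\<close> fixed by
  \<open>Q\<close>, and \<open>Q - q q^T\<close> is a projection whose trace is smaller by 1. An
  integer above the trace therefore bounds the induction.\<close>

lemma projection_eq_sum_orthonormal: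
  fixes Q :: "'a \<Rightarrow> 'a \<Rightarrow> real"
  assumes A: "finite A" and sym: "sym_on A Q"
    and idem: "\<forall>a\<in>A. \<forall>b\<in>A. (\<Sum>c\<in>A. Q a c * Q c b) = Q a b"
  shows "\<exists>(m::nat) v. (\<forall>s<m. \<forall>t<m. (\<Sum>a\<in>A. v s a * v t a) = of_bool (s = t)) \<and>
      (\<forall>a\<in>A. \<forall>b\<in>A. Q a b = (\<Sum>s<m. v s a * v s b)) \<and> (\<Sum>a\<in>A. Q a a) = real m"
proof -
  have *: "\<exists>(m::nat) v. (\<forall>s<m. \<forall>t<m. (\<Sum>a\<in>A. v s a * v t a) = of_bool (s = t)) \<and>
      (\<forall>a\<in>A. \<forall>b\<in>A. Q a b = (\<Sum>s<m. v s a * v s b)) \<and> (\<Sum>a\<in>A. Q a a) = real m"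
    if "(\<Sum>a\<in>A. Q a a) < real k" "sym_on A Q"
       "\<forall>a\<in>A. \<forall>b\<in>A. (\<Sum>c\<in>A. Q a c * Q c b) = Q a b" for k :: nat and Q :: "'a \<Rightarrow> 'a \<Rightarrow> real"
    using that
  proof (induction k arbitrary: Q)
    case (0 Q)
    \<comment> \<open>A diagonal entry of a projection is the squared norm of its row. Hence the
      trace is nonnegative and the base case is contradictory.\<close>
    have diag: "Q a a = (\<Sum>c\<in>A. (Q a c)\<^sup>2)" if "a \<in> A" for a
      using 0(3)[rule_format, OF that that] 0(2) that by (auto simp: sym_on_def power2_eq_square intro!: sum.cong)
    have "(\<Sum>a\<in>A. Q a a) \<ge> 0" by (intro sum_nonneg) (simp add: diag sum_nonneg)
    then show ?case using 0(1) by simp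
  next
    case (Suc k Q)
    have idemQ: "(\<Sum>c\<in>A. Q a c * Q c b) = Q a b" if "a \<in> A" "b \<in> A" for a b
      using Suc.prems(3) that by blast
    have diag: "Q a a = (\<Sum>c\<in>A. (Q a c)\<^sup>2)" if "a \<in> A" for a
      using idemQ[OF that that] Suc.prems(2) that by (auto simp: sym_on_def power2_eq_square intro!: sum.cong)
    show ?case
    proof (cases "\<forall>a\<in>A. Q a a = 0")
      case True
      have "Q a b = 0" if "a \<in> A" "b \<in> A" for a b
      proof -
        have "(\<Sum>c\<in>A. (Q a c)\<^sup>2) = 0" using True that diag by simp
        then show ?thesis using A that by (simp add: sum_nonneg_eq_0_iff)
      qed
      then show ?thesis by (intro exI[of _ 0]) auto
    next
      case False
      then obtain e where e: "e \<in> A" "Q e e \<noteq> 0" by blast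
      have "Q e e \<ge> 0" unfolding diag[OF e(1)] by (simp add: sum_nonneg)
      then have pos: "Q e e > 0" using e by simp
      \<comment> \<open>The squared norm of column \<open>e\<close> is \<open>Q e e\<close> by
        idempotence, which explains the normalization.\<close>
      define q where "q a = Q a e / sqrt (Q e e)" for a
      have qq: "(\<Sum>a\<in>A. q a * q a) = 1"
      proof -
        have "(\<Sum>a\<in>A. q a * q a) = (\<Sum>a\<in>A. Q e a * Q a e) / Q e e"
          using pos Suc.prems(2) e(1) by (auto simp: q_def sum_divide_distrib sym_on_def intro!: sum.cong)
        then show ?thesis using idemQ[OF e(1) e(1)] pos by simp
      qed
      have Qq: "(\<Sum>b\<in>A. Q a b * q b) = q a" if "a \<in> A" for a
      proof -
        have "(\<Sum>b\<in>A. Q a b * q b) = (\<Sum>b\<in>A. Q a b * Q b e) / sqrt (Q e e)"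
          by (simp add: q_def sum_divide_distrib)
        then show ?thesis using idemQ[OF that e(1)] by (simp add: q_def)
      qed
      have qQ: "(\<Sum>a\<in>A. q a * Q a b) = q b" if "b \<in> A" for b
        using Qq[OF that] Suc.prems(2) that by (auto simp: sym_on_def mult.commute elim!: trans[rotated] intro!: sum.cong)
      define R where "R a b = Q a b - q a * q b" for a b
      have trR: "(\<Sum>a\<in>A. R a a) = (\<Sum>a\<in>A. Q a a) - 1"
        by (simp add: R_def sum_subtractf qq)
      have "(\<Sum>c\<in>A. R a c * R c b) = R a b" if "a \<in> A" "b \<in> A" for a b
      proof -
        have "(\<Sum>c\<in>A. R a c * R c b) = (\<Sum>c\<in>A. Q a c * Q c b) - (\<Sum>c\<in>A. Q a c * q c) * q b
            - q a * (\<Sum>c\<in>A. q c * Q c b) + q a * (\<Sum>c\<in>A. q c * q c) * q b"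
          unfolding sum_distrib_left sum_distrib_right sum_subtractf[symmetric] sum.distrib[symmetric]
          by (intro sum.cong) (simp_all add: R_def algebra_simps)
        then show ?thesis using that by (simp add: idemQ Qq qQ qq R_def)
      qed
      then have idemR: "\<forall>a\<in>A. \<forall>b\<in>A. (\<Sum>c\<in>A. R a c * R c b) = R a b" by blast
      have symR: "sym_on A R" using Suc.prems(2) by (simp add: sym_on_def R_def mult.commute)
      have "(\<Sum>a\<in>A. R a a) < real k" using trR Suc.prems(1) by simp
      from Suc.IH[OF this symR idemR] obtain m v where v: "\<forall>s<m. \<forall>t<m. (\<Sum>a\<in>A. v s a * v t a) = of_bool (s = t)"
          "\<forall>a\<in>A. \<forall>b\<in>A. R a b = (\<Sum>s<m. v s a * v s b)" "(\<Sum>a\<in>A. R a a) = real (m::nat)"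
        by (elim exE conjE) (rule that)
      \<comment> \<open>The new vector is orthogonal to the old ones: the sum of the squared inner
        products is \<open>q^T R q\<close>, and \<open>R q = Q q - q = 0\<close>.\<close>
      have "(\<Sum>s<m. (\<Sum>a\<in>A. v s a * q a)\<^sup>2) = 0"
      proof -
        have "(\<Sum>s<m. (\<Sum>a\<in>A. v s a * q a)\<^sup>2) = (\<Sum>s<m. \<Sum>a\<in>A. \<Sum>b\<in>A. v s a * q a * (v s b * q b))"
          by (simp add: power2_eq_square sum_product)
        also have "\<dots> = (\<Sum>a\<in>A. \<Sum>b\<in>A. \<Sum>s<m. v s a * q a * (v s b * q b))"
          by (rule sum_swap3)
        also have "\<dots> = (\<Sum>a\<in>A. \<Sum>b\<in>A. q a * R a b * q b)"
          using v(2) by (auto simp: sum_distrib_left sum_distrib_right mult_ac intro!: sum.cong)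
        also have "\<dots> = (\<Sum>a\<in>A. q a * ((\<Sum>b\<in>A. Q a b * q b) - q a * (\<Sum>b\<in>A. q b * q b)))"
          by (simp add: R_def sum_distrib_left sum_subtractf algebra_simps)
        also have "\<dots> = 0" using Qq qq by simp
        finally show ?thesis .
      qed
      then have vq: "(\<Sum>a\<in>A. v s a * q a) = 0" if "s < m" for s
        using that by (subst (asm) sum_nonneg_eq_0_iff) auto
      then have vq': "(\<Sum>a\<in>A. q a * v s a) = 0" if "s < m" for s
        using that by (simp add: mult.commute)
      show ?thesis
      proof (intro exI[of _ "Suc m"] exI[of _ "v(m := q)"] conjI allI impI ballI)
        fix s t assume "s < Suc m" "t < Suc m"
        then show "(\<Sum>a\<in>A. (v(m := q)) s a * (v(m := q)) t a) = of_bool (s = t)"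
          using v(1) vq vq' qq by (cases "s = m"; cases "t = m") auto
      next
        fix a b assume "a \<in> A" "b \<in> A"
        then have "Q a b = (\<Sum>s<m. v s a * v s b) + q a * q b" using v(2) by (auto simp: R_def algebra_simps)
        then show "Q a b = (\<Sum>s<Suc m. (v(m := q)) s a * (v(m := q)) s b)" by simp
      next
        show "(\<Sum>a\<in>A. Q a a) = real (Suc m)" using v(3) trR by simp
      qed
    qed
  qed
  obtain k where "(\<Sum>a\<in>A. Q a a) < real k" using reals_Archimedean2 by blast
  from *[OF this sym idem] show ?thesis .
qed

text \<open>Write \<open>Q = V V^T\<close> with orthonormal columns in \<open>V\<close>, so that the
  form is \<open>|V^T z|^2\<close>. Transposition replaces it by \<open>|V g|^2 = |g|^2\<close>,
  with \<open>g\<close> a standard Gaussian vector of dimension the trace; this plays the role of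
  rotation invariance.\<close>

lemma nn_integral_gauss_inverse_projection:
  fixes Q :: "'a \<Rightarrow> 'a \<Rightarrow> real"
  assumes A: "finite A" and sym: "sym_on A Q"
    and idem: "\<forall>a\<in>A. \<forall>b\<in>A. (\<Sum>c\<in>A. Q a c * Q c b) = Q a b"
    and tr: "(\<Sum>a\<in>A. Q a a) > 2"
  shows "(\<integral>\<^sup>+ z. inverse (ennreal (\<Sum>a\<in>A. \<Sum>b\<in>A. z a * Q a b * z b)) \<partial>gauss A)
       = ennreal (1 / ((\<Sum>a\<in>A. Q a a) - 2))"
proof -
  obtain m v where v: "\<forall>s<m. \<forall>t<m. (\<Sum>a\<in>A. v s a * v t a) = of_bool (s = t)"
    "\<forall>a\<in>A. \<forall>b\<in>A. Q a b = (\<Sum>s<m. v s a * v s b)" "(\<Sum>a\<in>A. Q a a) = real (m::nat)"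
    using projection_eq_sum_orthonormal[OF A sym idem] by (elim exE conjE) (rule that)
  have 1: "(\<Sum>a\<in>A. \<Sum>b\<in>A. z a * Q a b * z b) = 0 + (\<Sum>s<m. (\<Sum>a\<in>A. v s a * z a)\<^sup>2)" for z
  proof -
    have "(\<Sum>s<m. (\<Sum>a\<in>A. v s a * z a)\<^sup>2) = (\<Sum>s<m. \<Sum>a\<in>A. \<Sum>b\<in>A. v s a * z a * (v s b * z b))"
      by (simp add: power2_eq_square sum_product)
    also have "\<dots> = (\<Sum>a\<in>A. \<Sum>b\<in>A. \<Sum>s<m. v s a * z a * (v s b * z b))"
      by (rule sum_swap3)
    also have "\<dots> = (\<Sum>a\<in>A. \<Sum>b\<in>A. z a * Q a b * z b)"
      using v(2) by (auto simp: sum_distrib_left sum_distrib_right mult_ac intro!: sum.cong)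
    finally show ?thesis by simp
  qed
  have 2: "(\<Sum>a\<in>A. (\<Sum>s<m. v s a * g s)\<^sup>2) = (\<Sum>s<m. (g s)\<^sup>2)" for g
  proof -
    have "(\<Sum>a\<in>A. (\<Sum>s<m. v s a * g s)\<^sup>2) = (\<Sum>a\<in>A. \<Sum>s<m. \<Sum>t<m. v s a * g s * (v t a * g t))"
      by (simp add: power2_eq_square sum_product)
    also have "\<dots> = (\<Sum>s<m. \<Sum>t<m. \<Sum>a\<in>A. v s a * g s * (v t a * g t))"
      by (rule sum_swap3)
    also have "\<dots> = (\<Sum>s<m. \<Sum>t<m. g s * g t * (\<Sum>a\<in>A. v s a * v t a))"
      by (simp add: sum_distrib_left mult_ac)
    also have "\<dots> = (\<Sum>s<m. \<Sum>t<m. g s * g t * of_bool (s = t))"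
      using v(1) by (auto intro!: sum.cong)
    also have "\<dots> = (\<Sum>s<m. (g s)\<^sup>2)"
      by (intro sum.cong refl) (subst sum_of_bool_mult, auto simp: power2_eq_square)
    finally show ?thesis .
  qed
  show ?thesis
    unfolding 1 nn_integral_gauss_inverse_transpose[OF A finite_lessThan order_refl, where K="\<lambda>a s. v s a"] 2
    using nn_integral_gauss_inverse_norm_square[of "{..<m}"] tr v(3) by simp
qed

subsection \<open>Least-squares coefficients of Gaussian columns\<close>

text \<open>The hat matrix when \<open>a\<close> and \<open>b\<close> are rows of the design behind
  \<open>G\<close>. The rows are not confined to that design: with \<open>G\<close> from the first
  \<open>n\<close> rows, the entry at \<open>(n, n)\<close> measures a new row against the old
  ones.\<close>

definition hat :: "nat set \<Rightarrow> (nat \<times> nat \<Rightarrow> real) \<Rightarrow> (nat \<Rightarrow> nat \<Rightarrow> real) \<Rightarrow> nat \<Rightarrow> nat \<Rightarrow> real" where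
  "hat P x G a b = (\<Sum>k\<in>P. x (a, k) * (\<Sum>l\<in>P. G k l * x (b, l)))"

lemma hat_sym:
  assumes "finite P" "inv_on P (gram n x) G"
  shows "hat P x G a b = hat P x G b a"
proof -
  have "hat P x G a b = (\<Sum>k\<in>P. \<Sum>l\<in>P. x (a, k) * (G k l * x (b, l)))"
    by (simp add: hat_def sum_distrib_left)
  also have "\<dots> = (\<Sum>l\<in>P. \<Sum>k\<in>P. x (a, k) * (G k l * x (b, l)))" by (rule sum.swap)
  also have "\<dots> = (\<Sum>l\<in>P. \<Sum>k\<in>P. x (b, l) * (G l k * x (a, k)))"
    using inv_on_sym[OF assms(1) sym_on_gram assms(2)] by (intro sum.cong refl) simp
  also have "\<dots> = hat P x G b a" by (simp add: hat_def sum_distrib_left)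
  finally show ?thesis .
qed

lemma hat_mult:
  assumes "finite P" "inv_on P (gram n x) G" "l \<in> P"
  shows "(\<Sum>c<n. x (c, l) * hat P x G c b) = x (b, l)"
proof -
  have "(\<Sum>c<n. x (c, l) * hat P x G c b)
      = (\<Sum>c<n. \<Sum>k\<in>P. \<Sum>m\<in>P. x (c, l) * x (c, k) * G k m * x (b, m))"
    by (simp add: hat_def sum_distrib_left mult_ac)
  also have "\<dots> = (\<Sum>k\<in>P. \<Sum>m\<in>P. \<Sum>c<n. x (c, l) * x (c, k) * G k m * x (b, m))"
    by (rule sum_swap3)
  also have "\<dots> = (\<Sum>k\<in>P. \<Sum>m\<in>P. gram n x l k * G k m * x (b, m))"
    by (simp add: gram_def sum_distrib_right)
  also have "\<dots> = (\<Sum>m\<in>P. (\<Sum>k\<in>P. gram n x l k * G k m) * x (b, m))"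
    by (subst sum.swap) (simp add: sum_distrib_right)
  also have "\<dots> = (\<Sum>m\<in>P. of_bool (l = m) * x (b, m))"
    using assms by (intro sum.cong refl) (simp add: inv_on_def)
  also have "\<dots> = x (b, l)" using assms by (intro sum_of_bool_mult)
  finally show ?thesis .
qed

lemma hat_idem:
  assumes "finite P" "inv_on P (gram n x) G"
  shows "(\<Sum>c<n. hat P x G a c * hat P x G c b) = hat P x G a b"
proof -
  have "(\<Sum>c<n. hat P x G a c * hat P x G c b) = (\<Sum>c<n. hat P x G c a * hat P x G c b)"
    by (simp add: hat_sym[OF assms, of a])
  also have "\<dots> = (\<Sum>c<n. \<Sum>k\<in>P. x (c, k) * hat P x G c b * (\<Sum>l\<in>P. G k l * x (a, l)))"
    unfolding hat_def[of P x G _ a] sum_distrib_right by (simp only: mult_ac)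
  also have "\<dots> = (\<Sum>k\<in>P. (\<Sum>c<n. x (c, k) * hat P x G c b) * (\<Sum>l\<in>P. G k l * x (a, l)))"
    by (subst sum.swap) (simp add: sum_distrib_right)
  also have "\<dots> = hat P x G b a"
    unfolding hat_def[of P x G b a] by (intro sum.cong refl) (simp only: hat_mult[OF assms])
  finally show ?thesis using hat_sym[OF assms, of a] by simp
qed

text \<open>Idempotence sums over the design rows but leaves the outer indices free, so the entry is
  a squared norm also for a row \<open>a\<close> outside the design.\<close>

lemma hat_nonneg:
  assumes "finite P" "inv_on P (gram n x) G"
  shows "hat P x G a a \<ge> 0"
proof -
  have "hat P x G a a = (\<Sum>c<n. (hat P x G c a)\<^sup>2)"
    unfolding hat_idem[OF assms, of a a, symmetric] by (simp add: hat_sym[OF assms, of a] power2_eq_square)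
  then show ?thesis by (simp add: sum_nonneg)
qed

text \<open>Cyclicity of the trace moves the computation to the identity on
  \<open>P\<close>.\<close>

lemma hat_trace:
  assumes "finite P" "inv_on P (gram n x) G"
  shows "(\<Sum>a<n. hat P x G a a) = card P"
proof -
  have "(\<Sum>a<n. hat P x G a a) = (\<Sum>a<n. \<Sum>k\<in>P. \<Sum>l\<in>P. G k l * (x (a, l) * x (a, k)))"
    by (simp add: hat_def sum_distrib_left mult_ac)
  also have "\<dots> = (\<Sum>k\<in>P. \<Sum>l\<in>P. \<Sum>a<n. G k l * (x (a, l) * x (a, k)))" by (rule sum_swap3)
  also have "\<dots> = (\<Sum>k\<in>P. \<Sum>l\<in>P. G k l * gram n x l k)"
    by (simp add: gram_def sum_distrib_left)
  also have "\<dots> = (\<Sum>k\<in>P. of_bool (k = k))"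
    using inv_on_left[OF assms(1) sym_on_gram assms(2)] by (intro sum.cong refl)
  finally show ?thesis by simp
qed

section \<open>Regression coefficients and residuals as random variables\<close>

definition ols_coef :: "nat \<Rightarrow> nat set \<Rightarrow> nat \<Rightarrow> (nat \<times> nat \<Rightarrow> real) \<Rightarrow> nat \<Rightarrow> real" where
  "ols_coef n P j x = schur_coef P (gram n x) (gram_inv n P x) j"

definition ols_norm2 :: "nat \<Rightarrow> nat set \<Rightarrow> nat \<Rightarrow> (nat \<times> nat \<Rightarrow> real) \<Rightarrow> real" where
  "ols_norm2 n P j x = (\<Sum>k\<in>P. (ols_coef n P j x k)\<^sup>2)"

definition resid2 :: "nat \<Rightarrow> nat set \<Rightarrow> nat \<Rightarrow> (nat \<times> nat \<Rightarrow> real) \<Rightarrow> real" where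
  "resid2 n P j x = schur P (gram n x) (gram_inv n P x) j"

text \<open>Regularity is phrased through the chosen inverse, which is measurable. For finite
  \<open>P\<close> it holds as soon as any inverse exists.\<close>

definition gram_regular :: "nat \<Rightarrow> nat set \<Rightarrow> (nat \<times> nat \<Rightarrow> real) \<Rightarrow> bool" where
  "gram_regular n P x \<longleftrightarrow> inv_on P (gram n x) (gram_inv n P x)"

lemma ols_norm2_nonneg: "ols_norm2 n P j x \<ge> 0"
  by (simp add: ols_norm2_def sum_nonneg)

lemma measurable_gram:
  assumes "{..<n} \<times> {k, l} \<subseteq> I"
  shows "(\<lambda>x. gram n x k l) \<in> borel_measurable (gauss I)"
  unfolding gram_def using assms
  by (intro borel_measurable_sum borel_measurable_times measurable_gauss_component) auto

lemma measurable_ols_coef: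
  assumes "finite P" "{..<n} \<times> insert j P \<subseteq> I"
  shows "(\<lambda>x. ols_coef n P j x k) \<in> borel_measurable (gauss I)"
  unfolding ols_coef_def schur_coef_def using assms
  by (intro borel_measurable_sum borel_measurable_times measurable_gram measurable_gram_inv) auto

lemma measurable_ols_norm2:
  assumes "finite P" "{..<n} \<times> insert j P \<subseteq> I"
  shows "ols_norm2 n P j \<in> borel_measurable (gauss I)"
  unfolding ols_norm2_def[abs_def] by (intro borel_measurable_sum borel_measurable_power measurable_ols_coef assms)

lemma measurable_resid2:
  assumes "finite P" "{..<n} \<times> insert j P \<subseteq> I"
  shows "resid2 n P j \<in> borel_measurable (gauss I)"
proof -
  have *: "{..<n} \<times> {j, k} \<subseteq> I" if "k \<in> insert j P" for k
    using assms that by auto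
  show ?thesis
    unfolding resid2_def[abs_def] schur_def ols_coef_def[symmetric]
    by (intro borel_measurable_sum borel_measurable_times borel_measurable_diff measurable_ols_coef assms
        measurable_gram * insertI1 insertI2)
qed

lemma measurable_gram_regular:
  assumes "finite P" "{..<n} \<times> P \<subseteq> I"
  shows "Measurable.pred (gauss I) (gram_regular n P)"
proof -
  have *: "{..<n} \<times> {k, l} \<subseteq> I" if "k \<in> P" "l \<in> P" for k l
    using assms that by auto
  have "Measurable.pred (gauss I) (\<lambda>x. (\<Sum>m\<in>P. gram n x k m * gram_inv n P x m l) = c)"
    if "k \<in> P" for k l and c :: real
    unfolding pred_def
    by (intro borel_measurable_eq borel_measurable_const borel_measurable_sum borel_measurable_times
        measurable_gram measurable_gram_inv * that assms)
  then show ?thesis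
    unfolding gram_regular_def[abs_def] inv_on_def by (intro pred_intros_finite assms(1))
qed

text \<open>Tonelli for the indicator of the exceptional set; it allows arguing column by column,
  conditionally on the others.\<close>

lemma AE_gauss_union:
  assumes IJ: "I \<inter> J = {}" "finite I" "finite J"
    and P: "Measurable.pred (gauss (I \<union> J)) P"
    and AE: "AE x in gauss I. AE y in gauss J. P (merge I J (x, y))"
  shows "AE x in gauss (I \<union> J). P x"
proof -
  have sets: "{x \<in> space (gauss (I \<union> J)). P x} \<in> sets (gauss (I \<union> J))"
      "{x \<in> space (gauss (I \<union> J)). \<not> P x} \<in> sets (gauss (I \<union> J))"
    using P pred_intros_logic(2)[OF P] by (simp_all add: pred_def)
  have "integral\<^sup>N (gauss (I \<union> J)) (indicator {x \<in> space (gauss (I \<union> J)). \<not> P x}) =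
     (\<integral>\<^sup>+ x. \<integral>\<^sup>+ y. indicator {x \<in> space (gauss (I \<union> J)). \<not> P x} (merge I J (x, y)) \<partial>gauss J \<partial>gauss I)"
    using sets by (intro nn_integral_gauss_union IJ) simp
  also have "\<dots> = (\<integral>\<^sup>+ x. \<integral>\<^sup>+ y. 0 \<partial>gauss J \<partial>gauss I)"
    using AE
  proof (intro nn_integral_cong_AE, eventually_elim)
    case (elim x)
    then show ?case by (intro nn_integral_cong_AE, elim AE_mp, intro AE_I2) simp
  qed
  also have "\<dots> = 0" by simp
  also have "integral\<^sup>N (gauss (I \<union> J)) (indicator {x \<in> space (gauss (I \<union> J)). \<not> P x}) =
      integral\<^sup>N (gauss (I \<union> J)) (indicator {x. \<not> P x})"
    by (intro nn_integral_cong) (simp add: indicator_def)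
  finally show ?thesis using AE_iff_nn_integral[OF sets(1)] by blast
qed

section \<open>Integrating out one column with the others frozen\<close>

lemma sum_column: "(\<Sum>a\<in>S \<times> {j}. f a) = (\<Sum>i\<in>S. f (i, j))"
  by (simp add: sum.cartesian_product')

lemma sum_row: "(\<Sum>a\<in>{i} \<times> S. f a) = (\<Sum>j\<in>S. f (i, j))"
  by (simp add: sum.cartesian_product')

context
  fixes n :: nat and P :: "nat set" and j :: nat and J :: "(nat \<times> nat) set" and x :: "nat \<times> nat \<Rightarrow> real"
  assumes P: "finite P" "j \<notin> P" and J: "{..<n} \<times> P \<subseteq> J" "({..<n} \<times> {j}) \<inter> J = {}"
    and reg: "gram_regular n P x"
begin

private abbreviation "A \<equiv> {..<n} \<times> {j}"
private abbreviation "y z \<equiv> merge J A (x, z)"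
private abbreviation "G \<equiv> gram_inv n P x"

private lemma inv: "inv_on P (gram n x) G"
  using reg by (simp add: gram_regular_def)

private lemma y_old: "i < n \<Longrightarrow> k \<in> P \<Longrightarrow> y z (i, k) = x (i, k)"
  using J by (auto simp: merge_def)

private lemma y_new: "i < n \<Longrightarrow> y z (i, j) = z (i, j)"
  using J by (auto simp: merge_def)

private lemma G_y: "gram_inv n P (y z) = G"
  using y_old by (intro gram_inv_cong P) auto

private lemma gram_y: "k \<in> P \<Longrightarrow> gram n (y z) k j = (\<Sum>i<n. x (i, k) * z (i, j))"
    "k \<in> P \<Longrightarrow> gram n (y z) j k = (\<Sum>i<n. x (i, k) * z (i, j))"
    "gram n (y z) j j = (\<Sum>i<n. (z (i, j))\<^sup>2)"
  by (simp_all add: gram_def y_old y_new power2_eq_square mult.commute)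

lemma gram_regular_merge: "gram_regular n P (merge J ({..<n} \<times> {j}) (x, z))"
proof -
  have "gram n (y z) k l = gram n x k l" if "k \<in> P" "l \<in> P" for k l
    using that by (intro gram_cong y_old)
  then show ?thesis
    using inv by (simp add: gram_regular_def G_y inv_on_def)
qed

text \<open>By locality the inverse Gram matrix does not see the fresh column, so conditionally on
  the others the coefficients are linear in it.\<close>

lemma ols_coef_merge:
  "ols_coef n P j (merge J ({..<n} \<times> {j}) (x, z)) k = (\<Sum>a\<in>{..<n} \<times> {j}. (\<Sum>l\<in>P. G k l * x (fst a, l)) * z a)"
proof -
  have "ols_coef n P j (y z) k = (\<Sum>l\<in>P. G k l * (\<Sum>i<n. x (i, l) * z (i, j)))"
    unfolding ols_coef_def schur_coef_def G_y by (intro sum.cong refl) (simp add: gram_y)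
  also have "\<dots> = (\<Sum>i<n. \<Sum>l\<in>P. G k l * x (i, l) * z (i, j))"
    by (subst sum.swap) (simp add: sum_distrib_left mult.assoc)
  finally show ?thesis by (simp add: sum_column sum_distrib_right)
qed

text \<open>The conditional variance of coefficient \<open>k\<close>, read off the diagonal of
  \<open>G W G = G\<close>.\<close>

lemma sum_square_coefs: "k \<in> P \<Longrightarrow> (\<Sum>a\<in>{..<n} \<times> {j}. (\<Sum>l\<in>P. G k l * x (fst a, l))\<^sup>2) = G k k"
proof -
  assume k: "k \<in> P"
  have "(\<Sum>a\<in>A. (\<Sum>l\<in>P. G k l * x (fst a, l))\<^sup>2) = (\<Sum>l\<in>P. G k l * (\<Sum>m\<in>P. gram n x l m * G k m))"
    by (simp add: sum_column sum_square_eq_gram)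
  also have "\<dots> = (\<Sum>l\<in>P. G k l * (\<Sum>m\<in>P. gram n x l m * G m k))"
    using inv_on_sym[OF P(1) sym_on_gram inv k] by (intro sum.cong refl arg_cong2[where f="(*)"]) simp
  also have "\<dots> = (\<Sum>l\<in>P. G k l * of_bool (l = k))"
    using inv k by (intro sum.cong refl) (simp add: inv_on_def)
  also have "\<dots> = G k k" by (intro sum_of_bool_mult P k)
  finally show ?thesis .
qed

text \<open>The squared residual is the quadratic form of the identity minus the hat matrix, a
  projection of trace \<open>n - card P\<close>, which exceeds 2 by assumption.\<close>

lemma nn_integral_resid2_merge:
  assumes "card P + 2 < n"
  shows "(\<integral>\<^sup>+ z. inverse (ennreal (resid2 n P j (merge J ({..<n} \<times> {j}) (x, z)))) \<partial>gauss ({..<n} \<times> {j}))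
       = ennreal (1 / (real n - real (card P) - 2))"
proof -
  define Q where "Q a b = of_bool (a = b) - hat P x G (fst a) (fst b)" for a b :: "nat \<times> nat"
  have "resid2 n P j (y z) = (\<Sum>a\<in>A. \<Sum>b\<in>A. z a * Q a b * z b)" for z
  proof -
    have "resid2 n P j (y z) = (\<Sum>i<n. (z (i, j))\<^sup>2)
        - (\<Sum>k\<in>P. (\<Sum>i<n. x (i, k) * z (i, j)) * (\<Sum>i'<n. (\<Sum>l\<in>P. G k l * x (i', l)) * z (i', j)))"
      unfolding resid2_def schur_def ols_coef_def[symmetric] ols_coef_merge
      by (simp add: gram_y sum_column cong: sum.cong)
    also have "(\<Sum>k\<in>P. (\<Sum>i<n. x (i, k) * z (i, j)) * (\<Sum>i'<n. (\<Sum>l\<in>P. G k l * x (i', l)) * z (i', j)))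
        = (\<Sum>k\<in>P. \<Sum>i<n. \<Sum>i'<n. z (i, j) * (x (i, k) * (\<Sum>l\<in>P. G k l * x (i', l))) * z (i', j))"
      by (simp add: sum_product mult_ac)
    also have "\<dots> = (\<Sum>i<n. \<Sum>i'<n. \<Sum>k\<in>P. z (i, j) * (x (i, k) * (\<Sum>l\<in>P. G k l * x (i', l))) * z (i', j))"
      by (rule sum_swap3)
    also have "\<dots> = (\<Sum>i<n. \<Sum>i'<n. z (i, j) * hat P x G i i' * z (i', j))"
      by (simp add: hat_def sum_distrib_left sum_distrib_right)
    also have "(\<Sum>i<n. (z (i, j))\<^sup>2) = (\<Sum>i<n. \<Sum>i'<n. z (i, j) * z (i', j) * of_bool (i = i'))"
      by (intro sum.cong refl) (subst sum_of_bool_mult, auto simp: power2_eq_square)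
    also have "(\<Sum>i<n. \<Sum>i'<n. z (i, j) * z (i', j) * of_bool (i = i')) - (\<Sum>i<n. \<Sum>i'<n. z (i, j) * hat P x G i i' * z (i', j))
        = (\<Sum>a\<in>A. \<Sum>b\<in>A. z a * Q a b * z b)"
      unfolding sum_column sum_subtractf[symmetric]
      by (intro sum.cong refl) (simp add: Q_def algebra_simps)
    finally show ?thesis .
  qed
  moreover have "sym_on A Q"
    using hat_sym[OF P(1) inv] by (auto simp: sym_on_def Q_def)
  moreover have "\<forall>a\<in>A. \<forall>b\<in>A. (\<Sum>c\<in>A. Q a c * Q c b) = Q a b"
  proof (intro ballI)
    fix a b assume "a \<in> A" "b \<in> A"
    then obtain i i' where ab: "a = (i, j)" "b = (i', j)" "i < n" "i' < n" by auto
    have "(\<Sum>c\<in>A. Q a c * Q c b) = (\<Sum>c<n. of_bool (i = c) * of_bool (c = i')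
       - of_bool (i = c) * hat P x G c i' - hat P x G i c * of_bool (c = i') + hat P x G i c * hat P x G c i')"
      by (simp add: sum_column Q_def ab algebra_simps)
    also have "\<dots> = of_bool (i = i') - hat P x G i i' - hat P x G i i' + hat P x G i i'"
      unfolding sum.distrib sum_subtractf hat_idem[OF P(1) inv]
      by (simp add: sum_of_bool_mult ab(3,4))
    finally show "(\<Sum>c\<in>A. Q a c * Q c b) = Q a b" by (simp add: Q_def ab)
  qed
  moreover have tr: "(\<Sum>a\<in>A. Q a a) = real n - real (card P)"
    using hat_trace[OF P(1) inv] by (simp add: sum_column Q_def sum_subtractf)
  ultimately show ?thesis
    using nn_integral_gauss_inverse_projection[of A Q] assms by simp
qed

lemma nn_integral_ols_norm2_merge:
  "(\<integral>\<^sup>+ z. ennreal (ols_norm2 n P j (merge J ({..<n} \<times> {j}) (x, z))) \<partial>gauss ({..<n} \<times> {j}))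
    = (\<Sum>k\<in>P. ennreal (G k k))"
proof -
  have "(\<integral>\<^sup>+ z. ennreal (ols_norm2 n P j (y z)) \<partial>gauss A)
      = (\<integral>\<^sup>+ z. (\<Sum>k\<in>P. ennreal ((0 + (\<Sum>a\<in>A. (\<Sum>l\<in>P. G k l * x (fst a, l)) * z a))\<^sup>2)) \<partial>gauss A)"
    unfolding ols_norm2_def ols_coef_merge by (intro nn_integral_cong) (simp add: sum_ennreal)
  also have "\<dots> = (\<Sum>k\<in>P. \<integral>\<^sup>+ z. ennreal ((0 + (\<Sum>a\<in>A. (\<Sum>l\<in>P. G k l * x (fst a, l)) * z a))\<^sup>2) \<partial>gauss A)"
    by (intro nn_integral_sum measurable_compose[OF _ measurable_ennreal] borel_measurable_power borel_measurable_add
        borel_measurable_sum borel_measurable_times borel_measurable_const measurable_gauss_component)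
  also have "\<dots> = (\<Sum>k\<in>P. ennreal (G k k))"
    by (subst nn_integral_gauss_affine_square) (simp_all add: sum_square_coefs)
  finally show ?thesis .
qed

text \<open>Linearization trades the fresh column \<open>j\<close> for a fresh row \<open>n\<close>.\<close>

lemma nn_integral_inverse_ols_norm2_merge:
  assumes J': "\<And>k. (n, k) \<notin> J"
  shows "(\<integral>\<^sup>+ z. inverse (ennreal (1 + ols_norm2 n P j (merge J ({..<n} \<times> {j}) (x, z)))) \<partial>gauss ({..<n} \<times> {j}))
    = (\<integral>\<^sup>+ g. inverse (ennreal (1 + hat P (merge J ({n} \<times> P) (x, g)) (gram_inv n P (merge J ({n} \<times> P) (x, g))) n n))
        \<partial>gauss ({n} \<times> P))"
proof -
  let ?C = "{n} \<times> P"
  define K where "K a b = (\<Sum>l\<in>P. G (snd b) l * x (fst a, l))" for a b :: "nat \<times> nat"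
  have 1: "ols_norm2 n P j (y z) = (\<Sum>b\<in>?C. (\<Sum>a\<in>A. K a b * z a)\<^sup>2)" for z
    by (simp add: ols_norm2_def ols_coef_merge sum_row K_def)
  have 2: "(\<Sum>a\<in>A. (\<Sum>b\<in>?C. K a b * g b)\<^sup>2)
      = hat P (merge J ?C (x, g)) (gram_inv n P (merge J ?C (x, g))) n n" for g
  proof -
    let ?w = "merge J ?C (x, g)"
    define c where "c l = (\<Sum>k\<in>P. g (n, k) * G k l)" for l
    have w: "?w (n, k) = g (n, k)" if "k \<in> P" for k using J' that by (auto simp: merge_def)
    have "gram_inv n P ?w = G" using J by (intro gram_inv_cong P) (auto simp: merge_def)
    then have h: "hat P ?w (gram_inv n P ?w) n n = (\<Sum>k\<in>P. g (n, k) * (\<Sum>l\<in>P. G k l * g (n, l)))"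
      by (simp add: hat_def w)
    \<comment> \<open>With \<open>c = G g\<close> the transposed form is
      \<open>|X c|^2 = c^T W c = c^T g = g^T G g\<close>, the hat entry of the new row against the
      old design.\<close>
    have Wc: "(\<Sum>l\<in>P. gram n x k l * c l) = g (n, k)" if "k \<in> P" for k
    proof -
      have "(\<Sum>l\<in>P. gram n x k l * c l) = (\<Sum>l\<in>P. \<Sum>m\<in>P. (gram n x k l * G l m) * g (n, m))"
        unfolding c_def sum_distrib_left using inv_on_sym[OF P(1) sym_on_gram inv]
        by (intro sum.cong refl) simp
      also have "\<dots> = (\<Sum>m\<in>P. (\<Sum>l\<in>P. gram n x k l * G l m) * g (n, m))"
        by (subst sum.swap) (simp add: sum_distrib_right)
      also have "\<dots> = (\<Sum>m\<in>P. of_bool (k = m) * g (n, m))"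
        using inv that by (intro sum.cong refl) (simp add: inv_on_def)
      also have "\<dots> = g (n, k)" by (intro sum_of_bool_mult P that)
      finally show ?thesis .
    qed
    have "(\<Sum>a\<in>A. (\<Sum>b\<in>?C. K a b * g b)\<^sup>2) = (\<Sum>i<n. (\<Sum>l\<in>P. c l * x (i, l))\<^sup>2)"
    proof -
      have "(\<Sum>k\<in>P. (\<Sum>l\<in>P. G k l * x (i, l)) * g (n, k)) = (\<Sum>l\<in>P. c l * x (i, l))" for i
        unfolding c_def sum_distrib_right by (subst sum.swap) (simp add: mult_ac)
      then show ?thesis by (simp add: sum_column sum_row K_def)
    qed
    also have "\<dots> = (\<Sum>k\<in>P. c k * g (n, k))"
      unfolding sum_square_eq_gram by (intro sum.cong refl) (simp only: Wc)
    also have "\<dots> = (\<Sum>l\<in>P. \<Sum>k\<in>P. g (n, k) * (G k l * g (n, l)))"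
      unfolding c_def sum_distrib_right by (simp only: mult_ac)
    also have "\<dots> = hat P ?w (gram_inv n P ?w) n n"
      unfolding h sum_distrib_left by (rule sum.swap)
    finally show ?thesis .
  qed
  show ?thesis
    unfolding 1 2[symmetric] using P by (intro nn_integral_gauss_inverse_transpose) auto
qed

end

text \<open>Columns are added one at a time. Given the earlier ones, the inverse squared residual
  has finite expectation, so the residual is almost surely nonzero and bordering provides the next
  inverse.\<close>

lemma AE_gram_regular:
  assumes "finite P" "finite I" "{..<n} \<times> P \<subseteq> I" "card P + 2 < n"
  shows "AE x in gauss I. gram_regular n P x"
  using assms
proof (induction P arbitrary: I rule: finite_induct)
  case empty
  show ?case by (simp add: gram_regular_def inv_on_def)
next
  case (insert j P)
  define A where "A = {..<n} \<times> {j}"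
  define J where "J = I - A"
  have J: "{..<n} \<times> P \<subseteq> J" "({..<n} \<times> {j}) \<inter> J = {}" "J \<inter> A = {}" "J \<union> A = I" "finite J" "finite A"
    using insert.prems insert.hyps by (auto simp: J_def A_def)
  have card: "card P + 2 < n" using insert.prems insert.hyps by simp
  have "AE x in gauss (J \<union> A). gram_regular n (insert j P) x"
  proof (rule AE_gauss_union)
    show "Measurable.pred (gauss (J \<union> A)) (gram_regular n (insert j P))"
      using insert.prems insert.hyps J by (intro measurable_gram_regular) auto
    show "AE x in gauss J. AE z in gauss A. gram_regular n (insert j P) (merge J A (x, z))"
    proof (rule AE_mp[OF insert.IH[OF J(5,1) card]], rule AE_I2, rule impI)
      fix x assume x: "x \<in> space (gauss J)" "gram_regular n P x"
      note * = insert.hyps J(1,2) x(2)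
      have meas: "(\<lambda>z. inverse (ennreal (resid2 n P j (merge J A (x, z))))) \<in> borel_measurable (gauss A)"
      proof -
        have "(\<lambda>z. merge J A (x, z)) \<in> gauss A \<rightarrow>\<^sub>M gauss (J \<union> A)"
          using measurable_compose[OF measurable_Pair1'[of x "gauss J" "gauss A", OF x(1)],
              of "merge J A" "gauss (J \<union> A)"] 
          by (simp add: gauss_def)
        then show ?thesis
          using measurable_resid2[of P n j "J \<union> A"] insert.hyps insert.prems J
          by (intro borel_measurable_inverse_ennreal measurable_compose[OF _ measurable_ennreal])
             (auto intro: measurable_compose)
      qed
      have "(\<integral>\<^sup>+ z. inverse (ennreal (resid2 n P j (merge J A (x, z)))) \<partial>gauss A) \<noteq> \<infinity>"
        unfolding A_def using nn_integral_resid2_merge[OF * card] by simp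
      \<comment> \<open>A vanishing residual would make the inverse infinite in
        \<open>ennreal\<close>, which a finite integral permits only on a null set.\<close>
      then have fin: "AE z in gauss A. inverse (ennreal (resid2 n P j (merge J A (x, z)))) \<noteq> \<infinity>"
        by (rule nn_integral_PInf_AE[OF meas])
      show "AE z in gauss A. gram_regular n (insert j P) (merge J A (x, z))"
      proof (rule AE_mp[OF fin], rule AE_I2, rule impI)
        fix z assume "inverse (ennreal (resid2 n P j (merge J A (x, z)))) \<noteq> \<infinity>"
        then have "resid2 n P j (merge J A (x, z)) \<noteq> 0" by auto
        then have "inv_on (insert j P) (gram n (merge J A (x, z)))
            (border P (gram n (merge J A (x, z))) (gram_inv n P (merge J A (x, z))) j)"
          using gram_regular_merge[OF *, of z]
          by (intro inv_on_border insert.hyps sym_on_gram) (auto simp: resid2_def gram_regular_def A_def)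
        then show "gram_regular n (insert j P) (merge J A (x, z))"
          unfolding gram_regular_def using insert.hyps by (intro inv_on_gram_inv) auto
      qed
    qed
  qed (use J in auto)
  then show ?case unfolding J(4) .
qed

text \<open>Conditioning on everything except column \<open>j\<close>. The inner formula is supplied
  on regular designs, which have full measure.\<close>

lemma nn_integral_gauss_column:
  assumes "finite I" "finite P" "j \<notin> P" "{..<n} \<times> insert j P \<subseteq> I" "card P + 2 < n"
    and f: "f \<in> borel_measurable (gauss I)"
    and g: "\<And>x. gram_regular n P x \<Longrightarrow>
      (\<integral>\<^sup>+ z. f (merge (I - {..<n} \<times> {j}) ({..<n} \<times> {j}) (x, z)) \<partial>gauss ({..<n} \<times> {j})) = g x"
  shows "integral\<^sup>N (gauss I) f = integral\<^sup>N (gauss (I - {..<n} \<times> {j})) g"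
proof -
  define A where "A = {..<n} \<times> {j}"
  have I: "I = (I - A) \<union> A" using assms(4) by (auto simp: A_def)
  have "integral\<^sup>N (gauss ((I - A) \<union> A)) f
      = (\<integral>\<^sup>+ x. (\<integral>\<^sup>+ z. f (merge (I - A) A (x, z)) \<partial>gauss A) \<partial>gauss (I - A))"
    by (rule nn_integral_gauss_union) (use assms(1) f I in \<open>auto simp: A_def\<close>)
  also have "\<dots> = integral\<^sup>N (gauss (I - A)) g"
  proof (rule nn_integral_cong_AE)
    have "AE x in gauss (I - A). gram_regular n P x"
      using assms by (intro AE_gram_regular) (auto simp: A_def)
    then show "AE x in gauss (I - A). (\<integral>\<^sup>+ z. f (merge (I - A) A (x, z)) \<partial>gauss A) = g x"
      by (rule AE_mp, intro AE_I2 impI) (simp add: g A_def)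
  qed
  finally show ?thesis using I by (simp add: A_def)
qed

section \<open>Expectations over the whole design\<close>

lemma column_disjoint:
  assumes "j \<notin> P" "{..<n} \<times> insert j P \<subseteq> I"
  shows "{..<n} \<times> P \<subseteq> I - {..<n} \<times> {j}" "({..<n} \<times> {j}) \<inter> (I - {..<n} \<times> {j}) = {}"
  using assms by auto

lemma nn_integral_inverse_resid2:
  assumes "finite I" "finite P" "j \<notin> P" "{..<n} \<times> insert j P \<subseteq> I" "card P + 2 < n"
  shows "(\<integral>\<^sup>+ x. inverse (ennreal (resid2 n P j x)) \<partial>gauss I) = ennreal (1 / (real n - real (card P) - 2))"
proof -
  interpret prob_space "gauss (I - {..<n} \<times> {j})" by (rule prob_space_gauss)
  have "(\<integral>\<^sup>+ x. inverse (ennreal (resid2 n P j x)) \<partial>gauss I)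
      = (\<integral>\<^sup>+ x. ennreal (1 / (real n - real (card P) - 2)) \<partial>gauss (I - {..<n} \<times> {j}))"
  proof (rule nn_integral_gauss_column[OF assms])
    show "(\<lambda>x. inverse (ennreal (resid2 n P j x))) \<in> borel_measurable (gauss I)"
      by (intro borel_measurable_inverse_ennreal measurable_compose[OF _ measurable_ennreal] measurable_resid2 assms)
  qed (rule nn_integral_resid2_merge[OF assms(2,3) column_disjoint[OF assms(3,4)] _ assms(5)])
  then show ?thesis by (simp add: emeasure_space_1)
qed

text \<open>Column \<open>j\<close> is regressed on the \<open>card P - 1\<close> other columns of
  \<open>P\<close>, which turns the constant 2 of the inverse residual moment into 1.\<close>

lemma nn_integral_gram_inv_diag:
  assumes "finite I" "finite P" "j \<in> P" "{..<n} \<times> P \<subseteq> I" "card P + 2 < n"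
  shows "(\<integral>\<^sup>+ x. ennreal (gram_inv n P x j j) \<partial>gauss I) = ennreal (1 / (real n - real (card P) - 1))"
proof -
  define P' where "P' = P - {j}"
  have P': "finite P'" "j \<notin> P'" "insert j P' = P" "card P = Suc (card P')"
    using assms(2,3) card_Suc_Diff1[OF assms(2,3)] by (auto simp: P'_def)
  have "AE x in gauss I. gram_regular n P x" "AE x in gauss I. gram_regular n P' x"
    using assms P' by (intro AE_gram_regular; auto)+
  then have "AE x in gauss I. ennreal (gram_inv n P x j j) = inverse (ennreal (resid2 n P' j x))"
  proof eventually_elim
    case (elim x)
    then have inv: "inv_on P' (gram n x) (gram_inv n P' x)" "inv_on (insert j P') (gram n x) (gram_inv n P x)"
      by (auto simp: gram_regular_def P')
    have "gram_inv n P x j j * resid2 n P' j x = 1"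
      unfolding resid2_def by (rule inv_on_diag_schur[OF P'(1,2) sym_on_gram inv])
    moreover have "resid2 n P' j x \<ge> 0"
      unfolding resid2_def by (rule schur_gram_nonneg[OF P'(1,2) inv(1)])
    ultimately have "resid2 n P' j x > 0" "gram_inv n P x j j = inverse (resid2 n P' j x)"
      using inverse_unique[of "resid2 n P' j x" "gram_inv n P x j j"] by (auto simp: less_le mult.commute)
    then show ?case by (simp add: inverse_ennreal)
  qed
  then have "(\<integral>\<^sup>+ x. ennreal (gram_inv n P x j j) \<partial>gauss I) = (\<integral>\<^sup>+ x. inverse (ennreal (resid2 n P' j x)) \<partial>gauss I)"
    by (rule nn_integral_cong_AE)
  also have "\<dots> = ennreal (1 / (real n - real (card P') - 2))"
    using assms P' by (intro nn_integral_inverse_resid2) auto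
  finally show ?thesis by (simp add: P'(4))
qed

lemma nn_integral_ols_norm2:
  assumes "finite I" "finite P" "j \<notin> P" "{..<n} \<times> insert j P \<subseteq> I" "card P + 2 < n"
  shows "(\<integral>\<^sup>+ x. ennreal (ols_norm2 n P j x) \<partial>gauss I) = ennreal (card P / (real n - real (card P) - 1))"
proof -
  let ?J = "I - {..<n} \<times> {j}"
  have "(\<integral>\<^sup>+ x. ennreal (ols_norm2 n P j x) \<partial>gauss I)
      = (\<integral>\<^sup>+ x. (\<Sum>k\<in>P. ennreal (gram_inv n P x k k)) \<partial>gauss ?J)"
  proof (rule nn_integral_gauss_column[OF assms])
    show "(\<lambda>x. ennreal (ols_norm2 n P j x)) \<in> borel_measurable (gauss I)"
      by (intro measurable_compose[OF _ measurable_ennreal] measurable_ols_norm2 assms)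
  qed (rule nn_integral_ols_norm2_merge[OF assms(2,3) column_disjoint[OF assms(3,4)]])
  also have "\<dots> = (\<Sum>k\<in>P. \<integral>\<^sup>+ x. ennreal (gram_inv n P x k k) \<partial>gauss ?J)"
    by (intro nn_integral_sum measurable_compose[OF _ measurable_ennreal] measurable_gram_inv
        column_disjoint[OF assms(3,4)] assms)
  also have "\<dots> = (\<Sum>k\<in>P. ennreal (1 / (real n - real (card P) - 1)))"
    using assms by (intro sum.cong refl nn_integral_gram_inv_diag column_disjoint[OF assms(3,4)]) auto
  also have "\<dots> = ennreal (card P / (real n - real (card P) - 1))"
    using assms(5) by (subst sum_ennreal) auto
  finally show ?thesis .
qed

section \<open>Leverages and the expectation of the inverse\<close>

lemma gram_Suc: "gram (Suc n) x k l = gram n x k l + x (n, k) * x (n, l)"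
  by (simp add: gram_def)

lemma measurable_hat:
  assumes "finite P" "{..<n} \<times> P \<subseteq> I" "\<And>k. k \<in> P \<Longrightarrow> (a, k) \<in> I" "\<And>k. k \<in> P \<Longrightarrow> (b, k) \<in> I"
  shows "(\<lambda>x. hat P x (gram_inv n P x) a b) \<in> borel_measurable (gauss I)"
  unfolding hat_def
  by (intro borel_measurable_sum borel_measurable_times measurable_gauss_component measurable_gram_inv assms)

text \<open>A rank-one update in the style of Sherman and Morrison. The vector
  \<open>u = G x\<close> for the new row \<open>x\<close> satisfies
  \<open>(W + x x^T) u = (1 + s) x\<close>, hence \<open>u = (1 + s) G' x\<close>. Pairing with
  \<open>x\<close> gives \<open>s = (1 + s) s'\<close> for the entries \<open>s\<close> and
  \<open>s'\<close> without and with the new row.\<close>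

lemma leave_one_out_leverage:
  assumes P: "finite P" and reg: "inv_on P (gram n x) G" "inv_on P (gram (Suc n) x) G'"
  shows "hat P x G n n \<ge> 0" "(1 + hat P x G n n) * (1 - hat P x G' n n) = 1"
proof -
  define s where "s = hat P x G n n"
  define u where "u k = (\<Sum>l\<in>P. G k l * x (n, l))" for k
  have s: "s = (\<Sum>k\<in>P. x (n, k) * u k)" by (simp add: s_def hat_def u_def)
  show s0: "hat P x G n n \<ge> 0" by (rule hat_nonneg[OF P reg(1)])
  have Wu: "(\<Sum>l\<in>P. gram n x k l * u l) = x (n, k)" if "k \<in> P" for k
  proof -
    have "(\<Sum>l\<in>P. gram n x k l * u l) = (\<Sum>m\<in>P. (\<Sum>l\<in>P. gram n x k l * G l m) * x (n, m))"
      unfolding u_def sum_distrib_left sum_distrib_right by (subst sum.swap) (simp add: mult.assoc)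
    also have "\<dots> = (\<Sum>m\<in>P. of_bool (k = m) * x (n, m))"
      using reg(1) that by (intro sum.cong refl) (simp add: inv_on_def)
    also have "\<dots> = x (n, k)" by (intro sum_of_bool_mult P that)
    finally show ?thesis .
  qed
  have Wu': "(\<Sum>l\<in>P. gram (Suc n) x k l * u l) = (1 + s) * x (n, k)" if "k \<in> P" for k
  proof -
    have "(\<Sum>l\<in>P. gram (Suc n) x k l * u l) = (\<Sum>l\<in>P. gram n x k l * u l) + x (n, k) * s"
      by (simp add: gram_Suc distrib_right sum.distrib s sum_distrib_left mult.assoc)
    then show ?thesis using Wu[OF that] by (simp add: algebra_simps)
  qed
  have "u k = (1 + s) * (\<Sum>l\<in>P. G' k l * x (n, l))" if "k \<in> P" for k
  proof -
    have "u k = (\<Sum>m\<in>P. G' m k * ((1 + s) * x (n, m)))"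
      by (rule inv_on_solve[OF P sym_on_gram reg(2) Wu' that])
    also have "\<dots> = (1 + s) * (\<Sum>m\<in>P. G' m k * x (n, m))" by (simp add: sum_distrib_left mult_ac)
    also have "(\<Sum>m\<in>P. G' m k * x (n, m)) = (\<Sum>m\<in>P. G' k m * x (n, m))"
      using inv_on_sym[OF P sym_on_gram reg(2)] that by (intro sum.cong refl) simp
    finally show ?thesis .
  qed
  then have "s = (\<Sum>k\<in>P. x (n, k) * ((1 + s) * (\<Sum>l\<in>P. G' k l * x (n, l))))"
    unfolding s by (intro sum.cong refl) simp
  also have "\<dots> = (1 + s) * hat P x G' n n"
    by (simp add: hat_def sum_distrib_left mult_ac)
  finally show "(1 + hat P x G n n) * (1 - hat P x G' n n) = 1"
    by (simp add: s_def algebra_simps)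
qed

lemma nn_integral_leverage:
  assumes "finite I" "finite P" "{..<n} \<times> P \<subseteq> I" "card P + 2 < n" "i < n"
  shows "(\<integral>\<^sup>+ x. ennreal (hat P x (gram_inv n P x) i i) \<partial>gauss I) = ennreal (card P / n)"
proof -
  interpret prob_space "gauss I" by (rule prob_space_gauss)
  define h where "h i x = ennreal (hat P x (gram_inv n P x) i i)" for i x
  have meas: "h i \<in> borel_measurable (gauss I)" if "i < n" for i
    unfolding h_def[abs_def] using assms(1-3) that
    by (intro measurable_compose[OF _ measurable_ennreal] measurable_hat) auto
  have AE: "AE x in gauss I. gram_regular n P x" by (rule AE_gram_regular[OF assms(2,1,3,4)])
  have exch: "integral\<^sup>N (gauss I) (h i') = integral\<^sup>N (gauss I) (h i)" if i': "i' < n" for i'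
  proof -
    \<comment> \<open>The swap is confined to columns in \<open>P\<close>: elsewhere
      \<open>I\<close> may contain an entry of one of the two rows and not of the other.\<close>
    define \<pi> where "\<pi> = (\<lambda>(a, k). if k \<in> P then (Transposition.transpose i i' a, k) else (a, k :: nat))"
    have \<pi>I: "\<pi> a \<in> I" if "a \<in> I" for a
      using assms(3) that i' assms(5) by (auto simp: \<pi>_def Transposition.transpose_def split: prod.split)
    have \<pi>\<pi>: "\<pi> (\<pi> a) = a" for a by (auto simp: \<pi>_def split: prod.split)
    have bij: "bij_betw \<pi> I I"
      by (rule bij_betw_byWitness[where f'=\<pi>]) (auto simp: \<pi>I \<pi>\<pi>)
    have "integral\<^sup>N (gauss I) (h i) = (\<integral>\<^sup>+ x. h i (\<lambda>a\<in>I. x (\<pi> a)) \<partial>gauss I)"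
      by (rule nn_integral_gauss_reindex[OF bij meas[OF assms(5)], symmetric])
    also have "\<dots> = integral\<^sup>N (gauss I) (h i')"
    proof (rule nn_integral_cong_AE, rule AE_mp[OF AE], rule AE_I2, rule impI)
      fix x assume "gram_regular n P x"
      then have inv: "inv_on P (gram n x) (gram_inv n P x)" by (simp add: gram_regular_def)
      let ?y = "\<lambda>a\<in>I. x (\<pi> a)"
      have y: "?y (a, k) = x (Transposition.transpose i i' a, k)" if "a < n" "k \<in> P" for a k
        using assms(3) that by (auto simp: \<pi>_def)
      have perm: "Transposition.transpose i i' permutes {..<n}"
        using assms(5) i' by (intro permutes_swap_id) auto
      have gram: "gram n ?y k l = gram n x k l" if "k \<in> P" "l \<in> P" for k l
      proof -
        have "gram n ?y k l = (\<Sum>a<n. x (Transposition.transpose i i' a, k) * x (Transposition.transpose i i' a, l))"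
          unfolding gram_def using that by (intro sum.cong refl) (simp only: y lessThan_iff)
        also have "\<dots> = gram n x k l"
          unfolding gram_def by (rule sum.permute[OF perm, unfolded o_def, symmetric])
        finally show ?thesis .
      qed
      have "inv_on P (gram n ?y) (gram_inv n P x)"
        using inv gram by (simp add: inv_on_def)
      then have inv': "inv_on P (gram n ?y) (gram_inv n P ?y)" by (rule inv_on_gram_inv[OF assms(2)])
      have inv'': "inv_on P (gram n x) (gram_inv n P ?y)"
        unfolding inv_on_def
      proof (intro ballI)
        fix k l assume kl: "k \<in> P" "l \<in> P"
        have "(\<Sum>m\<in>P. gram n x k m * gram_inv n P ?y m l) = (\<Sum>m\<in>P. gram n ?y k m * gram_inv n P ?y m l)"
          by (intro sum.cong refl) (simp only: gram[OF kl(1)])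
        then show "(\<Sum>m\<in>P. gram n x k m * gram_inv n P ?y m l) = of_bool (k = l)"
          using inv' kl unfolding inv_on_def by (simp only:)
      qed
      \<comment> \<open>Swapping rows preserves the Gram matrix on \<open>P\<close>. Locality does
        not apply, as the entries themselves have moved, but on a regular design uniqueness
        identifies the two inverses.\<close>
      have G: "gram_inv n P ?y k l = gram_inv n P x k l" if "k \<in> P" "l \<in> P" for k l
        by (rule inv_on_unique'[OF assms(2) sym_on_gram inv inv'' that])
      show "h i ?y = h i' x"
        unfolding h_def hat_def
      proof (intro arg_cong[where f=ennreal] sum.cong refl arg_cong2[where f="(*)"])
        show "?y (i, k) = x (i', k)" if "k \<in> P" for k
          using y[OF assms(5) that] by simp
        then show "?y (i, l) = x (i', l)" if "l \<in> P" for l using that .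
        show "gram_inv n P ?y k l = gram_inv n P x k l" if "k \<in> P" "l \<in> P" for k l
          using that by (rule G)
      qed
    qed
    finally show ?thesis by simp
  qed
  have "(\<Sum>i'<n. integral\<^sup>N (gauss I) (h i')) = (\<integral>\<^sup>+ x. (\<Sum>i'<n. h i' x) \<partial>gauss I)"
    by (intro nn_integral_sum[symmetric] meas) simp
  also have "\<dots> = (\<integral>\<^sup>+ x. ennreal (card P) \<partial>gauss I)"
  proof (rule nn_integral_cong_AE, rule AE_mp[OF AE], rule AE_I2, rule impI)
    fix x assume "gram_regular n P x"
    then have inv: "inv_on P (gram n x) (gram_inv n P x)" by (simp add: gram_regular_def)
    show "(\<Sum>i'<n. h i' x) = ennreal (card P)"
      unfolding h_def using hat_trace[OF assms(2) inv] hat_nonneg[OF assms(2) inv] by (subst sum_ennreal) auto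
  qed
  also have "\<dots> = ennreal (card P)" by (simp add: emeasure_space_1)
  finally have "of_nat n * integral\<^sup>N (gauss I) (h i) = ennreal (card P)"
    by (simp add: exch)
  then have "ennreal n * integral\<^sup>N (gauss I) (h i) = ennreal (card P)"
    by (simp add: ennreal_of_nat_eq_real_of_nat)
  moreover have n0: "real n > 0" using assms(5) by simp
  ultimately have "ennreal (1 / n) * (ennreal n * integral\<^sup>N (gauss I) (h i)) = ennreal (1 / n) * ennreal (card P)"
    by simp
  then show ?thesis
    using n0 by (simp add: h_def[abs_def] mult.assoc[symmetric] ennreal_mult[symmetric])
qed

text \<open>Row index \<open>n\<close> is kept free so that the fresh row can be stored there. The
  index set loses column \<open>j\<close> and gains row \<open>n\<close>, and the first
  \<open>Suc n\<close> rows then form an ordinary Gaussian design on \<open>P\<close>.\<close>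

lemma nn_integral_inverse_ols_norm2:
  assumes "finite I" "finite P" "j \<notin> P" "{..<n} \<times> insert j P \<subseteq> I" "card P + 2 < n"
    and row: "\<And>k. (n, k) \<notin> I"
  shows "(\<integral>\<^sup>+ x. inverse (ennreal (1 + ols_norm2 n P j x)) \<partial>gauss I) = ennreal (1 - card P / (real n + 1))"
proof -
  let ?J = "I - {..<n} \<times> {j}"
  let ?C = "{n} \<times> P"
  let ?h = "\<lambda>m x. hat P x (gram_inv m P x) n n"
  interpret prob_space "gauss (?J \<union> ?C)" by (rule prob_space_gauss)
  have sub: "{..<n} \<times> P \<subseteq> ?J \<union> ?C" "{..<Suc n} \<times> P \<subseteq> ?J \<union> ?C"
  proof -
    show "{..<n} \<times> P \<subseteq> ?J \<union> ?C" by (rule le_supI1[OF column_disjoint(1)[OF assms(3,4)]])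
    moreover have "{..<Suc n} \<times> P = {..<n} \<times> P \<union> ?C" by (auto simp: less_Suc_eq)
    ultimately show "{..<Suc n} \<times> P \<subseteq> ?J \<union> ?C" by simp
  qed
  have fin: "finite (?J \<union> ?C)" using assms(1,2) by simp
  have meas: "(\<lambda>x. ?h m x) \<in> borel_measurable (gauss (?J \<union> ?C))" if "m = n \<or> m = Suc n" for m
    using assms(2) sub that by (intro measurable_hat) auto
  have meas': "(\<lambda>x. inverse (ennreal (1 + ?h n x))) \<in> borel_measurable (gauss (?J \<union> ?C))"
    by (intro borel_measurable_inverse_ennreal measurable_compose[OF _ measurable_ennreal]
        borel_measurable_add borel_measurable_const meas) simp
  have "(\<integral>\<^sup>+ x. inverse (ennreal (1 + ols_norm2 n P j x)) \<partial>gauss I)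
      = (\<integral>\<^sup>+ x. (\<integral>\<^sup>+ g. inverse (ennreal (1 + ?h n (merge ?J ?C (x, g)))) \<partial>gauss ?C) \<partial>gauss ?J)"
  proof (rule nn_integral_gauss_column[OF assms(1-5)])
    show "(\<lambda>x. inverse (ennreal (1 + ols_norm2 n P j x))) \<in> borel_measurable (gauss I)"
      by (intro borel_measurable_inverse_ennreal measurable_compose[OF _ measurable_ennreal]
          borel_measurable_add borel_measurable_const measurable_ols_norm2 assms)
  qed (rule nn_integral_inverse_ols_norm2_merge[OF assms(2,3) column_disjoint[OF assms(3,4)]], use row in auto)
  also have "\<dots> = (\<integral>\<^sup>+ x. inverse (ennreal (1 + ?h n x)) \<partial>gauss (?J \<union> ?C))"
    by (rule nn_integral_gauss_union[symmetric, OF _ _ _ meas']) (use row assms(1,2) in auto)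
  also have "\<dots> = ennreal (1 - card P / (real n + 1))"
  proof -
    have "AE x in gauss (?J \<union> ?C). gram_regular n P x" "AE x in gauss (?J \<union> ?C). gram_regular (Suc n) P x"
      using assms(5) by (intro AE_gram_regular assms fin sub; simp)+
    then have "AE x in gauss (?J \<union> ?C). inverse (ennreal (1 + ?h n x)) + ennreal (?h (Suc n) x) = 1"
    proof eventually_elim
      case (elim x)
      then have inv: "inv_on P (gram n x) (gram_inv n P x)" "inv_on P (gram (Suc n) x) (gram_inv (Suc n) P x)"
        by (simp_all add: gram_regular_def)
      note * = leave_one_out_leverage[OF assms(2) inv]
      have "?h (Suc n) x \<ge> 0" by (rule hat_nonneg[OF assms(2) inv(2)])
      moreover have "inverse (1 + ?h n x) + ?h (Suc n) x = 1"
        using * by (simp add: field_simps)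
      ultimately show ?case
        using *(1) by (simp add: inverse_ennreal ennreal_plus[symmetric] del: ennreal_plus)
    qed
    then have "(\<integral>\<^sup>+ x. inverse (ennreal (1 + ?h n x)) + ennreal (?h (Suc n) x) \<partial>gauss (?J \<union> ?C)) = 1"
      by (subst nn_integral_cong_AE[where v="\<lambda>_. 1"]) (auto simp: emeasure_space_1)
    then have "(\<integral>\<^sup>+ x. inverse (ennreal (1 + ?h n x)) \<partial>gauss (?J \<union> ?C))
        + (\<integral>\<^sup>+ x. ennreal (?h (Suc n) x) \<partial>gauss (?J \<union> ?C)) = 1"
      by (simp only: nn_integral_add[OF meas' measurable_compose[OF meas[OF disjI2[OF refl]] measurable_ennreal]])
    moreover have "(\<integral>\<^sup>+ x. ennreal (?h (Suc n) x) \<partial>gauss (?J \<union> ?C)) = ennreal (card P / (real n + 1))"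
      using nn_integral_leverage[OF fin assms(2) sub(2), of n] assms(5) by (simp add: add.commute)
    ultimately have e: "(\<integral>\<^sup>+ x. inverse (ennreal (1 + ?h n x)) \<partial>gauss (?J \<union> ?C)) + ennreal (card P / (real n + 1)) = ennreal 1"
      by simp
    \<comment> \<open>The expected leverage is finite, so it may be cancelled in
      \<open>ennreal\<close>.\<close>
    have "ennreal 1 - ennreal (card P / (real n + 1)) = ennreal (1 - card P / (real n + 1))"
      by (rule ennreal_minus) simp
    then show ?thesis
      unfolding e[symmetric] by simp
  qed
  finally show ?thesis .
qed

text \<open>With \<open>u = 1 + R\<close>, the weighted square \<open>(R - c)^2 / u\<close> is a
  combination of \<open>u\<close>, 1 and \<open>1 / u\<close>, whose expectations are all known. The
  free parameter \<delta> converts control of this square into control of the absolute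
  deviation.\<close>

lemma integral_abs_ols_norm2_le:
  assumes "finite I" "finite P" "j \<notin> P" "{..<n} \<times> insert j P \<subseteq> I" "card P + 2 < n"
    and row: "\<And>k. (n, k) \<notin> I" and "\<delta> > 0"
  defines "p \<equiv> real (card P)"
  defines "c \<equiv> p / (real n - p - 1)"
  shows "integrable (gauss I) (ols_norm2 n P j)"
    and "(\<integral>x. \<bar>ols_norm2 n P j x - c\<bar> \<partial>gauss I)
      \<le> (1 + c) * (\<delta> + p / (2 * \<delta> * (real n + 1) * (real n - p - 1)))"
proof -
  interpret prob_space "gauss I" by (rule prob_space_gauss)
  let ?R = "ols_norm2 n P j"
  have np: "real n - p - 1 > 0" "p \<ge> 0" using assms(5) by (auto simp: p_def)
  have c0: "c \<ge> 0" using np by (simp add: c_def)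
  have meas: "?R \<in> borel_measurable (gauss I)" by (intro measurable_ols_norm2 assms)
  have nnR: "(\<integral>\<^sup>+ x. ennreal (?R x) \<partial>gauss I) = ennreal c"
    unfolding c_def p_def by (rule nn_integral_ols_norm2[OF assms(1-5)])
  show intR: "integrable (gauss I) ?R"
    using nnR ols_norm2_nonneg by (intro integrableI_nn_integral_finite[OF meas]) auto
  have R: "(\<integral>x. ?R x \<partial>gauss I) = c"
    using integral_eq_nn_integral[OF meas AE_I2[OF ols_norm2_nonneg]] by (simp add: nnR c0)
  have measi: "(\<lambda>x. inverse (1 + ?R x)) \<in> borel_measurable (gauss I)"
    by (intro borel_measurable_inverse borel_measurable_add borel_measurable_const meas)
  have inv1: "inverse (1 + ?R x) \<le> 1" "inverse (1 + ?R x) \<ge> 0" for x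
    using ols_norm2_nonneg[of n P j x] by (auto simp: field_simps)
  have inti: "integrable (gauss I) (\<lambda>x. inverse (1 + ?R x))"
    using inv1 by (intro integrable_const_bound[where B=1] AE_I2 measi) simp
  have "p / (real n + 1) \<le> 1" using np by (simp add: field_simps)
  moreover have "ennreal (inverse (1 + ?R x)) = inverse (ennreal (1 + ?R x))" for x
    by (rule inverse_ennreal[symmetric]) (use ols_norm2_nonneg[of n P j x] in linarith)
  moreover have "(\<integral>x. inverse (1 + ?R x) \<partial>gauss I) = enn2real (\<integral>\<^sup>+ x. ennreal (inverse (1 + ?R x)) \<partial>gauss I)"
    using inv1 by (intro integral_eq_nn_integral measi AE_I2)
  ultimately have Ri: "(\<integral>x. inverse (1 + ?R x) \<partial>gauss I) = 1 - p / (real n + 1)"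
    by (simp add: nn_integral_inverse_ols_norm2[OF assms(1-5) row] p_def)
  \<comment> \<open>The inequality of means for a deviation \<open>r\<close> with weight
    \<open>u\<close>: \<open>|r| <= \<delta> u + r^2 / (4 \<delta> u)\<close>.\<close>
  have pw: "\<bar>?R x - c\<bar> \<le> \<delta> * (1 + ?R x) + ((1 + ?R x) - 2 * (1 + c) + (1 + c)\<^sup>2 * inverse (1 + ?R x)) / (4 * \<delta>)" for x
  proof -
    define u where "u = 1 + ?R x"
    have u: "u > 0" using ols_norm2_nonneg[of n P j x] by (simp add: u_def)
    have "\<bar>r\<bar> * (4 * \<delta> * u) \<le> (2 * \<delta> * u)\<^sup>2 + r\<^sup>2" for r
      using zero_le_power2[of "2 * \<delta> * u - \<bar>r\<bar>"] by (simp add: power2_eq_square algebra_simps)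
    then have "\<bar>?R x - c\<bar> * (4 * \<delta> * u) \<le> (2 * \<delta> * u)\<^sup>2 + (?R x - c)\<^sup>2" .
    also have "\<dots> = (\<delta> * u + (u - 2 * (1 + c) + (1 + c)\<^sup>2 * inverse u) / (4 * \<delta>)) * (4 * \<delta> * u)"
    proof -
      have Rc: "?R x - c = u - (1 + c)" by (simp add: u_def)
      have "(?R x - c)\<^sup>2 = u * u - 2 * (1 + c) * u + (1 + c)\<^sup>2"
        unfolding Rc power2_diff by (simp add: power2_eq_square)
      also have "\<dots> = (u - 2 * (1 + c) + (1 + c)\<^sup>2 * inverse u) * u"
        using u by (simp add: left_diff_distrib distrib_right)
      finally have "(2 * \<delta> * u)\<^sup>2 + (?R x - c)\<^sup>2
          = \<delta> * u * (4 * \<delta> * u) + (u - 2 * (1 + c) + (1 + c)\<^sup>2 * inverse u) * u"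
        by (simp add: power2_eq_square)
      also have "(u - 2 * (1 + c) + (1 + c)\<^sup>2 * inverse u) * u
          = (u - 2 * (1 + c) + (1 + c)\<^sup>2 * inverse u) / (4 * \<delta>) * (4 * \<delta> * u)"
        using assms(7) by simp
      finally show ?thesis by (simp only: distrib_right)
    qed
    finally show ?thesis using assms(7) u unfolding u_def[symmetric] by simp
  qed
  have "(\<integral>x. \<bar>?R x - c\<bar> \<partial>gauss I)
    \<le> (\<integral>x. \<delta> * (1 + ?R x) + ((1 + ?R x) - 2 * (1 + c) + (1 + c)\<^sup>2 * inverse (1 + ?R x)) / (4 * \<delta>) \<partial>gauss I)"
    using intR inti pw by (intro integral_mono) auto
  also have "\<dots> = \<delta> * (1 + c) + ((1 + c) - 2 * (1 + c) + (1 + c)\<^sup>2 * (1 - p / (real n + 1))) / (4 * \<delta>)"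
    using intR inti prob_space by (simp add: R Ri)
  \<comment> \<open>Since \<open>1 + c = (n - 1) / (n - p - 1)\<close>, the product of the two
    expectations exceeds 1 by exactly \<open>2 p / ((n + 1) (n - p - 1))\<close>. This excess is the
    Jensen gap.\<close>
  also have "(1 + c) - 2 * (1 + c) + (1 + c)\<^sup>2 * (1 - p / (real n + 1)) = (1 + c) * (2 * p / ((real n + 1) * (real n - p - 1)))"
  proof -
    have "1 + c = (real n - 1) / (real n - p - 1)" using np by (simp add: c_def field_simps)
    then have "(1 + c) * (1 - p / (real n + 1)) - 1 = ((real n - 1) * (real n + 1 - p) - (real n + 1) * (real n - p - 1)) / ((real n + 1) * (real n - p - 1))"
      using np by (simp add: divide_simps) (simp add: algebra_simps)
    also have "(real n - 1) * (real n + 1 - p) - (real n + 1) * (real n - p - 1) = 2 * p"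
      by (simp add: algebra_simps)
    finally have e: "(1 + c) * (1 - p / (real n + 1)) - 1 = 2 * p / ((real n + 1) * (real n - p - 1))" .
    have "u - 2 * u + u\<^sup>2 * q = u * (u * q - 1)" for u q :: real
      by (simp add: power2_eq_square algebra_simps)
    then show ?thesis by (simp only: e)
  qed
  finally have bound: "(\<integral>x. \<bar>?R x - c\<bar> \<partial>gauss I)
      \<le> \<delta> * (1 + c) + (1 + c) * (2 * p / ((real n + 1) * (real n - p - 1))) / (4 * \<delta>)" .
  show "(\<integral>x. \<bar>?R x - c\<bar> \<partial>gauss I) \<le> (1 + c) * (\<delta> + p / (2 * \<delta> * (real n + 1) * (real n - p - 1)))"
  proof -
    have "\<delta> * (1 + c) + (1 + c) * (2 * p / (u * w)) / (4 * \<delta>) = (1 + c) * (\<delta> + p / (2 * \<delta> * u * w))" for u w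
    proof -
      have "2 * (p / (u * w) / (4 * \<delta>)) = p / (2 * \<delta> * u * w)" by simp
      moreover have "\<delta> * (1 + c) + (1 + c) * y = (1 + c) * (\<delta> + y)" for y
        by (simp add: algebra_simps)
      ultimately show ?thesis by (simp only: times_divide_eq_right[symmetric])
    qed
    with bound show ?thesis by (simp only:)
  qed
qed

notation vec_index (infixl "$v" 100)

subsection \<open>The law of the design\<close>

lemma PiM_distr_coordinatewise:
  assumes I: "finite I" and M: "\<And>i. prob_space (M i)" and f: "\<And>i. f i \<in> M i \<rightarrow>\<^sub>M M' i"
  shows "(\<Pi>\<^sub>M i\<in>I. distr (M i) (M' i) (f i)) = distr (PiM I M) (PiM I M') (\<lambda>\<omega>. \<lambda>i\<in>I. f i (\<omega> i))"
proof -
  interpret M: product_prob_space M I by (rule product_prob_spaceI) (rule M)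
  interpret D: product_prob_space "\<lambda>i. distr (M i) (M' i) (f i)" I
    by (rule product_prob_spaceI) (intro prob_space.prob_space_distr M f)
  have meas: "(\<lambda>\<omega>. \<lambda>i\<in>I. f i (\<omega> i)) \<in> PiM I M \<rightarrow>\<^sub>M PiM I M'"
    by (intro measurable_restrict) (rule measurable_compose[OF measurable_component_singleton[where M=M] f], assumption)
  show ?thesis
  proof (rule D.PiM_eqI[symmetric, OF I])
    show "sets (distr (PiM I M) (PiM I M') (\<lambda>\<omega>. \<lambda>i\<in>I. f i (\<omega> i))) = sets (\<Pi>\<^sub>M i\<in>I. distr (M i) (M' i) (f i))"
      by (simp cong: sets_PiM_cong)
    fix A assume A: "\<And>i. i \<in> I \<Longrightarrow> A i \<in> sets (distr (M i) (M' i) (f i))"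
    then have AE: "Pi\<^sub>E I A \<in> sets (PiM I M')" using I by (intro sets_PiM_I_finite) auto
    have "(\<lambda>\<omega>. \<lambda>i\<in>I. f i (\<omega> i)) -` Pi\<^sub>E I A \<inter> space (PiM I M) = (\<Pi>\<^sub>E i\<in>I. f i -` A i \<inter> space (M i))"
      by (auto simp: space_PiM PiE_iff)
    then have "emeasure (distr (PiM I M) (PiM I M') (\<lambda>\<omega>. \<lambda>i\<in>I. f i (\<omega> i))) (Pi\<^sub>E I A)
        = emeasure (PiM I M) (\<Pi>\<^sub>E i\<in>I. f i -` A i \<inter> space (M i))"
      by (simp add: emeasure_distr[OF meas AE])
    also have "\<dots> = (\<Prod>i\<in>I. emeasure (M i) (f i -` A i \<inter> space (M i)))"
      using A by (intro M.emeasure_PiM I measurable_sets[OF f]) auto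
    also have "\<dots> = (\<Prod>i\<in>I. emeasure (distr (M i) (M' i) (f i)) (A i))"
      using A by (intro prod.cong refl emeasure_distr[symmetric] f) auto
    finally show "emeasure (distr (PiM I M) (PiM I M') (\<lambda>\<omega>. \<lambda>i\<in>I. f i (\<omega> i))) (Pi\<^sub>E I A)
        = (\<Prod>i\<in>I. emeasure (distr (M i) (M' i) (f i)) (A i))" .
  qed
qed

lemma sets_covariate_law: "sets (covariate_law N lam) = sets (\<Pi>\<^sub>M j\<in>{..<N}. borel)"
  unfolding covariate_law_def by (intro sets_PiM_cong) (auto simp: centered_normal_def)

lemma covariate_law_eq_distr:
  "covariate_law N lam
    = distr (gauss {..<N}) (\<Pi>\<^sub>M j\<in>{..<N}. borel) (\<lambda>z. \<lambda>j\<in>{..<N}. sqrt (lam (Suc j)) * z j)"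
  unfolding covariate_law_def centered_normal_def gauss_def
  by (intro PiM_distr_coordinatewise prob_space_std_normal) auto

lemma prob_space_covariate_law: "prob_space (covariate_law N lam)"
  unfolding covariate_law_def centered_normal_def
  by (intro prob_space_PiM prob_space.prob_space_distr prob_space_std_normal) auto

text \<open>The bridge between two encodings: the Gaussian computations index entries by pairs,
  while the design law is a product over rows of products over coordinates. Restriction makes the
  result extensional, as the product spaces require.\<close>

definition scaled_design :: "nat \<Rightarrow> nat \<Rightarrow> (nat \<Rightarrow> real) \<Rightarrow> (nat \<times> nat \<Rightarrow> real) \<Rightarrow> nat \<Rightarrow> nat \<Rightarrow> real" where
  "scaled_design n N lam \<omega> = (\<lambda>i\<in>{..<n}. \<lambda>j\<in>{..<N}. sqrt (lam (Suc j)) * \<omega> (i, j))"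

lemma measurable_scaled_design:
  "scaled_design n N lam \<in> gauss ({..<n} \<times> {..<N}) \<rightarrow>\<^sub>M (\<Pi>\<^sub>M i\<in>{..<n}. \<Pi>\<^sub>M j\<in>{..<N}. borel)"
  unfolding scaled_design_def[abs_def]
  by (intro measurable_restrict borel_measurable_times borel_measurable_const measurable_gauss_component) auto

lemma indep_vars_gauss:
  assumes "I \<noteq> {}"
  shows "prob_space.indep_vars (gauss I) (\<lambda>_. borel) (\<lambda>a \<omega>. \<omega> a) I"
proof -
  interpret prob_space "gauss I" by (rule prob_space_gauss)
  have comp: "distr (gauss I) borel (\<lambda>\<omega>. \<omega> a) = std_normal_distribution" if "a \<in> I" for a
    using distr_PiM_component[of I "\<lambda>_. std_normal_distribution" a] prob_space_std_normal that
    unfolding gauss_def by (metis (no_types, lifting) distr_cong sets_density sets_lborel)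
  have "distr (gauss I) (\<Pi>\<^sub>M a\<in>I. borel) (\<lambda>\<omega>. \<lambda>a\<in>I. \<omega> a) = distr (gauss I) (gauss I) (\<lambda>\<omega>. \<omega>)"
    by (intro distr_cong) (auto simp: sets_gauss space_gauss fun_eq_iff PiE_def extensional_def)
  also have "\<dots> = gauss I" by (rule distr_id)
  also have "\<dots> = (\<Pi>\<^sub>M a\<in>I. distr (gauss I) borel (\<lambda>\<omega>. \<omega> a))"
  proof -
    have "(\<Pi>\<^sub>M a\<in>I. distr (gauss I) borel (\<lambda>\<omega>. \<omega> a)) = (\<Pi>\<^sub>M a\<in>I. std_normal_distribution)"
      by (intro PiM_cong refl comp)
    then show ?thesis unfolding gauss_def by (rule sym)
  qed
  finally show ?thesis
    by (subst indep_vars_iff_distr_eq_PiM'[OF assms]) (simp_all add: measurable_gauss_component)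
qed

text \<open>Rows are functions of disjoint blocks of independent coordinates. They are therefore
  independent, and their joint law is the product of the row laws.\<close>

lemma design_law_eq_distr:
  assumes "n > 0" "N > 0"
  shows "design_law n N lam = distr (gauss ({..<n} \<times> {..<N}))
    (\<Pi>\<^sub>M i\<in>{..<n}. \<Pi>\<^sub>M j\<in>{..<N}. borel) (scaled_design n N lam)"
proof -
  let ?I = "{..<n} \<times> {..<N}"
  interpret prob_space "gauss ?I" by (rule prob_space_gauss)
  define Y where "Y i r = (\<lambda>j\<in>{..<N}. sqrt (lam (Suc j)) * r (i, j))" for i :: nat and r :: "nat \<times> nat \<Rightarrow> real"
  have Ymeas: "Y i \<in> (\<Pi>\<^sub>M a\<in>{i} \<times> {..<N}. borel) \<rightarrow>\<^sub>M (\<Pi>\<^sub>M j\<in>{..<N}. borel)" for i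
    unfolding Y_def
    by (intro measurable_restrict borel_measurable_times borel_measurable_const measurable_component_singleton) auto
  have "indep_vars (\<lambda>i. \<Pi>\<^sub>M a\<in>{i} \<times> {..<N}. borel) (\<lambda>i \<omega>. restrict (\<lambda>a. \<omega> a) ({i} \<times> {..<N})) {..<n}"
    using assms by (intro indep_vars_restrict[OF indep_vars_gauss]) (auto simp: disjoint_family_on_def)
  then have ind: "indep_vars (\<lambda>_. \<Pi>\<^sub>M j\<in>{..<N}. borel) (\<lambda>i \<omega>. Y i (restrict (\<lambda>a. \<omega> a) ({i} \<times> {..<N}))) {..<n}"
    by (rule indep_vars_compose2) (rule Ymeas)
  have Yr: "Y i (restrict (\<lambda>a. \<omega> a) ({i} \<times> {..<N})) = (\<lambda>j\<in>{..<N}. sqrt (lam (Suc j)) * \<omega> (i, j))" for i \<omega>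
    by (auto simp: Y_def fun_eq_iff)
  have rv: "(\<lambda>\<omega>. \<lambda>j\<in>{..<N}. sqrt (lam (Suc j)) * \<omega> (i, j)) \<in> gauss ?I \<rightarrow>\<^sub>M (\<Pi>\<^sub>M j\<in>{..<N}. borel)" if "i < n" for i
    using that
    by (intro measurable_restrict borel_measurable_times borel_measurable_const measurable_gauss_component) auto
  have row: "distr (gauss ?I) (\<Pi>\<^sub>M j\<in>{..<N}. borel) (\<lambda>\<omega>. \<lambda>j\<in>{..<N}. sqrt (lam (Suc j)) * \<omega> (i, j))
      = covariate_law N lam" if "i < n" for i
  proof -
    have "gauss {..<N} = distr (gauss ?I) (gauss {..<N}) (\<lambda>\<omega>. \<lambda>j\<in>{..<N}. \<omega> (i, j))"
      unfolding gauss_def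
      by (rule distr_PiM_reindex[symmetric]) (use that in \<open>auto simp: inj_on_def prob_space_std_normal\<close>)
    then have "covariate_law N lam = distr (distr (gauss ?I) (gauss {..<N}) (\<lambda>\<omega>. \<lambda>j\<in>{..<N}. \<omega> (i, j)))
        (\<Pi>\<^sub>M j\<in>{..<N}. borel) (\<lambda>z. \<lambda>j\<in>{..<N}. sqrt (lam (Suc j)) * z j)"
      using covariate_law_eq_distr[of N lam] by simp
    also have "\<dots> = distr (gauss ?I) (\<Pi>\<^sub>M j\<in>{..<N}. borel)
        ((\<lambda>z. \<lambda>j\<in>{..<N}. sqrt (lam (Suc j)) * z j) \<circ> (\<lambda>\<omega>. \<lambda>j\<in>{..<N}. \<omega> (i, j)))"
    proof (rule distr_distr)
      show "(\<lambda>z. \<lambda>j\<in>{..<N}. sqrt (lam (Suc j)) * z j) \<in> gauss {..<N} \<rightarrow>\<^sub>M (\<Pi>\<^sub>M j\<in>{..<N}. borel)"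
        by (intro measurable_restrict borel_measurable_times borel_measurable_const measurable_gauss_component)
      have "(\<lambda>\<omega>. \<lambda>j\<in>{..<N}. \<omega> (i, j)) \<in> gauss ?I \<rightarrow>\<^sub>M (\<Pi>\<^sub>M j\<in>{..<N}. borel)"
        using that by (intro measurable_restrict measurable_gauss_component) auto
      then show "(\<lambda>\<omega>. \<lambda>j\<in>{..<N}. \<omega> (i, j)) \<in> gauss ?I \<rightarrow>\<^sub>M gauss {..<N}"
        by (simp only: measurable_cong_sets[OF refl sets_gauss])
    qed
    also have "\<dots> = distr (gauss ?I) (\<Pi>\<^sub>M j\<in>{..<N}. borel) (\<lambda>\<omega>. \<lambda>j\<in>{..<N}. sqrt (lam (Suc j)) * \<omega> (i, j))"
      by (intro distr_cong refl) (auto simp: fun_eq_iff)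
    finally show ?thesis by simp
  qed
  have "distr (gauss ?I) (\<Pi>\<^sub>M i\<in>{..<n}. \<Pi>\<^sub>M j\<in>{..<N}. borel) (\<lambda>\<omega>. \<lambda>i\<in>{..<n}. \<lambda>j\<in>{..<N}. sqrt (lam (Suc j)) * \<omega> (i, j))
      = (\<Pi>\<^sub>M i\<in>{..<n}. distr (gauss ?I) (\<Pi>\<^sub>M j\<in>{..<N}. borel) (\<lambda>\<omega>. \<lambda>j\<in>{..<N}. sqrt (lam (Suc j)) * \<omega> (i, j)))"
  proof -
    have "indep_vars (\<lambda>_. \<Pi>\<^sub>M j\<in>{..<N}. borel) (\<lambda>i \<omega>. \<lambda>j\<in>{..<N}. sqrt (lam (Suc j)) * \<omega> (i, j)) {..<n} \<longleftrightarrow> ?thesis"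
    proof (rule indep_vars_iff_distr_eq_PiM')
      show "{..<n} \<noteq> {}" using assms(1) by (simp add: lessThan_empty_iff)
    qed (rule rv, simp)
    then show ?thesis using ind unfolding Yr by blast
  qed
  also have "\<dots> = design_law n N lam"
    unfolding design_law_def by (intro PiM_cong refl) (simp add: row)
  finally show ?thesis by (simp add: scaled_design_def[abs_def])
qed

subsection \<open>The mean error as a function of the design\<close>

lemma centered_normal_0: "centered_normal 0 = return borel 0"
proof -
  have "centered_normal 0 = distr std_normal_distribution borel (\<lambda>_. 0)"
    by (simp add: centered_normal_def)
  also have "\<dots> = return borel 0"
    by (rule prob_space.distr_const[OF prob_space_std_normal]) simp
  finally show ?thesis .
qed

lemma nn_integral_covariate_law_square:
  assumes "\<forall>j<N. lam (Suc j) \<ge> 0"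
  shows "(\<integral>\<^sup>+ x. ennreal ((\<Sum>j<N. x j * d j)\<^sup>2) \<partial>covariate_law N lam) = ennreal (\<Sum>j<N. lam (Suc j) * (d j)\<^sup>2)"
proof -
  have "(\<integral>\<^sup>+ x. ennreal ((\<Sum>j<N. x j * d j)\<^sup>2) \<partial>covariate_law N lam)
      = (\<integral>\<^sup>+ z. ennreal ((\<Sum>j<N. (\<lambda>j\<in>{..<N}. sqrt (lam (Suc j)) * z j) j * d j)\<^sup>2) \<partial>gauss {..<N})"
    unfolding covariate_law_eq_distr
  proof (rule nn_integral_distr)
    show "(\<lambda>z. \<lambda>j\<in>{..<N}. sqrt (lam (Suc j)) * z j) \<in> gauss {..<N} \<rightarrow>\<^sub>M (\<Pi>\<^sub>M j\<in>{..<N}. borel)"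
      by (intro measurable_restrict borel_measurable_times borel_measurable_const measurable_gauss_component)
    have "(\<lambda>x. ennreal ((\<Sum>j<N. x j * d j)\<^sup>2)) \<in> borel_measurable (\<Pi>\<^sub>M j\<in>{..<N}. borel)"
      by (intro measurable_compose[OF _ measurable_ennreal] borel_measurable_power borel_measurable_sum
          borel_measurable_times borel_measurable_const measurable_component_singleton)
    then show "(\<lambda>x. ennreal ((\<Sum>j<N. x j * d j)\<^sup>2)) \<in> borel_measurable (distr (gauss {..<N})
        (\<Pi>\<^sub>M j\<in>{..<N}. borel) (\<lambda>z. \<lambda>j\<in>{..<N}. sqrt (lam (Suc j)) * z j))"
      by (simp only: measurable_distr_eq1)
  qed
  also have "\<dots> = (\<integral>\<^sup>+ z. ennreal ((0 + (\<Sum>j\<in>{..<N}. (sqrt (lam (Suc j)) * d j) * z j))\<^sup>2) \<partial>gauss {..<N})"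
  proof -
    have "(\<Sum>j<N. (\<lambda>j\<in>{..<N}. sqrt (lam (Suc j)) * z j) j * d j) = 0 + (\<Sum>j\<in>{..<N}. (sqrt (lam (Suc j)) * d j) * z j)" for z
      unfolding add_0 by (intro sum.cong refl) simp
    then show ?thesis by (simp only:)
  qed
  also have "\<dots> = ennreal (\<Sum>j<N. lam (Suc j) * (d j)\<^sup>2)"
    using assms by (subst nn_integral_gauss_affine_square) (simp_all add: power_mult_distrib cong: sum.cong_simp)
  finally show ?thesis .
qed

lemma pred_error_noiseless:
  assumes "\<sigma>\<^sup>2 = 0" "\<forall>j<N. lam (Suc j) \<ge> 0" "dim_vec u = N" "dim_vec v = N"
  shows "pred_error N lam \<sigma> u v = (\<Sum>j<N. lam (Suc j) * (u $v j - v $v j)\<^sup>2)"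
proof -
  let ?C = "covariate_law N lam"
  interpret C: prob_space ?C by (rule prob_space_covariate_law)
  interpret R: prob_space "return borel (0::real)" by (rule prob_space_return) simp
  define d where "d j = u $v j - v $v j" for j
  define f where "f = (\<lambda>(x :: nat \<Rightarrow> real, w :: real). ((\<Sum>j<N. x j * d j) + w)\<^sup>2)"
  have sp: "scalar_prod (Matrix.vec N x) u + w - scalar_prod (Matrix.vec N x) v = (\<Sum>j<N. x j * d j) + w" for x w
    using assms(3,4) by (simp add: scalar_prod_def d_def atLeast0LessThan right_diff_distrib sum_subtractf)
  have comp: "(\<lambda>z. fst z j) \<in> borel_measurable (?C \<Otimes>\<^sub>M return borel 0)" if "j \<in> {..<N}" for j
    by (rule measurable_compose[OF measurable_fst])
       (subst measurable_cong_sets[OF sets_covariate_law refl], rule measurable_component_singleton[OF that])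
  have snd: "snd \<in> borel_measurable (?C \<Otimes>\<^sub>M return borel (0::real))"
    using measurable_snd[of ?C "return borel (0::real)"] measurable_cong_sets[OF refl sets_return[of borel "0::real"]] by blast
  have meas: "f \<in> borel_measurable (?C \<Otimes>\<^sub>M return borel 0)"
    unfolding f_def case_prod_beta'
    by (intro borel_measurable_power borel_measurable_add borel_measurable_sum borel_measurable_times
        borel_measurable_const comp snd)
  have "pred_error N lam \<sigma> u v = (\<integral>z. f z \<partial>(?C \<Otimes>\<^sub>M return borel 0))"
    unfolding pred_error_def assms(1) centered_normal_0 sp f_def by (simp add: case_prod_beta')
  also have "\<dots> = enn2real (\<integral>\<^sup>+ z. ennreal (f z) \<partial>(?C \<Otimes>\<^sub>M return borel 0))"
    by (rule integral_eq_nn_integral[OF meas]) (auto simp: f_def)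
  also have "(\<integral>\<^sup>+ z. ennreal (f z) \<partial>(?C \<Otimes>\<^sub>M return borel 0))
      = (\<integral>\<^sup>+ x. \<integral>\<^sup>+ w. ennreal (f (x, w)) \<partial>return borel 0 \<partial>?C)"
    by (rule R.nn_integral_fst[symmetric]) (rule measurable_compose[OF meas measurable_ennreal])
  also have "\<dots> = (\<integral>\<^sup>+ x. ennreal ((\<Sum>j<N. x j * d j)\<^sup>2) \<partial>?C)"
    by (intro nn_integral_cong, subst nn_integral_return) (auto simp: f_def)
  also have "\<dots> = ennreal (\<Sum>j<N. lam (Suc j) * (d j)\<^sup>2)"
    by (rule nn_integral_covariate_law_square[OF assms(2)])
  finally have "pred_error N lam \<sigma> u v = enn2real (ennreal (\<Sum>j<N. lam (Suc j) * (d j)\<^sup>2))" .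
  moreover have "(\<Sum>j<N. lam (Suc j) * (d j)\<^sup>2) \<ge> 0"
    by (intro sum_nonneg mult_nonneg_nonneg) (use assms(2) in auto)
  ultimately show ?thesis by (simp add: d_def)
qed

lemma isotropic_nn_integral_square:
  assumes "isotropic_law N T"
  shows "(\<integral>\<^sup>+ \<theta>. ennreal ((\<Sum>l<N. c l * \<theta> l)\<^sup>2) \<partial>T) = ennreal (\<Sum>l<N. (c l)\<^sup>2)"
proof -
  have int: "integrable T (\<lambda>\<theta>. \<theta> i * \<theta> j)" "(\<integral>\<theta>. \<theta> i * \<theta> j \<partial>T) = of_bool (i = j)" if "i < N" "j < N" for i j
    using assms that by (auto simp: isotropic_law_def)
  have eq: "(\<Sum>l<N. c l * \<theta> l)\<^sup>2 = (\<Sum>i<N. \<Sum>j<N. c i * c j * (\<theta> i * \<theta> j))" for \<theta> :: "nat \<Rightarrow> real"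
    by (simp add: power2_eq_square sum_product mult_ac)
  have I: "integrable T (\<lambda>\<theta>. (\<Sum>l<N. c l * \<theta> l)\<^sup>2)"
    unfolding eq by (intro Bochner_Integration.integrable_sum integrable_mult_right int) auto
  have "(\<integral>\<theta>. (\<Sum>l<N. c l * \<theta> l)\<^sup>2 \<partial>T) = (\<Sum>i<N. \<Sum>j<N. c i * c j * of_bool (i = j))"
    unfolding eq by (subst Bochner_Integration.integral_sum; (intro Bochner_Integration.integrable_sum integrable_mult_right int)?; (simp add: int)?)
  also have "\<dots> = (\<Sum>l<N. (c l)\<^sup>2)"
    by (intro sum.cong refl, subst sum_of_bool_mult) (auto simp: power2_eq_square)
  finally show ?thesis
    using nn_integral_eq_integral[OF I] by simp
qed

lemma AE_noise_law_0:
  assumes "\<sigma>\<^sup>2 = 0"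
  shows "AE w in noise_law n \<sigma>. \<forall>i<n. w i = 0"
proof -
  have "AE w in noise_law n \<sigma>. w i = 0" if "i < n" for i
    unfolding noise_law_def assms centered_normal_0
    by (rule AE_PiM_component) (use that in \<open>auto intro: prob_space_return simp: AE_return\<close>)
  then have "AE w in noise_law n \<sigma>. \<forall>i\<in>{..<n}. w i = 0"
    by (intro AE_finite_allI) auto
  then show ?thesis by (simp only: lessThan_iff Ball_def)
qed

lemma sets_noise_law: "sets (noise_law n \<sigma>) = sets (\<Pi>\<^sub>M i\<in>{..<n}. borel)"
  unfolding noise_law_def by (intro sets_PiM_cong) (auto simp: centered_normal_def)

lemma prob_space_noise_law: "prob_space (noise_law n \<sigma>)"
  unfolding noise_law_def centered_normal_def
  by (intro prob_space_PiM prob_space.prob_space_distr prob_space_std_normal) auto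

text \<open>The least-squares matrix \<open>(X\<^sub>P\<^sup>T X\<^sub>P)\<^sup>-\<^sup>1 X\<^sub>P\<^sup>T\<close>, entrywise, with the junk value 0 for a singular Gram matrix.\<close>

definition ls_mat :: "nat \<Rightarrow> nat \<Rightarrow> (nat \<Rightarrow> nat \<Rightarrow> real) \<Rightarrow> nat \<Rightarrow> nat \<Rightarrow> real" where
  "ls_mat n p x k i = (let z = (\<lambda>(i, j). x i j) in
     if gram_regular n {..<p} z then \<Sum>m<p. gram_inv n {..<p} z k m * x i m else 0)"

text \<open>The two notions of singularity agree: an entrywise inverse makes the matrix a unit, so
  \<open>mat_inverse\<close> cannot fail, and a computed inverse is an entrywise one. Uniqueness
  then matches the entries.\<close>

lemma inv_mat_gram:
  fixes n p k l :: nat and x :: "nat \<Rightarrow> nat \<Rightarrow> real"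
  defines "z \<equiv> \<lambda>(i, j). x i j"
  defines "A \<equiv> Matrix.mat p p (\<lambda>(k, l). gram n z k l)"
  assumes "k < p" "l < p"
  shows "inv_mat A $$ (k, l) = (if gram_regular n {..<p} z then gram_inv n {..<p} z k l else 0)"
proof -
  have A: "A \<in> carrier_mat p p" by (simp add: A_def)
  show ?thesis
  proof (cases "mat_inverse A")
    case None
    have "\<not> gram_regular n {..<p} z"
    proof
      assume "gram_regular n {..<p} z"
      then have inv: "inv_on {..<p} (gram n z) (gram_inv n {..<p} z)" by (simp add: gram_regular_def)
      define B where "B = Matrix.mat p p (\<lambda>(k, l). gram_inv n {..<p} z k l)"
      have B: "B \<in> carrier_mat p p" by (simp add: B_def)
      have "A * B = 1\<^sub>m p"
        using inv by (intro eq_matI) (auto simp: A_def B_def scalar_prod_def atLeast0LessThan inv_on_def)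
      moreover have "B * A = 1\<^sub>m p"
        using inv_on_left[OF finite_lessThan sym_on_gram inv]
        by (intro eq_matI) (auto simp: A_def B_def scalar_prod_def atLeast0LessThan)
      ultimately have "A \<in> Units (ring_mat TYPE(real) p ())"
        using A B by (auto simp: Units_def ring_mat_def)
      then show False using mat_inverse(1)[OF A None, of "()"] by blast
    qed
    then show ?thesis using assms(3,4) None by (simp add: inv_mat_def A_def)
  next
    case (Some B)
    from mat_inverse(2)[OF A Some] have B: "A * B = 1\<^sub>m p" "B \<in> carrier_mat p p" by auto
    have "inv_on {..<p} (gram n z) (\<lambda>k l. B $$ (k, l))"
      unfolding inv_on_def
    proof (intro ballI)
      fix k l assume kl: "k \<in> {..<p}" "l \<in> {..<p}"
      have "(A * B) $$ (k, l) = (\<Sum>m<p. gram n z k m * B $$ (m, l))"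
        using kl B(2) by (auto simp: A_def scalar_prod_def atLeast0LessThan)
      then show "(\<Sum>m\<in>{..<p}. gram n z k m * B $$ (m, l)) = of_bool (k = l)"
        using kl unfolding B(1) by (simp only: index_one_mat lessThan_iff of_bool_def)
    qed
    then have "inv_on {..<p} (gram n z) (gram_inv n {..<p} z)"
        "gram_inv n {..<p} z k l = B $$ (k, l)"
      using assms(3,4) by (auto intro!: inv_on_gram_inv inv_on_unique'[OF finite_lessThan sym_on_gram])
    then show ?thesis using Some by (simp add: inv_mat_def gram_regular_def)
  qed
qed

lemma estimator_entry:
  fixes n p N :: nat and x :: "nat \<Rightarrow> nat \<Rightarrow> real"
  assumes "p \<le> n" "p \<le> N" "dim_vec y = n"
  defines "X \<equiv> Matrix.mat n N (\<lambda>(i, j). x i j)"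
  shows "dim_vec (estimator p X y) = N"
    and "j < N \<Longrightarrow> estimator p X y $v j = (if j < p then \<Sum>i<n. ls_mat n p x j i * y $v i else 0)"
proof -
  define Xp where "Xp = Matrix.mat n p (\<lambda>(i, j). x i j)"
  have Xp: "first_cols p X = Xp"
    using assms(2) by (intro eq_matI) (auto simp: first_cols_def X_def Xp_def)
  define A where "A = Matrix.mat p p (\<lambda>(k, l). gram n (\<lambda>(i, j). x i j) k l)"
  have A: "transpose_mat Xp * Xp = A"
    by (intro eq_matI) (auto simp: Xp_def A_def scalar_prod_def gram_def atLeast0LessThan)
  \<comment> \<open>The dimensions are right in the singular case as well, where the junk value is
    the zero matrix of the same format.\<close>
  have dimA: "dim_row (inv_mat A) = p" "dim_col (inv_mat A) = p"
  proof -
    have "A \<in> carrier_mat p p" by (simp add: A_def)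
    then have "inv_mat A \<in> carrier_mat p p"
      using mat_inverse(2)[of A p] by (auto simp: inv_mat_def split: option.split)
    then show "dim_row (inv_mat A) = p" "dim_col (inv_mat A) = p" by auto
  qed
  have est: "estimator p X y = ((inv_mat A * transpose_mat Xp) *\<^sub>v y) @\<^sub>v 0\<^sub>v (N - p)"
    using assms(1) by (simp add: estimator_def Let_def Xp A X_def[symmetric]) (simp add: X_def)
  show "dim_vec (estimator p X y) = N"
    using assms(2) by (simp add: est dimA)
  assume j: "j < N"
  have entry: "(inv_mat A * transpose_mat Xp) $$ (k, i) = ls_mat n p x k i" if "k < p" "i < n" for k i
  proof -
    have "(inv_mat A * transpose_mat Xp) $$ (k, i) = (\<Sum>m<p. inv_mat A $$ (k, m) * x i m)"
      using that dimA by (simp add: scalar_prod_def atLeast0LessThan Xp_def cong: sum.cong_simp)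
    also have "\<dots> = ls_mat n p x k i"
      using that inv_mat_gram[where k=k and p=p and n=n and x=x] by (simp add: ls_mat_def Let_def A_def cong: sum.cong_simp)
    finally show ?thesis .
  qed
  show "estimator p X y $v j = (if j < p then \<Sum>i<n. ls_mat n p x j i * y $v i else 0)"
  proof (cases "j < p")
    case True
    have "((inv_mat A * transpose_mat Xp) *\<^sub>v y) $v j = (\<Sum>i<n. (inv_mat A * transpose_mat Xp) $$ (j, i) * y $v i)"
      using True dimA assms(3)
      by (simp add: scalar_prod_def atLeast0LessThan Xp_def del: index_mult_mat(1))
    then show ?thesis
      using True dimA by (simp add: est entry cong: sum.cong_simp)
  next
    case False
    then show ?thesis using j dimA by (simp add: est)
  qed
qed

text \<open>The matrix that maps the true coefficients to their estimation error when the training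
  noise vanishes. Rows from \<open>p\<close> on are rows of the identity, since those coordinates
  are estimated by 0.\<close>

definition error_coef :: "nat \<Rightarrow> nat \<Rightarrow> (nat \<Rightarrow> nat \<Rightarrow> real) \<Rightarrow> nat \<Rightarrow> nat \<Rightarrow> real" where
  "error_coef n p x k l = of_bool (k = l) - (if k < p then \<Sum>i<n. ls_mat n p x k i * x i l else 0)"

text \<open>The estimation error is linear in the coefficients, so isotropy reduces each second
  moment to the squared norm of a row. The formula covers singular designs too, as the pointwise
  lower bound and the measurability of the error require.\<close>

lemma mean_error_eq:
  fixes x :: "nat \<Rightarrow> nat \<Rightarrow> real"
  assumes "\<sigma>\<^sup>2 = 0" "p \<le> n" "p \<le> N" "\<forall>j<N. lam (Suc j) \<ge> 0" "isotropic_law N T"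
  shows "mean_error n p N lam \<sigma> T x = (\<Sum>k<N. lam (Suc k) * (\<Sum>l<N. (error_coef n p x k l)\<^sup>2))"
proof -
  let ?W = "noise_law n \<sigma>"
  interpret W: prob_space ?W by (rule prob_space_noise_law)
  interpret T: prob_space T using assms(5) by (simp add: isotropic_law_def)
  have sT: "sets T = sets (\<Pi>\<^sub>M j\<in>{..<N}. borel)" using assms(5) by (simp add: isotropic_law_def)
  define X where "X = Matrix.mat n N (\<lambda>(i, j). x i j)"
  define e where "e k \<theta> = (\<Sum>l<N. error_coef n p x k l * \<theta> l)" for k and \<theta> :: "nat \<Rightarrow> real"
  \<comment> \<open>The training noise stays in the integrand, since the noise law makes it vanish
    only almost everywhere; it is dropped inside the inner integral.\<close>
  define g where "g = (\<lambda>(\<theta> :: nat \<Rightarrow> real, w :: nat \<Rightarrow> real). \<Sum>k<N. lam (Suc k) *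
     (e k \<theta> - (if k < p then \<Sum>i<n. ls_mat n p x k i * w i else 0))\<^sup>2)"
  have pe: "pred_error N lam \<sigma> (Matrix.vec N \<theta>) (estimator p X (response n X (Matrix.vec N \<theta>) w)) = g (\<theta>, w)" for \<theta> w
  proof -
    let ?y = "response n X (Matrix.vec N \<theta>) w"
    have dy: "dim_vec ?y = n" by (simp add: response_def)
    have y: "?y $v i = (\<Sum>l<N. x i l * \<theta> l) + w i" if "i < n" for i
      using that by (simp add: response_def X_def scalar_prod_def atLeast0LessThan)
    note est = estimator_entry[OF assms(2,3) dy, where x=x, folded X_def]
    have "Matrix.vec N \<theta> $v k - estimator p X ?y $v k
        = e k \<theta> - (if k < p then \<Sum>i<n. ls_mat n p x k i * w i else 0)"
      if k: "k < N" for k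
    proof -
      have 1: "(\<Sum>l<N. of_bool (k = l) * \<theta> l) = \<theta> k" using k by (intro sum_of_bool_mult) auto
      have 2: "(\<Sum>l<N. (\<Sum>i<n. ls_mat n p x k i * x i l) * \<theta> l) = (\<Sum>i<n. ls_mat n p x k i * (\<Sum>l<N. x i l * \<theta> l))"
        unfolding sum_distrib_left sum_distrib_right by (subst sum.swap) (simp add: mult.assoc)
      have "(\<Sum>i<n. ls_mat n p x k i * ?y $v i)
          = (\<Sum>i<n. ls_mat n p x k i * (\<Sum>l<N. x i l * \<theta> l)) + (\<Sum>i<n. ls_mat n p x k i * w i)"
        by (simp add: y distrib_left sum.distrib cong: sum.cong_simp)
      then show ?thesis
        using k by (simp add: est e_def error_coef_def left_diff_distrib sum_subtractf 1 2)
    qed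
    then show ?thesis
      by (subst pred_error_noiseless[OF assms(1,4)]) (simp_all add: est(1) g_def)
  qed
  have compT: "(\<lambda>z. fst z l) \<in> borel_measurable (T \<Otimes>\<^sub>M ?W)" if "l \<in> {..<N}" for l
    by (rule measurable_compose[OF measurable_fst])
       (subst measurable_cong_sets[OF sT refl], rule measurable_component_singleton[OF that])
  have compW: "(\<lambda>z. snd z i) \<in> borel_measurable (T \<Otimes>\<^sub>M ?W)" if "i \<in> {..<n}" for i
    by (rule measurable_compose[OF measurable_snd])
       (subst measurable_cong_sets[OF sets_noise_law refl], rule measurable_component_singleton[OF that])
  have ifm: "(\<lambda>z. if k < p then \<Sum>i<n. ls_mat n p x k i * snd z i else 0) \<in> borel_measurable (T \<Otimes>\<^sub>M ?W)" for k
  proof (cases "k < p")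
    case True
    have "(\<lambda>z. \<Sum>i<n. ls_mat n p x k i * snd z i) \<in> borel_measurable (T \<Otimes>\<^sub>M ?W)"
      by (intro borel_measurable_sum borel_measurable_times borel_measurable_const compW)
    with True show ?thesis by (simp only: if_True)
  next
    case False
    then show ?thesis by (simp only: if_False borel_measurable_const)
  qed
  have meas: "g \<in> borel_measurable (T \<Otimes>\<^sub>M ?W)"
    unfolding g_def case_prod_beta' e_def
    by (intro borel_measurable_sum borel_measurable_times borel_measurable_const borel_measurable_power
        borel_measurable_diff compT ifm)
  have g0: "g z \<ge> 0" for z
    using assms(4) by (auto simp: g_def split: prod.split intro!: sum_nonneg mult_nonneg_nonneg)
  have "mean_error n p N lam \<sigma> T x = (\<integral>z. g z \<partial>(T \<Otimes>\<^sub>M ?W))"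
    unfolding mean_error_def Let_def X_def[symmetric] pe by simp
  also have "\<dots> = enn2real (\<integral>\<^sup>+ z. ennreal (g z) \<partial>(T \<Otimes>\<^sub>M ?W))"
    by (rule integral_eq_nn_integral[OF meas AE_I2[OF g0]])
  also have "(\<integral>\<^sup>+ z. ennreal (g z) \<partial>(T \<Otimes>\<^sub>M ?W)) = (\<integral>\<^sup>+ \<theta>. \<integral>\<^sup>+ w. ennreal (g (\<theta>, w)) \<partial>?W \<partial>T)"
    by (rule W.nn_integral_fst[symmetric]) (rule measurable_compose[OF meas measurable_ennreal])
  also have "\<dots> = (\<integral>\<^sup>+ \<theta>. (\<Sum>k<N. ennreal (lam (Suc k)) * ennreal ((e k \<theta>)\<^sup>2)) \<partial>T)"
  proof (intro nn_integral_cong)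
    fix \<theta>
    have "(\<integral>\<^sup>+ w. ennreal (g (\<theta>, w)) \<partial>?W)
       = (\<integral>\<^sup>+ w. (\<Sum>k<N. ennreal (lam (Suc k)) * ennreal ((e k \<theta>)\<^sup>2)) \<partial>?W)"
    proof (rule nn_integral_cong_AE, rule AE_mp[OF AE_noise_law_0[OF assms(1)]], rule AE_I2, rule impI)
      fix w :: "nat \<Rightarrow> real" assume w: "\<forall>i<n. w i = 0"
      have gw: "g (\<theta>, w) = (\<Sum>k<N. lam (Suc k) * (e k \<theta>)\<^sup>2)"
      proof -
        have "(if k < p then \<Sum>i<n. ls_mat n p x k i * w i else 0) = 0" for k
          using w by (auto intro!: sum.neutral)
        then show ?thesis by (simp add: g_def)
      qed
      have "ennreal (g (\<theta>, w)) = (\<Sum>k<N. ennreal (lam (Suc k) * (e k \<theta>)\<^sup>2))"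
        unfolding gw using assms(4) by (intro sum_ennreal[symmetric]) auto
      then show "ennreal (g (\<theta>, w)) = (\<Sum>k<N. ennreal (lam (Suc k)) * ennreal ((e k \<theta>)\<^sup>2))"
        using assms(4) by (simp add: ennreal_mult)
    qed
    then show "(\<integral>\<^sup>+ w. ennreal (g (\<theta>, w)) \<partial>?W)
       = (\<Sum>k<N. ennreal (lam (Suc k)) * ennreal ((e k \<theta>)\<^sup>2))"
      by (simp add: W.emeasure_space_1)
  qed
  also have "\<dots> = (\<Sum>k<N. ennreal (lam (Suc k)) * (\<integral>\<^sup>+ \<theta>. ennreal ((e k \<theta>)\<^sup>2) \<partial>T))"
  proof -
    have m: "(\<lambda>\<theta>. ennreal ((e k \<theta>)\<^sup>2)) \<in> borel_measurable T" for k
      unfolding measurable_cong_sets[OF sT refl] e_def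
      by (intro measurable_compose[OF _ measurable_ennreal] borel_measurable_power borel_measurable_sum
          borel_measurable_times borel_measurable_const measurable_component_singleton)
    have "(\<integral>\<^sup>+ \<theta>. (\<Sum>k<N. ennreal (lam (Suc k)) * ennreal ((e k \<theta>)\<^sup>2)) \<partial>T)
        = (\<Sum>k<N. \<integral>\<^sup>+ \<theta>. ennreal (lam (Suc k)) * ennreal ((e k \<theta>)\<^sup>2) \<partial>T)"
      by (intro nn_integral_sum borel_measurable_times_ennreal borel_measurable_const m)
    then show ?thesis by (simp only: nn_integral_cmult[OF m])
  qed
  also have "\<dots> = (\<Sum>k<N. ennreal (lam (Suc k) * (\<Sum>l<N. (error_coef n p x k l)\<^sup>2)))"
    using assms(4) unfolding e_def by (intro sum.cong refl) (simp add: isotropic_nn_integral_square[OF assms(5)] ennreal_mult sum_nonneg)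
  also have "\<dots> = ennreal (\<Sum>k<N. lam (Suc k) * (\<Sum>l<N. (error_coef n p x k l)\<^sup>2))"
    using assms(4) by (intro sum_ennreal) (auto intro!: mult_nonneg_nonneg sum_nonneg)
  finally have "mean_error n p N lam \<sigma> T x
      = enn2real (ennreal (\<Sum>k<N. lam (Suc k) * (\<Sum>l<N. (error_coef n p x k l)\<^sup>2)))" .
  moreover have "(\<Sum>k<N. lam (Suc k) * (\<Sum>l<N. (error_coef n p x k l)\<^sup>2)) \<ge> 0"
    by (intro sum_nonneg mult_nonneg_nonneg) (use assms(4) in auto)
  ultimately show ?thesis by simp
qed

text \<open>Each omitted coordinate contributes at least its own variance, whatever the design. This
  bound drives the case of an infinite limit.\<close>

lemma mean_error_ge_tail:
  fixes x :: "nat \<Rightarrow> nat \<Rightarrow> real"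
  assumes "\<sigma>\<^sup>2 = 0" "p \<le> n" "p \<le> N" "\<forall>j<N. lam (Suc j) \<ge> 0" "isotropic_law N T"
  shows "mean_error n p N lam \<sigma> T x \<ge> (\<Sum>k\<in>{p..<N}. lam (Suc k))"
proof -
  have "(\<Sum>k\<in>{p..<N}. lam (Suc k)) \<le> (\<Sum>k\<in>{p..<N}. lam (Suc k) * (\<Sum>l<N. (error_coef n p x k l)\<^sup>2))"
  proof (rule sum_mono)
    fix k assume k: "k \<in> {p..<N}"
    have "(1::real) = (error_coef n p x k k)\<^sup>2" using k by (simp add: error_coef_def)
    also have "\<dots> \<le> (\<Sum>l<N. (error_coef n p x k l)\<^sup>2)"
      using k by (intro member_le_sum) auto
    finally have "lam (Suc k) * 1 \<le> lam (Suc k) * (\<Sum>l<N. (error_coef n p x k l)\<^sup>2)"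
      using k assms(4) by (intro mult_left_mono) auto
    then show "lam (Suc k) \<le> lam (Suc k) * (\<Sum>l<N. (error_coef n p x k l)\<^sup>2)" by simp
  qed
  also have "\<dots> \<le> (\<Sum>k<N. lam (Suc k) * (\<Sum>l<N. (error_coef n p x k l)\<^sup>2))"
    using assms(4) by (intro sum_mono2) (auto intro!: mult_nonneg_nonneg sum_nonneg)
  finally show ?thesis by (simp only: mean_error_eq[OF assms])
qed

lemma measurable_mean_error:
  assumes "\<sigma>\<^sup>2 = 0" "p \<le> n" "p \<le> N" "\<forall>j<N. lam (Suc j) \<ge> 0" "isotropic_law N T"
  shows "mean_error n p N lam \<sigma> T \<in> borel_measurable (\<Pi>\<^sub>M i\<in>{..<n}. \<Pi>\<^sub>M j\<in>{..<N}. borel)"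
proof -
  let ?M = "\<Pi>\<^sub>M i\<in>{..<n}. \<Pi>\<^sub>M j\<in>{..<N}. (borel :: real measure)"
  let ?I = "{..<n} \<times> {..<N}"
  have comp: "(\<lambda>x. x i j) \<in> borel_measurable ?M" if "i < n" "j < N" for i j
    by (rule measurable_compose[OF measurable_component_singleton[of i "{..<n}" "\<lambda>_. \<Pi>\<^sub>M j\<in>{..<N}. (borel :: real measure)"]
        measurable_component_singleton[of j "{..<N}" "\<lambda>_. borel :: real measure"]]) (use that in simp_all)
  \<comment> \<open>Transfers the nested design to the index set of pairs, where measurability of
    the chosen inverse is available.\<close>
  define Z where "Z x = (\<lambda>a\<in>?I. x (fst a) (snd a) :: real)" for x
  have "Z \<in> ?M \<rightarrow>\<^sub>M (\<Pi>\<^sub>M a\<in>?I. borel)"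
    unfolding Z_def by (intro measurable_restrict) (auto intro!: comp)
  then have Zm: "Z \<in> ?M \<rightarrow>\<^sub>M gauss ?I" by (simp only: measurable_cong_sets[OF refl sets_gauss])
  have sub: "{..<n} \<times> {..<p} \<subseteq> ?I" using assms(3) by auto
  have Z: "gram_inv n {..<p} (\<lambda>(i, j). x i j) = gram_inv n {..<p} (Z x)" for x
    using assms(3) by (intro gram_inv_cong) (auto simp: Z_def)
  have gr: "gram_regular n {..<p} (\<lambda>(i, j). x i j) = gram_regular n {..<p} (Z x)" for x
  proof -
    have "gram n (\<lambda>(i, j). x i j) k l = gram n (Z x) k l" if "k < p" "l < p" for k l
      using assms(3) that by (intro gram_cong) (auto simp: Z_def)
    then show ?thesis unfolding gram_regular_def inv_on_def Z by simp
  qed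
  have ls: "(\<lambda>x. ls_mat n p x k i) \<in> borel_measurable ?M" if "i < n" for k i
  proof -
    have "(\<lambda>x. if gram_regular n {..<p} (Z x) then \<Sum>m<p. gram_inv n {..<p} (Z x) k m * x i m else 0) \<in> borel_measurable ?M"
    proof (intro measurable_If borel_measurable_sum borel_measurable_times borel_measurable_const)
      show "(\<lambda>x. gram_inv n {..<p} (Z x) k m) \<in> borel_measurable ?M" for m
        by (rule measurable_compose[OF Zm measurable_gram_inv[OF finite_lessThan sub]])
      show "(\<lambda>x. x i m) \<in> borel_measurable ?M" if "m \<in> {..<p}" for m
        using that \<open>i < n\<close> assms(3) by (intro comp) auto
      show "{x \<in> space ?M. gram_regular n {..<p} (Z x)} \<in> sets ?M"
        using measurable_compose[OF Zm measurable_gram_regular[OF finite_lessThan sub]] by (simp only: pred_def)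
    qed
    then show ?thesis by (simp only: ls_mat_def Let_def Z gr)
  qed
  have ec: "(\<lambda>x. error_coef n p x k l) \<in> borel_measurable ?M" if "l < N" for k l
  proof (cases "k < p")
    case True
    have "(\<lambda>x. of_bool (k = l) - (\<Sum>i<n. ls_mat n p x k i * x i l)) \<in> borel_measurable ?M"
      by (intro borel_measurable_diff borel_measurable_const borel_measurable_sum borel_measurable_times ls comp that) auto
    with True show ?thesis by (simp only: error_coef_def if_True)
  next
    case False
    then show ?thesis by (simp only: error_coef_def if_False borel_measurable_const)
  qed
  have "(\<lambda>x. \<Sum>k<N. lam (Suc k) * (\<Sum>l<N. (error_coef n p x k l)\<^sup>2)) \<in> borel_measurable ?M"
    by (intro borel_measurable_sum borel_measurable_times borel_measurable_const borel_measurable_power ec) simp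
  then show ?thesis by (simp only: mean_error_eq[OF assms, symmetric])
qed

text \<open>Scaling the columns by \<open>s\<close> divides the inverse Gram entries by
  \<open>s k * s l\<close> and multiplies the coefficients by \<open>s l / s k\<close>. The weight
  \<open>lam (Suc k)\<close> of a fitted coordinate then cancels against the squared denominator, so
  only the eigenvalues of omitted coordinates remain.\<close>

lemma mean_error_scaled_design:
  assumes "\<sigma>\<^sup>2 = 0" "p \<le> n" "p \<le> N" "isotropic_law N T" and lam: "\<forall>j<N. lam (Suc j) > 0"
    and reg: "gram_regular n {..<p} w"
  shows "mean_error n p N lam \<sigma> T (scaled_design n N lam w)
       = (\<Sum>l\<in>{p..<N}. lam (Suc l) * (1 + ols_norm2 n {..<p} l w))"
proof -
  define x where "x = scaled_design n N lam w"
  define z where "z = (\<lambda>(i, j). x i j)"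
  define s where "s j = sqrt (lam (Suc j))" for j
  have s: "s j > 0" "(s j)\<^sup>2 = lam (Suc j)" if "j < N" for j using lam that by (auto simp: s_def less_imp_le)
  have x: "x i j = s j * w (i, j)" if "i < n" "j < N" for i j
    using that by (simp add: x_def scaled_design_def s_def)
  have inv: "inv_on {..<p} (gram n w) (gram_inv n {..<p} w)" using reg by (simp add: gram_regular_def)
  define G where "G = gram_inv n {..<p} w"
  have gz: "gram n z k l = s k * s l * gram n w k l" if "k < N" "l < N" for k l
    using that by (simp add: gram_def z_def x sum_distrib_left mult_ac cong: sum.cong_simp)
  have inv': "inv_on {..<p} (gram n z) (\<lambda>k l. G k l / (s k * s l))"
    unfolding inv_on_def
  proof (intro ballI)
    fix k l assume kl: "k \<in> {..<p}" "l \<in> {..<p}"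
    have "(\<Sum>m\<in>{..<p}. gram n z k m * (G m l / (s m * s l))) = (\<Sum>m\<in>{..<p}. s k / s l * (gram n w k m * G m l))"
    proof (intro sum.cong refl)
      fix m assume "m \<in> {..<p}"
      then have "m < N" "k < N" "l < N" using kl assms(3) by auto
      then show "gram n z k m * (G m l / (s m * s l)) = s k / s l * (gram n w k m * G m l)"
        using s(1)[of m] by (simp add: gz)
    qed
    also have "\<dots> = s k / s l * of_bool (k = l)"
      using inv kl unfolding inv_on_def G_def sum_distrib_left[symmetric] by simp
    also have "\<dots> = of_bool (k = l)" using s(1)[of k] kl assms(3) by auto
    finally show "(\<Sum>m\<in>{..<p}. gram n z k m * (G m l / (s m * s l))) = of_bool (k = l)" .
  qed
  have regz: "inv_on {..<p} (gram n z) (gram_inv n {..<p} z)" by (rule inv_on_gram_inv[OF finite_lessThan inv'])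
  have Gz: "gram_inv n {..<p} z k m = G k m / (s k * s m)" if "k < p" "m < p" for k m
    using inv_on_unique'[OF finite_lessThan sym_on_gram inv' regz] that by simp
  have fit: "(\<Sum>i<n. ls_mat n p x k i * x i l) = s l / s k * ols_coef n {..<p} l w k" if k: "k < p" and l: "l < N" for k l
  proof -
    have "(\<Sum>i<n. ls_mat n p x k i * x i l) = (\<Sum>i<n. \<Sum>m<p. G k m / (s k * s m) * x i m * x i l)"
      using regz by (simp add: ls_mat_def Let_def z_def[symmetric] gram_regular_def Gz k sum_distrib_right cong: sum.cong_simp)
    also have "\<dots> = (\<Sum>m<p. G k m / (s k * s m) * (\<Sum>i<n. x i m * x i l))"
      by (subst sum.swap) (simp add: sum_distrib_left mult.assoc)
    also have "\<dots> = (\<Sum>m<p. s l / s k * (G k m * gram n w m l))"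
    proof (intro sum.cong refl)
      fix m assume "m \<in> {..<p}"
      then have m: "m < N" using assms(3) by simp
      have "(\<Sum>i<n. x i m * x i l) = gram n z m l" by (simp add: gram_def z_def)
      then show "G k m / (s k * s m) * (\<Sum>i<n. x i m * x i l) = s l / s k * (G k m * gram n w m l)"
        using s(1)[OF m] by (simp add: gz[OF m l])
    qed
    finally show ?thesis
      by (simp add: ols_coef_def schur_coef_def G_def sum_distrib_left)
  qed
  \<comment> \<open>On a regular design the fit reproduces the fitted columns exactly, so they cause
    no error.\<close>
  have low: "(\<Sum>i<n. ls_mat n p x k i * x i l) = of_bool (k = l)" if "k < p" "l < p" for k l
  proof -
    have "ols_coef n {..<p} l w k = of_bool (k = l)"
      unfolding ols_coef_def schur_coef_def
      using that by (intro inv_on_left[OF finite_lessThan sym_on_gram inv]) auto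
    then show ?thesis using fit[of k l] that assms(3) s(1)[of k] by auto
  qed
  have split: "{..<N} = {..<p} \<union> {p..<N}" "{..<p} \<inter> {p..<N} = {}" using assms(3) by auto
  have sumsplit: "(\<Sum>k<N. f k) = (\<Sum>k<p. f k) + (\<Sum>k\<in>{p..<N}. f k)" for f :: "nat \<Rightarrow> real"
    using split by (subst split(1), subst sum.union_disjoint) auto
  have row_low: "(\<Sum>l<N. (error_coef n p x k l)\<^sup>2) = (\<Sum>l\<in>{p..<N}. lam (Suc l) / lam (Suc k) * (ols_coef n {..<p} l w k)\<^sup>2)"
    if k: "k < p" for k
  proof -
    have "(\<Sum>l<p. (error_coef n p x k l)\<^sup>2) = 0"
      using k by (intro sum.neutral) (simp add: error_coef_def low)
    moreover have "(error_coef n p x k l)\<^sup>2 = lam (Suc l) / lam (Suc k) * (ols_coef n {..<p} l w k)\<^sup>2" if "l \<in> {p..<N}" for l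
      using that k assms(3) s(2)[of l] s(2)[of k]
      by (simp add: error_coef_def fit power_mult_distrib power_divide)
    ultimately show ?thesis unfolding sumsplit by simp
  qed
  have row_high: "(\<Sum>l<N. (error_coef n p x k l)\<^sup>2) = 1" if k: "k \<in> {p..<N}" for k
  proof -
    have "(\<Sum>l<N. (error_coef n p x k l)\<^sup>2) = (\<Sum>l<N. of_bool (k = l) * 1)"
      using k by (intro sum.cong refl) (auto simp: error_coef_def)
    also have "\<dots> = 1" using k by (intro sum_of_bool_mult) auto
    finally show ?thesis .
  qed
  have "mean_error n p N lam \<sigma> T x = (\<Sum>k<N. lam (Suc k) * (\<Sum>l<N. (error_coef n p x k l)\<^sup>2))"
    by (rule mean_error_eq[OF assms(1-3) _ assms(4)]) (use lam in \<open>auto intro: less_imp_le\<close>)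
  also have "\<dots> = (\<Sum>k<p. \<Sum>l\<in>{p..<N}. lam (Suc l) * (ols_coef n {..<p} l w k)\<^sup>2) + (\<Sum>k\<in>{p..<N}. lam (Suc k))"
  proof -
    have "lam (Suc k) * (\<Sum>l<N. (error_coef n p x k l)\<^sup>2) = (\<Sum>l\<in>{p..<N}. lam (Suc l) * (ols_coef n {..<p} l w k)\<^sup>2)" if "k < p" for k
    proof -
      have "lam (Suc k) \<noteq> 0" using lam[rule_format, of k] that assms(3) by simp
      then show ?thesis unfolding row_low[OF that] sum_distrib_left by (intro sum.cong refl) simp
    qed
    then show ?thesis unfolding sumsplit[of "\<lambda>k. lam (Suc k) * _ k"] by (simp add: row_high)
  qed
  also have "(\<Sum>k<p. \<Sum>l\<in>{p..<N}. lam (Suc l) * (ols_coef n {..<p} l w k)\<^sup>2)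
      = (\<Sum>l\<in>{p..<N}. lam (Suc l) * ols_norm2 n {..<p} l w)"
    by (subst sum.swap) (simp add: ols_norm2_def sum_distrib_left)
  finally show ?thesis
    by (simp add: x_def distrib_left sum.distrib add.commute)
qed

text \<open>The \<open>R_l\<close> are dependent, since they share the columns in \<open>P\<close>.
  Bounds on the individual mean absolute deviations still add up with the eigenvalues as weights,
  and Markov's inequality is applied to the weighted sum \<open>F\<close>.\<close>

lemma prob_mean_error_deviation:
  assumes "\<sigma>\<^sup>2 = 0" "p + 2 < n" "p \<le> N" "isotropic_law N T" and lam: "\<forall>j<N. lam (Suc j) > 0"
    and "N > 0" "\<delta> > 0" "\<eta> > 0"
  defines "c \<equiv> real p / (real n - real p - 1)"
  defines "\<Lambda> \<equiv> \<Sum>l\<in>{p..<N}. lam (Suc l)"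
  defines "D \<equiv> design_law n N lam"
  assumes "\<Lambda> > 0"
  shows "prob_space D"
    and "mean_error n p N lam \<sigma> T \<in> borel_measurable D"
    and "measure D {x \<in> space D. \<bar>mean_error n p N lam \<sigma> T x - \<Lambda> * (1 + c)\<bar> \<le> \<eta> * (\<Lambda> * (1 + c))}
      \<ge> 1 - (\<delta> + real p / (2 * \<delta> * (real n + 1) * (real n - real p - 1))) / \<eta>"
proof -
  let ?I = "{..<n} \<times> {..<N}"
  let ?M = "\<Pi>\<^sub>M i\<in>{..<n}. \<Pi>\<^sub>M j\<in>{..<N}. (borel :: real measure)"
  let ?\<Phi> = "scaled_design n N lam"
  let ?E = "mean_error n p N lam \<sigma> T"
  interpret G: prob_space "gauss ?I" by (rule prob_space_gauss)
  have D: "D = distr (gauss ?I) ?M ?\<Phi>"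
    unfolding D_def using assms(2,6) by (intro design_law_eq_distr) auto
  have \<Phi>: "?\<Phi> \<in> gauss ?I \<rightarrow>\<^sub>M ?M" by (rule measurable_scaled_design)
  show "prob_space D" unfolding D by (rule G.prob_space_distr[OF \<Phi>])
  have lam0: "\<forall>j<N. lam (Suc j) \<ge> 0" using lam by (auto intro: less_imp_le)
  have EM: "?E \<in> borel_measurable ?M"
    using assms(2) by (intro measurable_mean_error assms(1,3,4) lam0) simp
  then show "?E \<in> borel_measurable D" unfolding D by (simp only: measurable_distr_eq1)
  define F where "F w = (\<Sum>l\<in>{p..<N}. lam (Suc l) * \<bar>ols_norm2 n {..<p} l w - c\<bar>)" for w
  define r where "r = \<delta> + real p / (2 * \<delta> * (real n + 1) * (real n - real p - 1))"
  have c0: "c \<ge> 0" using assms(2) by (simp add: c_def)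
  have col: "{..<n} \<times> insert l {..<p} \<subseteq> ?I" if "l \<in> {p..<N}" for l using that by auto
  have R: "integrable (gauss ?I) (ols_norm2 n {..<p} l)"
      "(\<integral>x. \<bar>ols_norm2 n {..<p} l x - c\<bar> \<partial>gauss ?I) \<le> (1 + c) * r" if "l \<in> {p..<N}" for l
    using integral_abs_ols_norm2_le[of ?I "{..<p}" l n \<delta>] col[OF that] that assms(2,7)
    by (auto simp: c_def r_def)
  have intF: "integrable (gauss ?I) F"
    unfolding F_def using R(1)
    by (intro Bochner_Integration.integrable_sum integrable_mult_right integrable_abs Bochner_Integration.integrable_diff) auto
  have "(\<integral>x. F x \<partial>gauss ?I) = (\<Sum>l\<in>{p..<N}. lam (Suc l) * (\<integral>x. \<bar>ols_norm2 n {..<p} l x - c\<bar> \<partial>gauss ?I))"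
    unfolding F_def using R(1)
    by (subst Bochner_Integration.integral_sum) (auto intro!: integrable_mult_right integrable_abs Bochner_Integration.integrable_diff)
  also have "\<dots> \<le> (\<Sum>l\<in>{p..<N}. lam (Suc l) * ((1 + c) * r))"
    using R(2) lam0 by (intro sum_mono mult_left_mono) auto
  also have "\<dots> = \<Lambda> * (1 + c) * r"
    by (simp add: \<Lambda>_def sum_distrib_right mult.assoc)
  finally have EF: "(\<integral>x. F x \<partial>gauss ?I) \<le> \<Lambda> * (1 + c) * r" .
  define a where "a = \<eta> * (\<Lambda> * (1 + c))"
  have a: "a > 0" using assms(8,12) c0 by (simp add: a_def)
  let ?A = "{x \<in> space D. \<bar>?E x - \<Lambda> * (1 + c)\<bar> \<le> \<eta> * (\<Lambda> * (1 + c))}"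
  have spD: "space D = space ?M" by (simp add: D)
  have Aset: "?A \<in> sets ?M"
  proof -
    have "(\<lambda>x. \<bar>?E x - \<Lambda> * (1 + c)\<bar>) \<in> borel_measurable ?M"
      by (intro borel_measurable_abs borel_measurable_diff EM borel_measurable_const)
    from borel_measurable_le[OF this borel_measurable_const] show ?thesis unfolding spD .
  qed
  have mA: "measure D ?A = measure (gauss ?I) (?\<Phi> -` ?A \<inter> space (gauss ?I))"
    using measure_distr[OF \<Phi> Aset] by (simp only: D[symmetric])
  have Bset: "{w \<in> space (gauss ?I). F w \<ge> a} \<in> sets (gauss ?I)"
    by (rule borel_measurable_le[OF borel_measurable_const borel_measurable_integrable[OF intF]])
  have "measure (gauss ?I) {w \<in> space (gauss ?I). F w \<ge> a} \<le> (\<integral>x. F x \<partial>gauss ?I) / a"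
    using lam0 by (intro integral_Markov_inequality_measure[OF intF] a AE_I2)
       (auto simp: F_def intro!: sum_nonneg mult_nonneg_nonneg)
  also have "\<dots> \<le> (\<Lambda> * (1 + c) * r) / a" using EF a by (intro divide_right_mono) auto
  also have "\<dots> = r / \<eta>" using assms(8,12) c0 by (simp add: a_def)
  finally have B: "measure (gauss ?I) {w \<in> space (gauss ?I). F w \<ge> a} \<le> r / \<eta>" .
  have "AE w in gauss ?I. gram_regular n {..<p} w"
    using assms(2,3) by (intro AE_gram_regular) auto
  \<comment> \<open>The inclusion of events holds only on regular designs, where the closed form of
    the error is available; hence the almost-everywhere version of monotonicity.\<close>
  then have "AE w in gauss ?I. w \<in> space (gauss ?I) - {w \<in> space (gauss ?I). F w \<ge> a} \<longrightarrow> w \<in> ?\<Phi> -` ?A \<inter> space (gauss ?I)"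
  proof (rule AE_mp, intro AE_I2 impI)
    fix w assume w: "w \<in> space (gauss ?I)" "gram_regular n {..<p} w" "w \<in> space (gauss ?I) - {w \<in> space (gauss ?I). F w \<ge> a}"
    have "?E (?\<Phi> w) - \<Lambda> * (1 + c) = (\<Sum>l\<in>{p..<N}. lam (Suc l) * (ols_norm2 n {..<p} l w - c))"
    proof -
      have "?E (?\<Phi> w) = (\<Sum>l\<in>{p..<N}. lam (Suc l) * (1 + ols_norm2 n {..<p} l w))"
        using assms(2) by (intro mean_error_scaled_design assms(1,3,4) lam w(2)) simp
      then show ?thesis
        by (simp add: \<Lambda>_def distrib_left right_diff_distrib sum.distrib sum_subtractf sum_distrib_right[symmetric])
    qed
    also have "\<bar>\<dots>\<bar> \<le> (\<Sum>l\<in>{p..<N}. \<bar>lam (Suc l) * (ols_norm2 n {..<p} l w - c)\<bar>)" by (rule sum_abs)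
    also have "\<dots> = F w" unfolding F_def using lam0 by (intro sum.cong refl) (simp add: abs_mult)
    finally have "\<bar>?E (?\<Phi> w) - \<Lambda> * (1 + c)\<bar> \<le> F w" .
    then show "w \<in> ?\<Phi> -` ?A \<inter> space (gauss ?I)"
      using w(1,3) measurable_space[OF \<Phi> w(1)] by (auto simp: spD a_def)
  qed
  then have "measure (gauss ?I) (space (gauss ?I) - {w \<in> space (gauss ?I). F w \<ge> a}) \<le> measure (gauss ?I) (?\<Phi> -` ?A \<inter> space (gauss ?I))"
    by (intro G.finite_measure_mono_AE measurable_sets[OF \<Phi> Aset])
  moreover have "measure (gauss ?I) (space (gauss ?I) - {w \<in> space (gauss ?I). F w \<ge> a}) = 1 - measure (gauss ?I) {w \<in> space (gauss ?I). F w \<ge> a}"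
    by (rule G.prob_compl[OF Bset])
  ultimately show "measure D ?A \<ge> 1 - (\<delta> + real p / (2 * \<delta> * (real n + 1) * (real n - real p - 1))) / \<eta>"
    using B unfolding mA r_def by linarith
qed

subsection \<open>The limiting risk\<close>

text \<open>An antiderivative of \<open>t powr (- \<kappa>)\<close> in both regimes, so that most
  arguments proceed through the derivative without a case distinction.\<close>

definition powr_prim :: "real \<Rightarrow> real \<Rightarrow> real" where
  "powr_prim \<kappa> t = (if \<kappa> = 1 then ln t else t powr (1 - \<kappa>) / (1 - \<kappa>))"

lemma DERIV_powr_prim:
  assumes "t > 0"
  shows "(powr_prim \<kappa> has_real_derivative t powr (- \<kappa>)) (at t)"
proof (cases "\<kappa> = 1")
  case True
  have "(ln has_real_derivative inverse t) (at t)" using assms by (rule DERIV_ln)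
  then show ?thesis
    using assms True by (simp add: powr_prim_def[abs_def] powr_minus)
next
  case False
  have "((\<lambda>t. t powr (1 - \<kappa>) / (1 - \<kappa>)) has_real_derivative ((1 - \<kappa>) * t powr (1 - \<kappa> - 1)) / (1 - \<kappa>)) (at t)"
    using assms by (intro DERIV_cdivide has_real_derivative_powr)
  then show ?thesis using False by (simp add: powr_prim_def[abs_def])
qed

lemma continuous_on_powr_prim:
  assumes "\<kappa> < 1 \<and> S \<subseteq> {0..} \<or> S \<subseteq> {0<..}"
  shows "continuous_on S (powr_prim \<kappa>)"
proof (cases "S \<subseteq> {0<..}")
  case True
  then have "isCont (powr_prim \<kappa>) t" if "t \<in> S" for t
    using that by (intro DERIV_isCont[OF DERIV_powr_prim]) auto
  then show ?thesis by (simp add: continuous_at_imp_continuous_on)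
next
  case False
  then have "\<kappa> < 1" "\<forall>t\<in>S. t \<ge> 0" using assms by auto
  then have "continuous_on S (\<lambda>t. t powr (1 - \<kappa>) / (1 - \<kappa>))"
    by (intro continuous_intros continuous_on_powr') auto
  then show ?thesis using \<open>\<kappa> < 1\<close> by (simp add: powr_prim_def[abs_def])
qed

lemma powr_prim_strict_mono:
  assumes "0 < a" "a < b"
  shows "powr_prim \<kappa> a < powr_prim \<kappa> b"
proof (rule DERIV_pos_imp_increasing[OF assms(2)])
  fix x assume "a \<le> x" "x \<le> b"
  then show "\<exists>y. (powr_prim \<kappa> has_real_derivative y) (at x) \<and> 0 < y"
    using DERIV_powr_prim[of x \<kappa>] assms by (intro exI[of _ "x powr (- \<kappa>)"]) auto
qed

text \<open>Stated for differences because at \<kappa> = 1 the logarithm is homogeneous only up to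
  an additive constant.\<close>

lemma powr_prim_scale:
  assumes "s > 0" "x > 0" "y > 0"
  shows "powr_prim \<kappa> x - powr_prim \<kappa> y = s powr (1 - \<kappa>) * (powr_prim \<kappa> (x / s) - powr_prim \<kappa> (y / s))"
proof -
  have "x powr (1 - \<kappa>) = s powr (1 - \<kappa>) * (x / s) powr (1 - \<kappa>)" "y powr (1 - \<kappa>) = s powr (1 - \<kappa>) * (y / s) powr (1 - \<kappa>)"
    using assms by (simp_all add: powr_divide)
  then show ?thesis
    using assms by (simp add: powr_prim_def ln_div right_diff_distrib diff_divide_distrib)
qed

lemma powr_prim_step:
  assumes "x > 0" "\<kappa> > 0"
  shows "powr_prim \<kappa> (x + 1) - powr_prim \<kappa> x \<le> x powr (- \<kappa>)"
    and "(x + 1) powr (- \<kappa>) \<le> powr_prim \<kappa> (x + 1) - powr_prim \<kappa> x"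
proof -
  obtain z where z: "z > x" "z < x + 1" "powr_prim \<kappa> (x + 1) - powr_prim \<kappa> x = (x + 1 - x) * z powr (- \<kappa>)"
    using MVT2[of x "x + 1" "powr_prim \<kappa>" "\<lambda>t. t powr (- \<kappa>)"] DERIV_powr_prim assms by auto
  show "powr_prim \<kappa> (x + 1) - powr_prim \<kappa> x \<le> x powr (- \<kappa>)" "(x + 1) powr (- \<kappa>) \<le> powr_prim \<kappa> (x + 1) - powr_prim \<kappa> x"
    using z assms by (auto intro!: powr_mono2')
qed

text \<open>Comparison of a decreasing summand with its integral, by telescoping the one-step
  bounds. The lower bound shifts both endpoints by 1.\<close>

lemma sum_powr_bounds:
  assumes "1 \<le> p" "p \<le> N" "\<kappa> > 0"
  shows "powr_prim \<kappa> (real N + 1) - powr_prim \<kappa> (real p + 1) \<le> (\<Sum>l\<in>{p..<N}. real (Suc l) powr (- \<kappa>))"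
    and "(\<Sum>l\<in>{p..<N}. real (Suc l) powr (- \<kappa>)) \<le> powr_prim \<kappa> (real N) - powr_prim \<kappa> (real p)"
proof -
  have "(\<Sum>l\<in>{p..<N}. powr_prim \<kappa> (real (Suc l) + 1) - powr_prim \<kappa> (real l + 1)) \<le> (\<Sum>l\<in>{p..<N}. real (Suc l) powr (- \<kappa>))"
    using powr_prim_step(1)[of "real (Suc _)", OF _ assms(3)] by (intro sum_mono) (simp add: add.commute)
  also have "(\<Sum>l\<in>{p..<N}. powr_prim \<kappa> (real (Suc l) + 1) - powr_prim \<kappa> (real l + 1)) = powr_prim \<kappa> (real N + 1) - powr_prim \<kappa> (real p + 1)"
    by (rule sum_Suc_diff'[of p N "\<lambda>l. powr_prim \<kappa> (real l + 1)", OF assms(2)])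
  finally show "powr_prim \<kappa> (real N + 1) - powr_prim \<kappa> (real p + 1) \<le> (\<Sum>l\<in>{p..<N}. real (Suc l) powr (- \<kappa>))" .
  have "(\<Sum>l\<in>{p..<N}. real (Suc l) powr (- \<kappa>)) \<le> (\<Sum>l\<in>{p..<N}. powr_prim \<kappa> (real (Suc l)) - powr_prim \<kappa> (real l))"
  proof (rule sum_mono)
    fix l assume "l \<in> {p..<N}"
    then show "real (Suc l) powr (- \<kappa>) \<le> powr_prim \<kappa> (real (Suc l)) - powr_prim \<kappa> (real l)"
      using powr_prim_step(2)[of "real l" \<kappa>] assms by (simp add: add.commute)
  qed
  also have "\<dots> = powr_prim \<kappa> (real N) - powr_prim \<kappa> (real p)"
    by (rule sum_Suc_diff'[of p N "\<lambda>l. powr_prim \<kappa> (real l)", OF assms(2)])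
  finally show "(\<Sum>l\<in>{p..<N}. real (Suc l) powr (- \<kappa>)) \<le> powr_prim \<kappa> (real N) - powr_prim \<kappa> (real p)" .
qed

section \<open>The tail integral and the slope of the risk\<close>

definition tail_int :: "real \<Rightarrow> real \<Rightarrow> real" where
  "tail_int \<kappa> a = powr_prim \<kappa> 1 - powr_prim \<kappa> a"

lemma DERIV_tail_int: "a > 0 \<Longrightarrow> (tail_int \<kappa> has_real_derivative - (a powr (- \<kappa>))) (at a)"
  unfolding tail_int_def[abs_def] by (auto intro!: derivative_eq_intros DERIV_powr_prim)

lemma tail_int_pos:
  assumes "a < 1" "a > 0 \<or> a = 0 \<and> \<kappa> < 1"
  shows "tail_int \<kappa> a > 0"
  using assms powr_prim_strict_mono[of a 1 \<kappa>] by (auto simp: tail_int_def powr_prim_def)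

text \<open>For \<kappa> \<ge> 1 the integrand dominates \<open>1 / t\<close> on
  \<open>(0, 1]\<close>. This gives the divergence of the integral at 0 and, later, that of the
  normalized tail sum.\<close>

lemma tail_int_ge_ln:
  assumes "0 < a" "a \<le> 1" "\<kappa> \<ge> 1"
  shows "tail_int \<kappa> a \<ge> - ln a"
proof -
  have "powr_prim \<kappa> a - ln a \<le> powr_prim \<kappa> 1 - ln 1"
  proof (rule DERIV_nonneg_imp_nondecreasing[OF assms(2)])
    fix x assume x: "a \<le> x" "x \<le> 1"
    then have x0: "x > 0" using assms by simp
    have "((\<lambda>x. powr_prim \<kappa> x - ln x) has_real_derivative x powr (- \<kappa>) - inverse x) (at x)"
      using x0 by (auto intro!: derivative_eq_intros DERIV_powr_prim simp: divide_inverse)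
    moreover have "x powr (- \<kappa>) \<ge> x powr (- 1)"
      using x x0 assms(3) by (intro powr_mono') auto
    then have "x powr (- \<kappa>) - inverse x \<ge> 0" using x0 by (simp add: powr_minus)
    ultimately show "\<exists>y. ((\<lambda>x. powr_prim \<kappa> x - ln x) has_real_derivative y) (at x) \<and> y \<ge> 0" by blast
  qed
  then show ?thesis by (simp add: tail_int_def)
qed

lemma nn_integral_powr_tail:
  assumes "a \<le> 1" "a > 0 \<or> a = 0 \<and> \<kappa> < 1"
  shows "(\<integral>\<^sup>+t\<in>{a..1}. ennreal (t powr (- \<kappa>)) \<partial>lborel) = ennreal (tail_int \<kappa> a)"
proof (cases "a > 0")
  case True
  show ?thesis
    unfolding tail_int_def
    by (rule nn_integral_FTC_Icc) (use True assms in \<open>auto intro!: DERIV_powr_prim\<close>)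
next
  case False
  then have a: "a = 0" "\<kappa> < 1" using assms by auto
  have "((\<lambda>t. t powr (- \<kappa>)) has_integral (1 powr (- \<kappa> + 1) / (- \<kappa> + 1))) {0..1}"
    using a by (intro has_integral_powr_from_0) auto
  then have "((\<lambda>t. t powr (- \<kappa>)) has_integral (1 / (1 - \<kappa>))) {0..1}" by simp
  then have "((\<lambda>t. if t \<in> {0..1} then t powr (- \<kappa>) else 0) has_integral (1 / (1 - \<kappa>))) UNIV"
    by (simp only: has_integral_restrict_UNIV)
  then have "(\<integral>\<^sup>+t. ennreal (if t \<in> {0..1} then t powr (- \<kappa>) else 0) \<partial>lborel) = ennreal (1 / (1 - \<kappa>))"
    by (intro nn_integral_has_integral_lborel) auto
  moreover have "(\<integral>\<^sup>+t\<in>{0..1}. ennreal (t powr (- \<kappa>)) \<partial>lborel) = (\<integral>\<^sup>+t. ennreal (if t \<in> {0..1} then t powr (- \<kappa>) else 0) \<partial>lborel)"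
    by (intro nn_integral_cong) (auto simp: indicator_def)
  ultimately show ?thesis
    using a by (simp add: tail_int_def powr_prim_def)
qed

lemma nn_integral_powr_tail_top:
  assumes "\<kappa> \<ge> 1"
  shows "(\<integral>\<^sup>+t\<in>{0..1}. ennreal (t powr (- \<kappa>)) \<partial>lborel) = \<infinity>" (is "?I = _")
proof (rule ccontr)
  assume "?I \<noteq> \<infinity>"
  then obtain c where c: "?I = ennreal c" "c \<ge> 0" by (cases ?I rule: ennreal_cases) auto
  \<comment> \<open>Chosen so that \<open>- ln a = c + 1\<close>, which exceeds the supposed finite
    value \<open>c\<close>.\<close>
  define a where "a = exp (- (c + 1))"
  have a: "0 < a" "a \<le> 1" using c by (auto simp: a_def)
  have "ennreal (c + 1) \<le> ennreal (tail_int \<kappa> a)"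
    using tail_int_ge_ln[OF a assms] by (intro ennreal_leI) (simp add: a_def)
  also have "\<dots> = (\<integral>\<^sup>+t\<in>{a..1}. ennreal (t powr (- \<kappa>)) \<partial>lborel)"
    using a by (intro nn_integral_powr_tail[symmetric]) auto
  also have "\<dots> \<le> ?I"
    using a by (intro nn_integral_mono) (auto simp: indicator_def)
  finally show False using c by simp
qed

text \<open>The derivative of the risk after the positive factor
  \<open>\<beta> / (\<beta> - a)^2\<close> has been removed.\<close>

definition risk_slope :: "real \<Rightarrow> real \<Rightarrow> real \<Rightarrow> real" where
  "risk_slope \<kappa> \<beta> a = tail_int \<kappa> a - a powr (- \<kappa>) * (\<beta> - a)"

lemma h_fun_eq:
  assumes "0 < a" "a \<le> 1"
  shows "h_fun \<kappa> \<beta> a = - (a powr (\<kappa> - 1)) * risk_slope \<kappa> \<beta> a"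
proof -
  have "(LBINT t:{a..1}. t powr (\<kappa> - 2)) = (\<integral>t. t powr (\<kappa> - 2) * indicator {a..1} t \<partial>lborel)"
    by (simp add: set_lebesgue_integral_def mult.commute)
  also have "\<dots> = powr_prim (2 - \<kappa>) 1 - powr_prim (2 - \<kappa>) a"
  proof (rule integral_FTC_Icc_real[OF assms(2)])
    show "(powr_prim (2 - \<kappa>) has_real_derivative x powr (\<kappa> - 2)) (at x)" if "a \<le> x" "x \<le> 1" for x
      using DERIV_powr_prim[of x "2 - \<kappa>"] that assms by simp
    show "isCont (\<lambda>x. x powr (\<kappa> - 2)) x" if "a \<le> x" "x \<le> 1" for x
      using that assms by (intro continuous_intros) auto
  qed
  finally have h: "h_fun \<kappa> \<beta> a = \<beta> / a - (powr_prim (2 - \<kappa>) 1 - powr_prim (2 - \<kappa>) a) - 1"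
    by (simp add: h_fun_def)
  show ?thesis
  proof (cases "\<kappa> = 1")
    case True
    then show ?thesis
      unfolding h using assms by (simp add: risk_slope_def tail_int_def powr_prim_def powr_minus field_simps)
  next
    case False
    \<comment> \<open>All powers of \<open>a\<close> that occur are rational in \<open>u\<close> and
      \<open>a\<close>, which reduces the identity to field arithmetic.\<close>
    define u where "u = a powr (\<kappa> - 1)"
    have u: "u > 0" using assms by (simp add: u_def)
    have 1: "a powr (1 - \<kappa>) = 1 / u" using powr_minus_divide[of a "\<kappa> - 1"] by (simp add: u_def)
    have "a powr (- \<kappa>) = a powr (1 - \<kappa>) / a" using assms powr_diff[of a "1 - \<kappa>" 1] by simp
    then have 2: "a powr (- \<kappa>) = 1 / (u * a)" by (simp add: 1)
    have "h_fun \<kappa> \<beta> a = \<beta> / a - (1 / (\<kappa> - 1) - u / (\<kappa> - 1)) - 1"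
      using False by (simp add: h powr_prim_def u_def)
    moreover have "risk_slope \<kappa> \<beta> a = 1 / (1 - \<kappa>) - 1 / u / (1 - \<kappa>) - 1 / (u * a) * (\<beta> - a)"
      using False by (simp add: risk_slope_def tail_int_def powr_prim_def 1 2)
    moreover have "\<beta> / a - (1 / d - u / d) - 1 = - u * (1 / - d - 1 / u / - d - 1 / (u * a) * (\<beta> - a))" if "d \<noteq> 0" for d
      using u assms that by (simp add: field_simps)
    from this[of "\<kappa> - 1"] have "\<beta> / a - (1 / (\<kappa> - 1) - u / (\<kappa> - 1)) - 1 = - u * (1 / (1 - \<kappa>) - 1 / u / (1 - \<kappa>) - 1 / (u * a) * (\<beta> - a))"
      using False by simp
    ultimately show ?thesis by (simp add: u_def)
  qed
qed

text \<open>The derivative of \<open>tail_int\<close> cancels against the term from differentiating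
  \<open>\<beta> - a\<close>. A single term remains, of constant sign on
  \<open>(0, \<beta>)\<close>.\<close>

lemma DERIV_risk_slope:
  assumes "a > 0"
  shows "(risk_slope \<kappa> \<beta> has_real_derivative \<kappa> * a powr (- \<kappa> - 1) * (\<beta> - a)) (at a)"
proof -
  have "((\<lambda>a. a powr (- \<kappa>)) has_real_derivative - \<kappa> * a powr (- \<kappa> - 1)) (at a)"
    by (rule has_real_derivative_powr[OF assms])
  from DERIV_diff[OF DERIV_tail_int[OF assms, of \<kappa>] DERIV_mult[OF this DERIV_diff[OF DERIV_const[of \<beta>] DERIV_ident]]]
  show ?thesis
    unfolding risk_slope_def[abs_def] by (rule DERIV_cong) (simp add: algebra_simps)
qed

lemma risk_slope_strict_mono:
  assumes "\<kappa> > 0" "0 < a" "a < b" "b < \<beta>"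
  shows "risk_slope \<kappa> \<beta> a < risk_slope \<kappa> \<beta> b"
proof (rule DERIV_pos_imp_increasing[OF assms(3)])
  fix x assume x: "a \<le> x" "x \<le> b"
  then have "\<kappa> * x powr (- \<kappa> - 1) * (\<beta> - x) > 0" using assms by simp
  then show "\<exists>y. (risk_slope \<kappa> \<beta> has_real_derivative y) (at x) \<and> y > 0"
    using DERIV_risk_slope[of x \<kappa> \<beta>] x assms by auto
qed

text \<open>Multiplication by \<open>a powr \<kappa>\<close> keeps the sign and tames the
  singularity at 0: the tail integral is of smaller order than \<open>a powr (- \<kappa>)\<close>,
  so the product tends to \<open>- \<beta>\<close>.\<close>

lemma ex_risk_slope_neg:
  assumes "\<kappa> > 0" "0 < \<beta>"
  shows "\<exists>a. 0 < a \<and> a < \<beta> \<and> risk_slope \<kappa> \<beta> a < 0"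
proof -
  have "((\<lambda>a. a powr \<kappa> * tail_int \<kappa> a - (\<beta> - a)) \<longlongrightarrow> 0 - (\<beta> - 0)) (at_right 0)"
  proof (intro tendsto_diff tendsto_const tendsto_ident_at)
    have p: "((\<lambda>a::real. a powr \<kappa>) \<longlongrightarrow> 0) (at_right 0)"
      using assms(1) by real_asymp
    show "((\<lambda>a. a powr \<kappa> * tail_int \<kappa> a) \<longlongrightarrow> 0) (at_right 0)"
    proof (cases "\<kappa> = 1")
      case True
      have "((\<lambda>a::real. a * (- ln a)) \<longlongrightarrow> 0) (at_right 0)" by real_asymp
      moreover have "eventually (\<lambda>a. a * (- ln a) = a powr \<kappa> * tail_int \<kappa> a) (at_right 0)"
        using eventually_at_right_less[of 0] by eventually_elim (use True in \<open>simp add: tail_int_def powr_prim_def\<close>)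
      ultimately show ?thesis by (rule Lim_transform_eventually)
    next
      case False
      have "((\<lambda>a. (a powr \<kappa> - a) / (1 - \<kappa>)) \<longlongrightarrow> (0 - 0) / (1 - \<kappa>)) (at_right 0)"
        using False by (intro tendsto_intros p) auto
      moreover have "eventually (\<lambda>a. (a powr \<kappa> - a) / (1 - \<kappa>) = a powr \<kappa> * tail_int \<kappa> a) (at_right 0)"
        using eventually_at_right_less[of 0]
      proof eventually_elim
        case (elim a)
        have "a powr \<kappa> * a powr (1 - \<kappa>) = a" using elim by (simp add: powr_add[symmetric])
        then show ?case
          using False by (simp add: tail_int_def powr_prim_def right_diff_distrib diff_divide_distrib)
      qed
      ultimately show ?thesis by (simp add: Lim_transform_eventually)
    qed
  qed
  then have "eventually (\<lambda>a. a powr \<kappa> * tail_int \<kappa> a - (\<beta> - a) < 0) (at_right 0)"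
    using assms(2) by (intro order_tendstoD(2)) auto
  moreover have "eventually (\<lambda>a. 0 < a \<and> a < \<beta>) (at_right 0)"
    using assms(2) by (auto simp: eventually_at_right_field intro!: exI[of _ \<beta>])
  ultimately have "eventually (\<lambda>a. 0 < a \<and> a < \<beta> \<and> risk_slope \<kappa> \<beta> a < 0) (at_right 0)"
  proof eventually_elim
    case (elim a)
    have "a powr (- \<kappa>) * (a powr \<kappa> * tail_int \<kappa> a - (\<beta> - a)) < 0"
      using elim by (intro mult_pos_neg) auto
    moreover have "a powr (- \<kappa>) * (a powr \<kappa> * tail_int \<kappa> a - (\<beta> - a)) = risk_slope \<kappa> \<beta> a"
      using elim by (simp add: risk_slope_def right_diff_distrib mult.assoc[symmetric] powr_add[symmetric])
    ultimately show ?case using elim by simp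
  qed
  then show ?thesis
    by (rule eventually_happens'[OF trivial_limit_at_right_real])
qed

lemma risk_slope_root:
  assumes "\<kappa> > 0" "0 < \<beta>" "\<beta> < 1"
  shows "\<exists>!a. a \<in> {0<..<\<beta>} \<and> risk_slope \<kappa> \<beta> a = 0"
proof -
  obtain a where a: "0 < a" "a < \<beta>" "risk_slope \<kappa> \<beta> a < 0" using ex_risk_slope_neg assms by blast
  \<comment> \<open>At \<open>a = \<beta>\<close> the subtracted term vanishes and the tail integral
    is positive because \<beta> < 1.\<close>
  have b: "risk_slope \<kappa> \<beta> \<beta> > 0" using tail_int_pos[of \<beta> \<kappa>] assms by (simp add: risk_slope_def)
  have "\<exists>x\<ge>a. x \<le> \<beta> \<and> risk_slope \<kappa> \<beta> x = 0"
  proof (rule IVT)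
    show "\<forall>x. a \<le> x \<and> x \<le> \<beta> \<longrightarrow> isCont (risk_slope \<kappa> \<beta>) x"
      using a by (auto intro!: DERIV_isCont[OF DERIV_risk_slope])
  qed (use a b in auto)
  then obtain x where x: "x \<ge> a" "x \<le> \<beta>" "risk_slope \<kappa> \<beta> x = 0" by blast
  then have "x \<in> {0<..<\<beta>}" using a b by (auto simp: less_le)
  moreover have "y = x" if "y \<in> {0<..<\<beta>}" "risk_slope \<kappa> \<beta> y = 0" for y
    using risk_slope_strict_mono[of \<kappa> x y \<beta>] risk_slope_strict_mono[of \<kappa> y x \<beta>] that x \<open>x \<in> _\<close> assms(1)
    by (cases x y rule: linorder_cases) auto
  ultimately show ?thesis using x by blast
qed

section \<open>Monotonicity and minimum of the risk\<close>

definition risk_real :: "real \<Rightarrow> real \<Rightarrow> real \<Rightarrow> real" where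
  "risk_real \<kappa> \<beta> a = tail_int \<kappa> a * (\<beta> / (\<beta> - a))"

lemma DERIV_risk_real:
  assumes "0 < a" "a < \<beta>"
  shows "(risk_real \<kappa> \<beta> has_real_derivative \<beta> * risk_slope \<kappa> \<beta> a / (\<beta> - a)\<^sup>2) (at a)"
proof -
  have "((\<lambda>a. \<beta> / (\<beta> - a)) has_real_derivative \<beta> / (\<beta> - a)\<^sup>2) (at a)"
    using assms by (auto intro!: derivative_eq_intros simp: power2_eq_square)
  from DERIV_mult[OF DERIV_tail_int[OF assms(1), of \<kappa>] this]
  have D: "(risk_real \<kappa> \<beta> has_real_derivative - (a powr (- \<kappa>)) * (\<beta> / (\<beta> - a)) + \<beta> / (\<beta> - a)\<^sup>2 * tail_int \<kappa> a) (at a)"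
    unfolding risk_real_def[abs_def] .
  have "\<beta> / (\<beta> - a) = \<beta> * (\<beta> - a) / (\<beta> - a)\<^sup>2" using assms by (simp add: power2_eq_square)
  moreover have "- w * (\<beta> * v / d) + \<beta> / d * t = \<beta> * (t - w * v) / d" for w v d t :: real
    by (simp add: algebra_simps diff_divide_distrib)
  ultimately have "- (a powr (- \<kappa>)) * (\<beta> / (\<beta> - a)) + \<beta> / (\<beta> - a)\<^sup>2 * tail_int \<kappa> a = \<beta> * risk_slope \<kappa> \<beta> a / (\<beta> - a)\<^sup>2"
    by (simp only: risk_slope_def)
  with D show ?thesis by simp
qed

lemma continuous_on_risk_real:
  assumes "b < \<beta>" "a > 0 \<or> a = 0 \<and> \<kappa> < 1"
  shows "continuous_on {a..b} (risk_real \<kappa> \<beta>)"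
  unfolding risk_real_def[abs_def] tail_int_def[abs_def] using assms
  by (intro continuous_intros continuous_on_powr_prim) auto

text \<open>The derivative is used in the open interval and continuity at its ends, which admits the
  left endpoint 0 when \<kappa> < 1 although the derivative formula fails there.\<close>

lemma risk_real_mono:
  assumes "\<kappa> > 0" "\<beta> > 0" and root: "s \<in> {0<..<\<beta>}" "risk_slope \<kappa> \<beta> s = 0" and a: "a > 0 \<or> a = 0 \<and> \<kappa> < 1"
  shows "a < b \<Longrightarrow> b \<le> s \<Longrightarrow> risk_real \<kappa> \<beta> b < risk_real \<kappa> \<beta> a"
    and "s \<le> a \<Longrightarrow> a < b \<Longrightarrow> b < \<beta> \<Longrightarrow> risk_real \<kappa> \<beta> a < risk_real \<kappa> \<beta> b"
proof -
  show "risk_real \<kappa> \<beta> b < risk_real \<kappa> \<beta> a" if ab: "a < b" "b \<le> s"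
  proof (rule DERIV_neg_imp_decreasing_open[OF ab(1)])
    fix x assume x: "a < x" "x < b"
    then have "risk_slope \<kappa> \<beta> x < 0"
      using risk_slope_strict_mono[of \<kappa> x s \<beta>] root ab a assms(1) by auto
    then have "\<beta> * risk_slope \<kappa> \<beta> x / (\<beta> - x)\<^sup>2 < 0"
      using assms(2) x root ab by (intro divide_neg_pos mult_pos_neg) auto
    then show "\<exists>y. (risk_real \<kappa> \<beta> has_real_derivative y) (at x) \<and> y < 0"
      using DERIV_risk_real[of x \<beta> \<kappa>] x a root ab by auto
  qed (use ab root a in \<open>auto intro!: continuous_on_risk_real\<close>)
  show "risk_real \<kappa> \<beta> a < risk_real \<kappa> \<beta> b" if ab: "s \<le> a" "a < b" "b < \<beta>"
  proof (rule DERIV_pos_imp_increasing_open[OF ab(2)])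
    fix x assume x: "a < x" "x < b"
    then have "risk_slope \<kappa> \<beta> x > 0"
      using risk_slope_strict_mono[of \<kappa> s x \<beta>] root ab a assms(1) by auto
    then have "\<beta> * risk_slope \<kappa> \<beta> x / (\<beta> - x)\<^sup>2 > 0"
      using assms(2) x root ab by (intro divide_pos_pos mult_pos_pos) auto
    then show "\<exists>y. (risk_real \<kappa> \<beta> has_real_derivative y) (at x) \<and> y > 0"
      using DERIV_risk_real[of x \<beta> \<kappa>] x a root ab by auto
  qed (use ab root a in \<open>auto intro!: continuous_on_risk_real\<close>)
qed

lemma risk_eq:
  assumes "a < \<beta>" "\<beta> < 1" "0 < \<beta>" "a > 0 \<or> a = 0 \<and> \<kappa> < 1"
  shows "risk \<kappa> \<beta> m a = ennreal (real m powr (1 - \<kappa>) * risk_real \<kappa> \<beta> a)"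
    and "risk_coeff \<kappa> \<beta> a = ennreal (risk_real \<kappa> \<beta> a)" and "risk_real \<kappa> \<beta> a > 0"
proof -
  have "tail_int \<kappa> a > 0" using assms by (intro tail_int_pos) auto
  then show pos: "risk_real \<kappa> \<beta> a > 0" using assms by (simp add: risk_real_def)
  show "risk_coeff \<kappa> \<beta> a = ennreal (risk_real \<kappa> \<beta> a)"
    using assms nn_integral_powr_tail[of a \<kappa>] \<open>tail_int \<kappa> a > 0\<close>
    by (simp add: risk_coeff_def risk_real_def ennreal_mult[symmetric])
  then show "risk \<kappa> \<beta> m a = ennreal (real m powr (1 - \<kappa>) * risk_real \<kappa> \<beta> a)"
    using pos by (simp add: risk_def ennreal_mult)
qed

lemma risk_coeff_0_top:
  assumes "\<kappa> \<ge> 1" "\<beta> > 0"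
  shows "risk_coeff \<kappa> \<beta> 0 = \<infinity>" "m \<ge> 1 \<Longrightarrow> risk \<kappa> \<beta> m 0 = \<infinity>"
proof -
  show t: "risk_coeff \<kappa> \<beta> 0 = \<infinity>"
    using nn_integral_powr_tail_top[OF assms(1)] assms(2) by (simp add: risk_coeff_def ennreal_top_mult)
  show "risk \<kappa> \<beta> m 0 = \<infinity>" if "m \<ge> 1"
    using t that by (simp add: risk_def ennreal_mult_top)
qed

lemma risk_shape:
  assumes "\<kappa> > 0" "0 < \<beta>" "\<beta> < 1" and root: "s \<in> {0<..<\<beta>}" "risk_slope \<kappa> \<beta> s = 0" and m: "(m::nat) \<ge> 1"
  shows "strict_antimono_on {0..<s} (risk \<kappa> \<beta> m)"
    and "strict_mono_on {s<..<\<beta>} (risk \<kappa> \<beta> m)"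
    and "risk \<kappa> \<beta> m s = (INF a\<in>{0..<\<beta>}. risk \<kappa> \<beta> m a)"
    and "risk \<kappa> \<beta> m s = ennreal (real m powr (1 - \<kappa>) * (\<beta> / s powr \<kappa>))"
proof -
  let ?c = "real m powr (1 - \<kappa>)"
  have c: "?c > 0" using m by simp
  have less: "risk \<kappa> \<beta> m a < risk \<kappa> \<beta> m b"
    if "a > 0 \<or> a = 0 \<and> \<kappa> < 1" "b > 0 \<or> b = 0 \<and> \<kappa> < 1" "a < \<beta>" "b < \<beta>" "risk_real \<kappa> \<beta> a < risk_real \<kappa> \<beta> b" for a b
  proof -
    have "0 \<le> ?c * risk_real \<kappa> \<beta> a" using risk_eq(3)[OF that(3) assms(3,2) that(1)] c by simp
    then show ?thesis
      unfolding risk_eq(1)[OF that(3) assms(3,2) that(1)] risk_eq(1)[OF that(4) assms(3,2) that(2)]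
      using that(5) c by (simp only: ennreal_less_iff mult_less_cancel_left_pos)
  qed
  have down: "risk \<kappa> \<beta> m b < risk \<kappa> \<beta> m a" if "0 \<le> a" "a < b" "b \<le> s" for a b
  \<comment> \<open>Here the risk at 0 is infinite and lies strictly above the finite value at
    \<open>b\<close>.\<close>
  proof (cases "a = 0 \<and> \<kappa> \<ge> 1")
    case True
    then show ?thesis
      using risk_coeff_0_top(2)[OF _ assms(2) m] risk_eq(1)[of b \<beta> \<kappa> m] that root assms(2,3) by simp
  next
    case False
    then have a: "a > 0 \<or> a = 0 \<and> \<kappa> < 1" using that by auto
    show ?thesis
      using risk_real_mono(1)[OF assms(1,2) root a that(2,3)] a that root by (intro less) auto
  qed
  have up: "risk \<kappa> \<beta> m a < risk \<kappa> \<beta> m b" if "s \<le> a" "a < b" "b < \<beta>" for a b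
    using risk_real_mono(2)[OF assms(1,2) root _ that] that root by (intro less) auto
  show "strict_antimono_on {0..<s} (risk \<kappa> \<beta> m)"
    by (intro monotone_onI down) auto
  show "strict_mono_on {s<..<\<beta>} (risk \<kappa> \<beta> m)"
    by (intro monotone_onI up) auto
  show "risk \<kappa> \<beta> m s = (INF a\<in>{0..<\<beta>}. risk \<kappa> \<beta> m a)"
  proof (rule antisym)
    show "risk \<kappa> \<beta> m s \<le> (INF a\<in>{0..<\<beta>}. risk \<kappa> \<beta> m a)"
    proof (rule INF_greatest)
      fix a assume "a \<in> {0..<\<beta>}"
      then show "risk \<kappa> \<beta> m s \<le> risk \<kappa> \<beta> m a"
        using down[of a s] up[of s a] by (cases a s rule: linorder_cases) (auto intro: less_imp_le)
    qed
    show "(INF a\<in>{0..<\<beta>}. risk \<kappa> \<beta> m a) \<le> risk \<kappa> \<beta> m s"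
      using root by (intro INF_lower) auto
  qed
  \<comment> \<open>At the root the tail integral contains the factor \<open>\<beta> - s\<close>,
    which cancels the denominator of the risk.\<close>
  have "tail_int \<kappa> s = s powr (- \<kappa>) * (\<beta> - s)" using root by (simp add: risk_slope_def)
  then have "risk_real \<kappa> \<beta> s = \<beta> / s powr \<kappa>"
    using root by (simp add: risk_real_def powr_minus_divide)
  then show "risk \<kappa> \<beta> m s = ennreal (real m powr (1 - \<kappa>) * (\<beta> / s powr \<kappa>))"
    using root assms(2,3) by (simp add: risk_eq)
qed

subsection \<open>Asymptotics\<close>

definition tail_sum :: "real \<Rightarrow> nat \<Rightarrow> nat \<Rightarrow> real" where
  "tail_sum \<kappa> p N = (\<Sum>l\<in>{p..<N}. real (Suc l) powr (- \<kappa>))"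

text \<open>Scaling by \<open>N\<close> removes the power of \<open>N\<close>, so that both bounds
  depend on \<open>p / N\<close> up to a shift by \<open>1 / N\<close>.\<close>

lemma normalized_tail_sum_bounds:
  assumes "1 \<le> p" "p \<le> N" "\<kappa> > 0"
  shows "powr_prim \<kappa> (real N / real N + 1 / real N) - powr_prim \<kappa> (real p / real N + 1 / real N) \<le> real N powr (\<kappa> - 1) * tail_sum \<kappa> p N"
    and "real N powr (\<kappa> - 1) * tail_sum \<kappa> p N \<le> tail_int \<kappa> (real p / real N)"
proof -
  have N: "real N > 0" "real p > 0" using assms by auto
  have c: "real N powr (\<kappa> - 1) * (real N powr (1 - \<kappa>) * r) = r" for r
    using N by (simp add: mult.assoc[symmetric] powr_add[symmetric])
  note b = sum_powr_bounds[OF assms(1-3), folded tail_sum_def]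
  have "real N powr (\<kappa> - 1) * (powr_prim \<kappa> (real N + 1) - powr_prim \<kappa> (real p + 1)) \<le> real N powr (\<kappa> - 1) * tail_sum \<kappa> p N"
    using b(1) by (intro mult_left_mono) auto
  moreover have "powr_prim \<kappa> (real N + 1) - powr_prim \<kappa> (real p + 1)
      = real N powr (1 - \<kappa>) * (powr_prim \<kappa> ((real N + 1) / real N) - powr_prim \<kappa> ((real p + 1) / real N))"
    using N by (intro powr_prim_scale) auto
  ultimately show "powr_prim \<kappa> (real N / real N + 1 / real N) - powr_prim \<kappa> (real p / real N + 1 / real N) \<le> real N powr (\<kappa> - 1) * tail_sum \<kappa> p N"
    by (simp only: c add_divide_distrib)
  have "real N powr (\<kappa> - 1) * tail_sum \<kappa> p N \<le> real N powr (\<kappa> - 1) * (powr_prim \<kappa> (real N) - powr_prim \<kappa> (real p))"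
    using b(2) by (intro mult_left_mono) auto
  also have "powr_prim \<kappa> (real N) - powr_prim \<kappa> (real p)
      = real N powr (1 - \<kappa>) * (powr_prim \<kappa> (real N / real N) - powr_prim \<kappa> (real p / real N))"
    using N by (intro powr_prim_scale) auto
  finally show "real N powr (\<kappa> - 1) * tail_sum \<kappa> p N \<le> tail_int \<kappa> (real p / real N)"
    using N by (simp only: c tail_int_def divide_self)
qed

context
  fixes \<kappa> \<alpha> :: real and p N :: "nat \<Rightarrow> nat"
  assumes \<kappa>: "\<kappa> > 0" and \<alpha>: "0 \<le> \<alpha>"
    and pN: "\<And>k. p k \<le> N k"
    and lim: "filterlim p at_top sequentially" "filterlim N at_top sequentially"
      "(\<lambda>k. real (p k) / real (N k)) \<longlonglongrightarrow> \<alpha>"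
begin

private lemma inverse_N: "(\<lambda>k. 1 / real (N k)) \<longlonglongrightarrow> 0"
  by (rule tendsto_divide_0[OF tendsto_const])
     (rule filterlim_at_top_imp_at_infinity[OF filterlim_compose[OF filterlim_real_sequentially lim(2)]])

private lemma shifted_ratio: "(\<lambda>k. real (p k) / real (N k) + 1 / real (N k)) \<longlonglongrightarrow> \<alpha>"
  using tendsto_add[OF lim(3) inverse_N] by simp

private lemma p_pos: "eventually (\<lambda>k. 1 \<le> p k) sequentially"
  using lim(1) by (auto simp: filterlim_at_top)

lemma tendsto_normalized_tail_sum:
  assumes "\<alpha> > 0 \<or> \<kappa> < 1"
  shows "(\<lambda>k. real (N k) powr (\<kappa> - 1) * tail_sum \<kappa> (p k) (N k)) \<longlonglongrightarrow> tail_int \<kappa> \<alpha>"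
proof -
  \<comment> \<open>The domain on which the antiderivative is continuous: 0 is included only if
    \<alpha> = 0, and then \<kappa> < 1. The arguments themselves are eventually positive because
    \<open>p\<close> is.\<close>
  define S where "S = (if \<alpha> > 0 then {0<..} else {0::real..})"
  have cont: "continuous_on S (powr_prim \<kappa>)"
    using assms by (intro continuous_on_powr_prim) (auto simp: S_def)
  have S: "\<alpha> \<in> S" "1 \<in> S" using \<alpha> by (auto simp: S_def)
  have pos: "eventually (\<lambda>k. real (p k) / real (N k) > 0 \<and> 1 / real (N k) > 0) sequentially"
    using p_pos
  proof eventually_elim
    case (elim k)
    then have "N k > 0" using pN[of k] by linarith
    with elim show ?case by simp
  qed
  have inS: "t \<in> S" if "t > 0" for t using that by (auto simp: S_def)
  have 1: "(\<lambda>k. powr_prim \<kappa> (real (p k) / real (N k))) \<longlonglongrightarrow> powr_prim \<kappa> \<alpha>"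
    by (rule continuous_on_tendsto_compose[OF cont lim(3) S(1)]) (use pos in eventually_elim, auto intro: inS)
  have 2: "(\<lambda>k. powr_prim \<kappa> (real (p k) / real (N k) + 1 / real (N k))) \<longlonglongrightarrow> powr_prim \<kappa> \<alpha>"
    by (rule continuous_on_tendsto_compose[OF cont shifted_ratio S(1)]) (use pos in eventually_elim, auto intro!: inS add_pos_pos)
  have one: "(\<lambda>k. real (N k) / real (N k) + 1 / real (N k)) \<longlonglongrightarrow> 1"
  proof (rule Lim_transform_eventually)
    show "(\<lambda>k. 1 + 1 / real (N k)) \<longlonglongrightarrow> 1" using tendsto_add[OF tendsto_const inverse_N] by simp
    show "eventually (\<lambda>k. 1 + 1 / real (N k) = real (N k) / real (N k) + 1 / real (N k)) sequentially"
      using pos by eventually_elim auto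
  qed
  have 3: "(\<lambda>k. powr_prim \<kappa> (real (N k) / real (N k) + 1 / real (N k))) \<longlonglongrightarrow> powr_prim \<kappa> 1"
    by (rule continuous_on_tendsto_compose[OF cont one S(2)]) (use pos in eventually_elim, auto intro!: inS add_nonneg_pos)
  show ?thesis
  proof (rule tendsto_sandwich)
    show "(\<lambda>k. powr_prim \<kappa> (real (N k) / real (N k) + 1 / real (N k)) - powr_prim \<kappa> (real (p k) / real (N k) + 1 / real (N k)))
        \<longlonglongrightarrow> tail_int \<kappa> \<alpha>"
      unfolding tail_int_def by (intro tendsto_diff 2 3)
    show "(\<lambda>k. tail_int \<kappa> (real (p k) / real (N k))) \<longlonglongrightarrow> tail_int \<kappa> \<alpha>"
      unfolding tail_int_def by (intro tendsto_diff tendsto_const 1)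
    show "eventually (\<lambda>k. powr_prim \<kappa> (real (N k) / real (N k) + 1 / real (N k)) - powr_prim \<kappa> (real (p k) / real (N k) + 1 / real (N k))
        \<le> real (N k) powr (\<kappa> - 1) * tail_sum \<kappa> (p k) (N k)) sequentially"
      using p_pos by eventually_elim (rule normalized_tail_sum_bounds(1)[OF _ pN \<kappa>])
    show "eventually (\<lambda>k. real (N k) powr (\<kappa> - 1) * tail_sum \<kappa> (p k) (N k)
        \<le> tail_int \<kappa> (real (p k) / real (N k))) sequentially"
      using p_pos by eventually_elim (rule normalized_tail_sum_bounds(2)[OF _ pN \<kappa>])
  qed
qed

text \<open>The shifted ratio tends to 0, so the logarithmic lower bound on the tail integral
  exceeds any constant.\<close>

lemma eventually_tail_sum_ge:
  assumes "\<alpha> = 0" "\<kappa> \<ge> 1"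
  shows "eventually (\<lambda>k. C * real (N k) powr (1 - \<kappa>) \<le> tail_sum \<kappa> (p k) (N k)) sequentially"
proof -
  \<comment> \<open>The threshold makes \<open>- ln q\<close> exceed \<open>C\<close>; the absolute
    value also keeps \<open>q\<close> at most 1, as the logarithmic bound demands.\<close>
  have "eventually (\<lambda>k. real (p k) / real (N k) + 1 / real (N k) < exp (- \<bar>C\<bar>)) sequentially"
    using shifted_ratio assms(1) by (intro order_tendstoD(2)) auto
  then show ?thesis
    using p_pos
  proof eventually_elim
    case (elim k)
    define q where "q = real (p k) / real (N k) + 1 / real (N k)"
    have N: "real (N k) > 0" "real (p k) > 0" using elim(2) pN[of k] by auto
    have q: "0 < q" "q < exp (- \<bar>C\<bar>)" using elim(1) N by (auto simp: q_def add_pos_pos)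
    have "exp (- \<bar>C\<bar>) \<le> 1" by simp
    then have q1: "q \<le> 1" using q by linarith
    have "ln q < ln (exp (- \<bar>C\<bar>))" using q by (subst ln_less_cancel_iff) auto
    then have "C \<le> - ln q" by simp
    also have "\<dots> \<le> tail_int \<kappa> q" by (rule tail_int_ge_ln[OF q(1) q1 assms(2)])
    also have "\<dots> \<le> powr_prim \<kappa> (real (N k) / real (N k) + 1 / real (N k)) - powr_prim \<kappa> q"
      unfolding tail_int_def using N powr_prim_strict_mono[of 1 "1 + 1 / real (N k)" \<kappa>] by (simp add: less_imp_le)
    also have "\<dots> \<le> real (N k) powr (\<kappa> - 1) * tail_sum \<kappa> (p k) (N k)"
      unfolding q_def by (rule normalized_tail_sum_bounds(1)[OF elim(2) pN \<kappa>])
    finally have "C * real (N k) powr (1 - \<kappa>)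
        \<le> real (N k) powr (\<kappa> - 1) * tail_sum \<kappa> (p k) (N k) * real (N k) powr (1 - \<kappa>)"
      by (rule mult_right_mono) simp
    also have "\<dots> = (real (N k) powr (\<kappa> - 1) * real (N k) powr (1 - \<kappa>)) * tail_sum \<kappa> (p k) (N k)"
      by (simp only: mult_ac)
    also have "real (N k) powr (\<kappa> - 1) * real (N k) powr (1 - \<kappa>) = 1"
      using N by (simp add: powr_add[symmetric])
    finally show ?case by simp
  qed
qed

end

text \<open>The error concentrates around the deterministic value \<open>m k\<close>, and
  \<open>m k\<close> is asymptotic to the limiting risk because \<open>1 + \<alpha> / (\<beta> -
  \<alpha>) = \<beta> / (\<beta> - \<alpha>)\<close>. The tolerance is divided equally between these
  two approximations.\<close>

lemma conv_p_mean_error: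
  fixes \<kappa> \<alpha> \<beta> \<sigma> :: real and n p N :: "nat \<Rightarrow> nat"
    and T :: "nat \<Rightarrow> (nat \<Rightarrow> real) measure" and lam :: "nat \<Rightarrow> nat \<Rightarrow> real"
  assumes \<kappa>: "\<kappa> > 0" and \<alpha>: "0 \<le> \<alpha>" "\<alpha> < \<beta>" and \<beta>: "0 < \<beta>" "\<beta> < 1"
    and fin: "\<alpha> > 0 \<or> \<kappa> < 1"
    and eig: "\<And>k j. j < N k \<Longrightarrow> lam k (Suc j) = real (Suc j) powr (- \<kappa>)"
    and T: "\<And>k. isotropic_law (N k) (T k)" and \<sigma>: "\<sigma>\<^sup>2 = 0" and pN: "\<And>k. p k \<le> N k"
    and lim: "filterlim p at_top sequentially" "filterlim N at_top sequentially"
      "(\<lambda>k. real (p k) / real (N k)) \<longlonglongrightarrow> \<alpha>" "(\<lambda>k. real (n k) / real (N k)) \<longlonglongrightarrow> \<beta>"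
  shows "conv_p (\<lambda>k. design_law (n k) (N k) (lam k)) (\<lambda>k. mean_error (n k) (p k) (N k) (lam k) \<sigma> (T k))
    (\<lambda>k. real (N k) powr (1 - \<kappa>) * risk_real \<kappa> \<beta> \<alpha>)"
  unfolding conv_p_def
proof (intro allI impI)
  fix \<epsilon> :: real assume \<epsilon>: "\<epsilon> > 0"
  define b where "b = risk_real \<kappa> \<beta> \<alpha>"
  have "\<alpha> > 0 \<or> \<alpha> = 0 \<and> \<kappa> < 1" using fin \<alpha>(1) by auto
  then have b: "b > 0" unfolding b_def by (rule risk_eq(3)[OF \<alpha>(2) \<beta>(2,1)])
  define d where "d k = real (n k) - real (p k) - 1" for k
  define c where "c k = real (p k) / d k" for k
  define \<Lambda> where "\<Lambda> k = (\<Sum>l\<in>{p k..<N k}. lam k (Suc l))" for k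
  have \<Lambda>: "\<Lambda> k = tail_sum \<kappa> (p k) (N k)" for k
    unfolding \<Lambda>_def tail_sum_def by (intro sum.cong refl eig) auto
  have Ntop: "filterlim (\<lambda>k. real (N k)) at_top sequentially"
    by (rule filterlim_compose[OF filterlim_real_sequentially lim(2)])
  have invN: "(\<lambda>k. 1 / real (N k)) \<longlonglongrightarrow> 0"
    by (rule tendsto_divide_0[OF tendsto_const filterlim_at_top_imp_at_infinity[OF Ntop]])
  have Npos: "eventually (\<lambda>k. real (N k) > 0) sequentially"
    using Ntop unfolding filterlim_at_top_dense by blast
  have dN: "(\<lambda>k. d k / real (N k)) \<longlonglongrightarrow> \<beta> - \<alpha>"
    using tendsto_diff[OF tendsto_diff[OF lim(4,3)] invN] by (simp add: d_def diff_divide_distrib)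
  have dtop: "filterlim d at_top sequentially"
  proof (rule filterlim_mono_eventually[OF _ order_refl order_refl])
    show "filterlim (\<lambda>k. d k / real (N k) * real (N k)) at_top sequentially"
      using \<alpha> by (intro filterlim_tendsto_pos_mult_at_top[OF dN _ Ntop]) simp
    show "eventually (\<lambda>k. d k / real (N k) * real (N k) = d k) sequentially"
      using Npos by eventually_elim simp
  qed
  have d1: "eventually (\<lambda>k. d k > 1) sequentially" using dtop unfolding filterlim_at_top_dense by blast
  have clim: "c \<longlonglongrightarrow> \<alpha> / (\<beta> - \<alpha>)"
  proof (rule Lim_transform_eventually)
    show "(\<lambda>k. (real (p k) / real (N k)) / (d k / real (N k))) \<longlonglongrightarrow> \<alpha> / (\<beta> - \<alpha>)"
      using \<alpha> by (intro tendsto_divide lim dN) simp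
    show "eventually (\<lambda>k. (real (p k) / real (N k)) / (d k / real (N k)) = c k) sequentially"
      using Npos by eventually_elim (simp add: c_def)
  qed
  define m where "m k = \<Lambda> k * (1 + c k)" for k
  have mlim: "(\<lambda>k. real (N k) powr (\<kappa> - 1) * m k) \<longlonglongrightarrow> b"
  proof -
    have "(\<lambda>k. real (N k) powr (\<kappa> - 1) * \<Lambda> k * (1 + c k)) \<longlonglongrightarrow> tail_int \<kappa> \<alpha> * (1 + \<alpha> / (\<beta> - \<alpha>))"
      unfolding \<Lambda> by (intro tendsto_mult tendsto_add tendsto_const clim
          tendsto_normalized_tail_sum[OF \<kappa> \<alpha>(1) pN lim(1-3) fin])
    moreover have "1 + \<alpha> / (\<beta> - \<alpha>) = \<beta> / (\<beta> - \<alpha>)" using \<alpha> by (simp add: field_simps)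
    ultimately show ?thesis by (simp add: m_def b_def risk_real_def mult.assoc)
  qed
  \<comment> \<open>The first bound spends half of the tolerance; the second ensures that
    \<open>m k\<close> is at most twice the target.\<close>
  have near: "eventually (\<lambda>k. \<bar>real (N k) powr (\<kappa> - 1) * m k - b\<bar> < min (\<epsilon> / 2 * b) b) sequentially"
    using tendstoD[OF mlim, of "min (\<epsilon> / 2 * b) b"] \<epsilon> b by (simp add: dist_real_def)
  have pltN: "eventually (\<lambda>k. p k < N k) sequentially"
  proof -
    have "eventually (\<lambda>k. real (p k) / real (N k) < 1) sequentially"
      using order_tendstoD(2)[OF lim(3), of 1] \<alpha> \<beta> by simp
    then show ?thesis using Npos by eventually_elim simp
  qed
  \<comment> \<open>As \<open>m k\<close> is at most twice the target, a relative deviation of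
    \<open>\<epsilon> / 4\<close> from \<open>m k\<close> costs at most the other half of the
    tolerance.\<close>
  define \<eta> where "\<eta> = \<epsilon> / 4"
  have \<eta>: "\<eta> > 0" using \<epsilon> by (simp add: \<eta>_def)
  define Pr where "Pr k = \<P>(x in design_law (n k) (N k) (lam k). \<bar>mean_error (n k) (p k) (N k) (lam k) \<sigma> (T k) x
      - real (N k) powr (1 - \<kappa>) * b\<bar> \<le> \<epsilon> * \<bar>real (N k) powr (1 - \<kappa>) * b\<bar>)" for k
  have bound: "eventually (\<lambda>k. 1 - (3 / 2 * (1 / sqrt (d k))) / \<eta> \<le> Pr k \<and> Pr k \<le> 1) sequentially"
    using near pltN d1 Npos
  proof eventually_elim
    case (elim k)
    define s where "s = real (N k) powr (1 - \<kappa>)"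
    have s: "s > 0" "s * real (N k) powr (\<kappa> - 1) = 1"
      using elim(4) by (auto simp: s_def powr_add[symmetric])
    \<comment> \<open>This choice balances the two error terms: as \<open>p \<le> n + 1\<close>, the
      second is at most \<open>1 / (2 \<delta> d)\<close>, half of the first, which explains the
      factor 3 / 2.\<close>
    define \<delta> where "\<delta> = 1 / sqrt (d k)"
    have dk: "d k > 1" by fact
    have \<delta>: "\<delta> > 0" using dk by (simp add: \<delta>_def)
    let ?D = "design_law (n k) (N k) (lam k)"
    let ?E = "mean_error (n k) (p k) (N k) (lam k) \<sigma> (T k)"
    have pn: "p k + 2 < n k" using dk by (simp add: d_def)
    have lampos: "\<forall>j<N k. lam k (Suc j) > 0" by (simp add: eig)
    have Lpos: "\<Lambda> k > 0"
      unfolding \<Lambda>_def using elim(2) lampos by (intro sum_pos) auto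
    note dev = prob_mean_error_deviation[OF \<sigma> pn pN T lampos _ \<delta> \<eta> Lpos[unfolded \<Lambda>_def]]
    have N0: "0 < N k" using elim(4) by simp
    interpret D: prob_space ?D by (rule dev(1)[OF N0])
    have "\<bar>s * (real (N k) powr (\<kappa> - 1) * m k) - s * b\<bar> = s * \<bar>real (N k) powr (\<kappa> - 1) * m k - b\<bar>"
      using s(1) by (simp add: right_diff_distrib[symmetric] abs_mult)
    then have "\<bar>m k - s * b\<bar> = s * \<bar>real (N k) powr (\<kappa> - 1) * m k - b\<bar>"
      by (simp add: mult.assoc[symmetric] s(2))
    also have "\<dots> \<le> s * min (\<epsilon> / 2 * b) b" using elim(1) s(1) by (intro mult_left_mono) auto
    finally have mb0: "\<bar>m k - s * b\<bar> \<le> s * min (\<epsilon> / 2 * b) b" .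
    have mb1: "\<bar>m k - s * b\<bar> \<le> \<epsilon> / 2 * (s * b)"
      using order_trans[OF mb0 mult_left_mono[of _ "\<epsilon> / 2 * b" s]] s(1) by (simp add: mult_ac)
    have mb2: "\<bar>m k - s * b\<bar> \<le> s * b"
      by (rule order_trans[OF mb0 mult_left_mono]) (use s(1) in auto)
    have sub: "{x \<in> space ?D. \<bar>?E x - m k\<bar> \<le> \<eta> * m k} \<subseteq> {x \<in> space ?D. \<bar>?E x - s * b\<bar> \<le> \<epsilon> * \<bar>s * b\<bar>}"
    proof safe
      fix x assume x: "\<bar>?E x - m k\<bar> \<le> \<eta> * m k"
      have "m k \<le> 2 * (s * b)" using mb2 by linarith
      then have "\<eta> * m k \<le> \<eta> * (2 * (s * b))" using \<eta> by (intro mult_left_mono) auto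
      also have "\<dots> = \<epsilon> / 2 * (s * b)" by (simp add: \<eta>_def)
      finally have "\<bar>?E x - m k\<bar> \<le> \<epsilon> / 2 * (s * b)" using x by linarith
      then have "\<bar>?E x - s * b\<bar> \<le> \<epsilon> * (s * b)" using mb1 by linarith
      then show "\<bar>?E x - s * b\<bar> \<le> \<epsilon> * \<bar>s * b\<bar>" using s(1) b by simp
    qed
    have mset: "{x \<in> space ?D. \<bar>?E x - s * b\<bar> \<le> \<epsilon> * \<bar>s * b\<bar>} \<in> sets ?D"
      by (intro borel_measurable_le borel_measurable_abs borel_measurable_diff borel_measurable_const dev(2)[OF N0])
    have "\<delta> + real (p k) / (2 * \<delta> * (real (n k) + 1) * (real (n k) - real (p k) - 1)) \<le> 3 / 2 * (1 / sqrt (d k))"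
    proof -
      have "real (p k) / (2 * \<delta> * (real (n k) + 1) * d k) = (real (p k) / (real (n k) + 1)) * (1 / (2 * \<delta> * d k))"
        by simp
      also have "\<dots> \<le> 1 * (1 / (2 * \<delta> * d k))"
        using pn \<delta> dk by (intro mult_right_mono) auto
      also have "\<dots> = 1 / 2 * (1 / sqrt (d k))"
      proof -
        have "\<delta> * d k = sqrt (d k)" using dk by (simp add: \<delta>_def real_div_sqrt)
        then show ?thesis by (simp add: mult.assoc)
      qed
      finally show ?thesis by (simp add: \<delta>_def d_def)
    qed
    then have "1 - (3 / 2 * (1 / sqrt (d k))) / \<eta>
        \<le> 1 - (\<delta> + real (p k) / (2 * \<delta> * (real (n k) + 1) * (real (n k) - real (p k) - 1))) / \<eta>"
      using \<eta> by (intro diff_left_mono divide_right_mono) auto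
    also have "\<dots> \<le> measure ?D {x \<in> space ?D. \<bar>?E x - m k\<bar> \<le> \<eta> * m k}"
      using dev(3)[OF N0] by (simp only: m_def c_def d_def \<Lambda>_def)
    also have "\<dots> \<le> measure ?D {x \<in> space ?D. \<bar>?E x - s * b\<bar> \<le> \<epsilon> * \<bar>s * b\<bar>}"
      by (rule D.finite_measure_mono[OF sub mset])
    finally show ?case by (simp add: Pr_def s_def)
  qed
  have "Pr \<longlonglongrightarrow> 1"
  proof (rule tendsto_sandwich)
    have "(\<lambda>k. 1 / sqrt (d k)) \<longlonglongrightarrow> 0"
      by (rule tendsto_divide_0[OF tendsto_const filterlim_at_top_imp_at_infinity[OF filterlim_compose[OF sqrt_at_top dtop]]])
    then have "(\<lambda>k. 1 - (3 / 2 * (1 / sqrt (d k))) / \<eta>) \<longlonglongrightarrow> 1 - (3 / 2 * 0) / \<eta>"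
      using \<eta> by (intro tendsto_intros) auto
    then show "(\<lambda>k. 1 - (3 / 2 * (1 / sqrt (d k))) / \<eta>) \<longlonglongrightarrow> 1" by simp
    show "(\<lambda>k. 1 :: real) \<longlonglongrightarrow> 1" by simp
  qed (use bound in eventually_elim, simp)+
  then show "(\<lambda>k. \<P>(x in design_law (n k) (N k) (lam k). \<bar>mean_error (n k) (p k) (N k) (lam k) \<sigma> (T k) x
      - real (N k) powr (1 - \<kappa>) * risk_real \<kappa> \<beta> \<alpha>\<bar> \<le> \<epsilon> * \<bar>real (N k) powr (1 - \<kappa>) * risk_real \<kappa> \<beta> \<alpha>\<bar>)) \<longlonglongrightarrow> 1"
    by (simp only: Pr_def[abs_def] b_def)
qed

text \<open>If the risk coefficient is infinite, a relative error around the limit has no meaning.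
  Convergence is then expressed by the normalized error exceeding every constant with probability
  tending to 1.\<close>

theorem theorem1:
  fixes \<kappa> \<alpha> \<beta> \<sigma> :: real
    and n p N :: "nat \<Rightarrow> nat"
    and T :: "nat \<Rightarrow> (nat \<Rightarrow> real) measure"
    and lam :: "nat \<Rightarrow> nat \<Rightarrow> real"
  assumes "\<kappa> > 0" and "\<alpha> \<in> {0..1}" and "\<beta> \<in> {0<..<1}" and "\<alpha> < \<beta>"
    and eigenvalues: "\<And>k j. j \<in> {1..N k} \<Longrightarrow> lam k j = real j powr (- \<kappa>)"
    and coefficients: "\<And>k. isotropic_law (N k) (T k)"
    and noiseless: "\<sigma>\<^sup>2 = 0"
    and "\<And>k. p k \<le> N k"
    and "filterlim n at_top sequentially"
    and "filterlim p at_top sequentially"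
    and "filterlim N at_top sequentially"
    and "(\<lambda>k. real (p k) / real (N k)) \<longlonglongrightarrow> \<alpha>"
    and "(\<lambda>k. real (n k) / real (N k)) \<longlonglongrightarrow> \<beta>"
  shows "(risk_coeff \<kappa> \<beta> \<alpha> < \<infinity> \<longrightarrow>
           conv_p (\<lambda>k. design_law (n k) (N k) (lam k))
             (\<lambda>k. mean_error (n k) (p k) (N k) (lam k) \<sigma> (T k))
             (\<lambda>k. enn2real (risk \<kappa> \<beta> (N k) \<alpha>))) \<and>
         (risk_coeff \<kappa> \<beta> \<alpha> = \<infinity> \<longrightarrow>
           (\<forall>C. (\<lambda>k. \<P>(x in design_law (n k) (N k) (lam k).
                   mean_error (n k) (p k) (N k) (lam k) \<sigma> (T k) x
                     \<ge> C * real (N k) powr (1 - \<kappa>))) \<longlonglongrightarrow> 1)) \<and>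
         (\<exists>!a. a \<in> {0<..<\<beta>} \<and> h_fun \<kappa> \<beta> a = 0) \<and>
         (\<forall>\<alpha>s\<in>{0<..<\<beta>}. h_fun \<kappa> \<beta> \<alpha>s = 0 \<longrightarrow>
           (\<forall>m::nat. m \<ge> 1 \<longrightarrow>
              strict_antimono_on {0..<\<alpha>s} (risk \<kappa> \<beta> m) \<and>
              strict_mono_on {\<alpha>s<..<\<beta>} (risk \<kappa> \<beta> m) \<and>
              risk \<kappa> \<beta> m \<alpha>s = (INF a\<in>{0..<\<beta>}. risk \<kappa> \<beta> m a) \<and>
              risk \<kappa> \<beta> m \<alpha>s = ennreal (real m powr (1 - \<kappa>) * (\<beta> / \<alpha>s powr \<kappa>))))"
proof (intro conjI)
  have \<alpha>: "0 \<le> \<alpha>" and \<beta>: "0 < \<beta>" "\<beta> < 1" using assms(2,3) by auto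
  have eig: "lam k (Suc j) = real (Suc j) powr (- \<kappa>)" if "j < N k" for k j
    using that by (intro eigenvalues) auto
  have root: "h_fun \<kappa> \<beta> a = 0 \<longleftrightarrow> risk_slope \<kappa> \<beta> a = 0" if "a \<in> {0<..<\<beta>}" for a
    using that \<beta> by (subst h_fun_eq) auto
  show "risk_coeff \<kappa> \<beta> \<alpha> < \<infinity> \<longrightarrow>
           conv_p (\<lambda>k. design_law (n k) (N k) (lam k))
             (\<lambda>k. mean_error (n k) (p k) (N k) (lam k) \<sigma> (T k))
             (\<lambda>k. enn2real (risk \<kappa> \<beta> (N k) \<alpha>))"
  proof
    assume "risk_coeff \<kappa> \<beta> \<alpha> < \<infinity>"
    then have fin: "\<alpha> > 0 \<or> \<kappa> < 1"
      using risk_coeff_0_top(1)[OF _ \<beta>(1), of \<kappa>] \<alpha> by (cases "\<alpha> = 0"; cases "\<kappa> \<ge> 1") auto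
    then have "\<alpha> > 0 \<or> \<alpha> = 0 \<and> \<kappa> < 1" using \<alpha> by auto
    note r = risk_eq[OF assms(4) \<beta>(2,1) this]
    have "enn2real (risk \<kappa> \<beta> (N k) \<alpha>) = real (N k) powr (1 - \<kappa>) * risk_real \<kappa> \<beta> \<alpha>" for k
      unfolding r(1) using r(3) by (simp add: less_imp_le)
    then show "conv_p (\<lambda>k. design_law (n k) (N k) (lam k))
             (\<lambda>k. mean_error (n k) (p k) (N k) (lam k) \<sigma> (T k))
             (\<lambda>k. enn2real (risk \<kappa> \<beta> (N k) \<alpha>))"
      using conv_p_mean_error[OF assms(1) \<alpha> assms(4) \<beta> fin eig coefficients noiseless assms(8,10-13)] by simp
  qed
  show "risk_coeff \<kappa> \<beta> \<alpha> = \<infinity> \<longrightarrow>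
           (\<forall>C. (\<lambda>k. \<P>(x in design_law (n k) (N k) (lam k).
                   mean_error (n k) (p k) (N k) (lam k) \<sigma> (T k) x
                     \<ge> C * real (N k) powr (1 - \<kappa>))) \<longlonglongrightarrow> 1)"
  proof (intro impI allI)
    fix C assume top: "risk_coeff \<kappa> \<beta> \<alpha> = \<infinity>"
    \<comment> \<open>In every other case the risk coefficient equals a real number.\<close>
    have inf: "\<alpha> = 0" "\<kappa> \<ge> 1"
      using top risk_eq(2)[of \<alpha> \<beta> \<kappa>] \<alpha> \<beta> assms(4) by (force simp: not_le)+
    have "eventually (\<lambda>k. real (p k) / real (N k) < real (n k) / real (N k)) sequentially"
    proof -
      have "eventually (\<lambda>k. real (n k) / real (N k) - real (p k) / real (N k) > 0) sequentially"
        using order_tendstoD(1)[OF tendsto_diff[OF assms(13,12)], of 0] assms(4) by simp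
      then show ?thesis by eventually_elim simp
    qed
    \<comment> \<open>The lower bound holds for every design, so the probability is eventually
      exactly 1.\<close>
    then have "eventually (\<lambda>k. 1 = \<P>(x in design_law (n k) (N k) (lam k).
                   mean_error (n k) (p k) (N k) (lam k) \<sigma> (T k) x \<ge> C * real (N k) powr (1 - \<kappa>))) sequentially"
      using eventually_tail_sum_ge[OF assms(1) \<alpha> assms(8,10-12) inf, of C]
    proof eventually_elim
      case (elim k)
      let ?D = "design_law (n k) (N k) (lam k)"
      interpret prob_space ?D
        unfolding design_law_def by (intro prob_space_PiM prob_space_covariate_law)
      \<comment> \<open>If \<open>N k = 0\<close>, both quotients are 0 by convention and their
        strict inequality is contradictory.\<close>
      have pn: "p k \<le> n k"
        using elim(1) by (cases "N k = 0") (auto simp: divide_less_cancel)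
      have lam0: "\<forall>j<N k. lam k (Suc j) \<ge> 0" by (simp add: eig)
      have "(\<Sum>l\<in>{p k..<N k}. lam k (Suc l)) = tail_sum \<kappa> (p k) (N k)"
        unfolding tail_sum_def by (intro sum.cong refl eig) auto
      then have "mean_error (n k) (p k) (N k) (lam k) \<sigma> (T k) x \<ge> C * real (N k) powr (1 - \<kappa>)" for x
        using mean_error_ge_tail[OF noiseless pn assms(8) lam0 coefficients, of x] elim(2) by simp
      then show ?case by (simp add: prob_space)
    qed
    then show "(\<lambda>k. \<P>(x in design_law (n k) (N k) (lam k).
                   mean_error (n k) (p k) (N k) (lam k) \<sigma> (T k) x \<ge> C * real (N k) powr (1 - \<kappa>))) \<longlonglongrightarrow> 1"
      by (rule Lim_transform_eventually[OF tendsto_const])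
  qed
  show "\<exists>!a. a \<in> {0<..<\<beta>} \<and> h_fun \<kappa> \<beta> a = 0"
    using risk_slope_root[OF assms(1) \<beta>] root by metis
  show "\<forall>\<alpha>s\<in>{0<..<\<beta>}. h_fun \<kappa> \<beta> \<alpha>s = 0 \<longrightarrow>
           (\<forall>m::nat. m \<ge> 1 \<longrightarrow>
              strict_antimono_on {0..<\<alpha>s} (risk \<kappa> \<beta> m) \<and>
              strict_mono_on {\<alpha>s<..<\<beta>} (risk \<kappa> \<beta> m) \<and>
              risk \<kappa> \<beta> m \<alpha>s = (INF a\<in>{0..<\<beta>}. risk \<kappa> \<beta> m a) \<and>
              risk \<kappa> \<beta> m \<alpha>s = ennreal (real m powr (1 - \<kappa>) * (\<beta> / \<alpha>s powr \<kappa>)))"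
  proof (intro ballI impI allI)
    fix s and m :: nat
    assume s: "s \<in> {0<..<\<beta>}" "h_fun \<kappa> \<beta> s = 0" and m: "1 \<le> m"
    note shape = risk_shape[OF assms(1) \<beta> s(1) root[OF s(1), THEN iffD1, OF s(2)] m]
    show "strict_antimono_on {0..<s} (risk \<kappa> \<beta> m) \<and> strict_mono_on {s<..<\<beta>} (risk \<kappa> \<beta> m) \<and>
        risk \<kappa> \<beta> m s = (INF a\<in>{0..<\<beta>}. risk \<kappa> \<beta> m a) \<and>
        risk \<kappa> \<beta> m s = ennreal (real m powr (1 - \<kappa>) * (\<beta> / s powr \<kappa>))"
      using shape by (intro conjI)
  qed
qed

end
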